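(* Let $g\in\mathcal{G}$ and let $G(t)=\int_0^tg(s)\,ds$ be its primitive. If $\mathcal{I}_g\subset\mathcal{Z}_G$, then every extended zeta-function residue on $\mathcal{I}_g$ is proportional to (i.e. a scalar multiple of) a Dixmier trace.
   Context: $H$ is a complex separable infinite-dimensional Hilbert space; $\mathcal{C}_0(H)$ are the compact operators; $\mathrm{Tr}$ is the standard trace; $\mu(n,T)$, $n\ge0$, are the singular values of $T\in\mathcal{C}_0(H)$ in non-increasing order. $\mathcal{G}$ is the set of all decreasing functions $g:[0,\infty)\to(0,\infty)$ vanishing at $+\infty$ with $g\notin L_1(0,\infty)$ and $\lim_{t\to\infty}\frac{g(2t)}{g(t)}=\frac12$. For $g\in\mathcal{G}$ with primitive $G$: $\mathcal{I}_g:=\{T\in\mathcal{C}_0(H):\mu(n,T)=O(g(n))\}$; the Lorentz ideal is $\mathcal{M}_G:=\{T\in\mathcal{C}_0(H):\sup_{n\ge0}\frac{1}{G(n+1)}\sum_{k=0}^n\mu(k,T)<\infty\}\supset\mathcal{I}_g$; and $\mathcal{Z}_G:=\{T\in\mathcal{C}_0(H):\limsup_{t\to\infty}\frac{1}{G(e^t)}\mathrm{Tr}(|T|^{1+1/t})<\infty\}$. $EL(\mathbb{N})$ is the set of positive linear functionals on the real space $\ell_\infty$ which equal the limit on every convergent sequence. A Dixmier trace on $\mathcal{M}_G$ is a linear extension of $\mathrm{Tr}_\omega(T)=\omega\big(n\mapsto\frac{1}{G(n+1)}\sum_{j=0}^n\mu(j,T)\big)$, $0\le T\in\mathcal{M}_G$,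 for some $\omega\in EL(\mathbb{N})$ invariant under the dilation $(x_0,x_1,\dots)\mapsto(x_0,x_0,x_1,x_1,\dots)$. Dixmier traces on $\mathcal{I}_g$ are restrictions to $\mathcal{I}_g$ of Dixmier traces on $\mathcal{M}_G$. $EL(0,\infty)$ is the set of positive linear functionals $\gamma$ on real $L_\infty(0,\infty)$ with $\gamma(f)=\mathrm{ess}\lim_{t\to\infty}f(t)$ whenever this limit exists. If $f$ is measurable and bounded on $(t_0,\infty)$ for some $t_0>0$, then $\gamma(f):=\gamma(f\chi_{(t_0,\infty)})$. For $\gamma\in EL(0,\infty)$ the extended zeta-function residue is $\zeta_\gamma(T):=\gamma\big(t\mapsto\frac{1}{G(e^t)}\mathrm{Tr}(T^{1+1/t})\big)$, $0\le T\in\mathcal{Z}_G$, extended linearly by $\zeta_\gamma(T)=\zeta_\gamma((\Re T)_+)-\zeta_\gamma((\Re T)_-)+i\zeta_\gamma((\Im T)_+)-i\zeta_\gamma((\Im T)_-)$; an extended zeta-function residue on $\mathcal{I}_g$ is the restriction of some $\zeta_\gamma$ to $\mathcal{I}_g$. *)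

theory Defs
  imports "HOL-Analysis.Analysis" "HOL-Library.Landau_Symbols"
begin

section \<open>Complex Hilbert spaces\<close>

text \<open>
  A complex Hilbert space is presented as a real one (which supplies norm, topology and
  completeness) with a complex scalar multiplication extending the real one and a sesquilinear
  form, antilinear in the first argument, whose real part is the real inner product.
\<close>

class complex_hilbert_space = real_inner + complete_space +
  fixes scaleC :: "complex \<Rightarrow> 'a \<Rightarrow> 'a" (infixr "*\<^sub>C" 75)
    and cinner :: "'a \<Rightarrow> 'a \<Rightarrow> complex"
  assumes scaleC_add_right: "c *\<^sub>C (x + y) = c *\<^sub>C x + c *\<^sub>C y"
    and scaleC_add_left: "(c + d) *\<^sub>C x = c *\<^sub>C x + d *\<^sub>C x"
    and scaleC_scaleC: "c *\<^sub>C d *\<^sub>C x = (c * d) *\<^sub>C x"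
    and scaleC_of_real: "complex_of_real r *\<^sub>C x = r *\<^sub>R x"
    and cinner_commute: "cinner x y = cnj (cinner y x)"
    and cinner_add_right: "cinner x (y + z) = cinner x y + cinner x z"
    and cinner_scaleC_right: "cinner x (c *\<^sub>C y) = c * cinner x y"
    and Re_cinner: "Re (cinner x y) = inner x y"

global_interpretation cvec: vector_space "scaleC :: complex \<Rightarrow> 'a \<Rightarrow> 'a::complex_hilbert_space"
proof
  show "1 *\<^sub>C x = x" for x :: 'a
    using scaleC_of_real[of 1 x] by simp
qed (simp_all add: scaleC_add_right scaleC_add_left scaleC_scaleC)

definition is_onb :: "'a::complex_hilbert_space set \<Rightarrow> bool" where
  "is_onb B \<longleftrightarrow>
     (\<forall>x\<in>B. \<forall>y\<in>B. cinner x y = (if x = y then 1 else 0)) \<and> closure (cvec.span B) = UNIV"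


section \<open>Operators\<close>

definition bounded_op :: "('a::complex_hilbert_space \<Rightarrow> 'a) \<Rightarrow> bool" where
  "bounded_op T \<longleftrightarrow> bounded_linear T \<and> (\<forall>c x. T (c *\<^sub>C x) = c *\<^sub>C T x)"

definition compact_op :: "('a::complex_hilbert_space \<Rightarrow> 'a) \<Rightarrow> bool" where
  "compact_op T \<longleftrightarrow> bounded_op T \<and> compact (closure (T ` cball 0 1))"

definition positive_op :: "('a::complex_hilbert_space \<Rightarrow> 'a) \<Rightarrow> bool" where
  "positive_op T \<longleftrightarrow> bounded_op T \<and> (\<forall>x. cinner x (T x) \<in> \<real>\<^sub>\<ge>\<^sub>0)"

definition adj_op :: "('a::complex_hilbert_space \<Rightarrow> 'a) \<Rightarrow> ('a \<Rightarrow> 'a)" where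
  "adj_op T = (THE S. \<forall>x y. cinner (T x) y = cinner x (S y))"

definition abs_op :: "('a::complex_hilbert_space \<Rightarrow> 'a) \<Rightarrow> ('a \<Rightarrow> 'a)" where
  "abs_op T = (THE P. positive_op P \<and> P \<circ> P = adj_op T \<circ> T)"

definition Re_op :: "('a::complex_hilbert_space \<Rightarrow> 'a) \<Rightarrow> ('a \<Rightarrow> 'a)" where
  "Re_op T = (\<lambda>x. (1/2) *\<^sub>C (T x + adj_op T x))"

definition Im_op :: "('a::complex_hilbert_space \<Rightarrow> 'a) \<Rightarrow> ('a \<Rightarrow> 'a)" where
  "Im_op T = (\<lambda>x. (1 / (2 * \<i>)) *\<^sub>C (T x - adj_op T x))"

text \<open>The next two are meant for self-adjoint operators.\<close>

definition pos_part_op :: "('a::complex_hilbert_space \<Rightarrow> 'a) \<Rightarrow> ('a \<Rightarrow> 'a)" where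
  "pos_part_op A = (\<lambda>x. (1/2) *\<^sub>C (abs_op A x + A x))"

definition neg_part_op :: "('a::complex_hilbert_space \<Rightarrow> 'a) \<Rightarrow> ('a \<Rightarrow> 'a)" where
  "neg_part_op A = (\<lambda>x. (1/2) *\<^sub>C (abs_op A x - A x))"

text \<open>
  Functional calculus for a compact positive operator and an exponent \<open>p > 0\<close>: the eigenvectors
  (those for the eigenvalue 0 included; note \<open>0 powr p = 0\<close>) span a dense subspace, so the bounded
  operator \<open>A\<close> below is determined by its action on them.
\<close>

definition powr_op :: "('a::complex_hilbert_space \<Rightarrow> 'a) \<Rightarrow> real \<Rightarrow> ('a \<Rightarrow> 'a)" where
  "powr_op T p =
     (THE A. bounded_op A \<and> (\<forall>a x. a \<ge> 0 \<and> T x = a *\<^sub>R x \<longrightarrow> A x = (a powr p) *\<^sub>R x))"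

text \<open>
  The trace of a positive operator, possibly infinite.  The sum does not depend on the choice
  of the orthonormal basis.
\<close>

definition trace_op :: "('a::complex_hilbert_space \<Rightarrow> 'a) \<Rightarrow> ennreal" where
  "trace_op A = (\<Sum>\<^sub>\<infinity>e\<in>(SOME B. is_onb B). ennreal (Re (cinner e (A e))))"

text \<open>
  The singular values of a compact operator: the eigenvalues of \<open>\<bar>T\<bar>\<close> in non-increasing order,
  each positive one repeated according to its multiplicity.  The list is continued by zeros exactly
  when \<open>T\<close> has finite rank.
\<close>

definition singular_value :: "('a::complex_hilbert_space \<Rightarrow> 'a) \<Rightarrow> nat \<Rightarrow> real" where
  "singular_value T =
     (THE s. decseq s \<and> (\<forall>n. s n \<ge> 0) \<and>
        (\<forall>a>0. finite {n. s n = a} \<and>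
               card {n. s n = a} = cvec.dim {x. abs_op T x = a *\<^sub>R x}))"


section \<open>The function class and the ideals\<close>

definition decay_class :: "(real \<Rightarrow> real) set" where
  "decay_class =
     {g. antimono_on {0..} g \<and> (\<forall>t\<ge>0. g t > 0) \<and> (g \<longlongrightarrow> 0) at_top \<and>
         \<not> g absolutely_integrable_on {0<..} \<and>
         ((\<lambda>t. g (2 * t) / g t) \<longlongrightarrow> 1/2) at_top}"

definition ideal_I :: "(real \<Rightarrow> real) \<Rightarrow> ('a::complex_hilbert_space \<Rightarrow> 'a) set" where
  "ideal_I g = {T. compact_op T \<and> singular_value T \<in> O(\<lambda>n. g (real n))}"

definition lorentz_avg :: "(real \<Rightarrow> real) \<Rightarrow> ('a::complex_hilbert_space \<Rightarrow> 'a) \<Rightarrow> nat \<Rightarrow> real" where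
  "lorentz_avg G T n = 1 / G (real (n + 1)) * (\<Sum>k\<le>n. singular_value T k)"

definition lorentz_M :: "(real \<Rightarrow> real) \<Rightarrow> ('a::complex_hilbert_space \<Rightarrow> 'a) set" where
  "lorentz_M G = {T. compact_op T \<and> bdd_above (range (lorentz_avg G T))}"

definition ideal_Z :: "(real \<Rightarrow> real) \<Rightarrow> ('a::complex_hilbert_space \<Rightarrow> 'a) set" where
  "ideal_Z G =
     {T. compact_op T \<and>
         Limsup at_top (\<lambda>t::real. trace_op (powr_op (abs_op T) (1 + 1/t)) / ennreal (G (exp t)))
           < \<infinity>}"


section \<open>Dixmier traces\<close>

definition EL_nat :: "((nat \<Rightarrow> real) \<Rightarrow> real) set" where
  "EL_nat =
     {\<omega>. (\<forall>x y. Bseq x \<and> Bseq y \<longrightarrow> \<omega> (\<lambda>n. x n + y n) = \<omega> x + \<omega> y) \<and>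
         (\<forall>c x. Bseq x \<longrightarrow> \<omega> (\<lambda>n. c * x n) = c * \<omega> x) \<and>
         (\<forall>x. Bseq x \<and> (\<forall>n. x n \<ge> 0) \<longrightarrow> \<omega> x \<ge> 0) \<and>
         (\<forall>x l. x \<longlonglongrightarrow> l \<longrightarrow> \<omega> x = l)}"

definition dilation_invariant :: "((nat \<Rightarrow> real) \<Rightarrow> real) \<Rightarrow> bool" where
  "dilation_invariant \<omega> \<longleftrightarrow> (\<forall>x. Bseq x \<longrightarrow> \<omega> (\<lambda>n. x (n div 2)) = \<omega> x)"

text \<open>
  Functionals on a set of operators are total functions whose values outside the set are
  irrelevant.
\<close>

definition linear_functional_on ::
    "('a::complex_hilbert_space \<Rightarrow> 'a) set \<Rightarrow> (('a \<Rightarrow> 'a) \<Rightarrow> complex) \<Rightarrow> bool" where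
  "linear_functional_on V \<phi> \<longleftrightarrow>
     (\<forall>S\<in>V. \<forall>T\<in>V. \<phi> (\<lambda>x. S x + T x) = \<phi> S + \<phi> T) \<and>
     (\<forall>c. \<forall>T\<in>V. \<phi> (\<lambda>x. c *\<^sub>C T x) = c * \<phi> T)"

definition dixmier_trace ::
    "(real \<Rightarrow> real) \<Rightarrow> (('a::complex_hilbert_space \<Rightarrow> 'a) \<Rightarrow> complex) \<Rightarrow> bool" where
  "dixmier_trace G \<phi> \<longleftrightarrow>
     (\<exists>\<omega>\<in>EL_nat. dilation_invariant \<omega> \<and> linear_functional_on (lorentz_M G) \<phi> \<and>
        (\<forall>T\<in>lorentz_M G. positive_op T \<longrightarrow> \<phi> T = complex_of_real (\<omega> (lorentz_avg G T))))"

definition dixmier_trace_on_I ::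
    "(real \<Rightarrow> real) \<Rightarrow> (real \<Rightarrow> real) \<Rightarrow> (('a::complex_hilbert_space \<Rightarrow> 'a) \<Rightarrow> complex) \<Rightarrow> bool" where
  "dixmier_trace_on_I g G \<phi> \<longleftrightarrow> (\<exists>\<psi>. dixmier_trace G \<psi> \<and> (\<forall>T\<in>ideal_I g. \<phi> T = \<psi> T))"


section \<open>Extended zeta-function residues\<close>

definition Linf :: "(real \<Rightarrow> real) set" where
  "Linf = {f. f \<in> borel_measurable (lebesgue_on {0<..}) \<and>
              (\<exists>C. AE t in lebesgue_on {0<..}. \<bar>f t\<bar> \<le> C)}"

definition ess_lim_at_top :: "(real \<Rightarrow> real) \<Rightarrow> real \<Rightarrow> bool" where
  "ess_lim_at_top f l \<longleftrightarrow>
     (\<forall>\<epsilon>>0. \<exists>t0. AE t in lebesgue_on {0<..}. t > t0 \<longrightarrow> \<bar>f t - l\<bar> < \<epsilon>)"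

text \<open>
  Functionals on \<open>L\<^sub>\<infinity>(0,\<infinity>)\<close> are given on representatives.  Positivity is required for almost
  everywhere non-negative functions, which with linearity forces equal values on functions that
  agree almost everywhere.
\<close>

definition EL_half_line :: "((real \<Rightarrow> real) \<Rightarrow> real) set" where
  "EL_half_line =
     {\<gamma>. (\<forall>f\<in>Linf. \<forall>h\<in>Linf. \<gamma> (\<lambda>t. f t + h t) = \<gamma> f + \<gamma> h) \<and>
         (\<forall>c. \<forall>f\<in>Linf. \<gamma> (\<lambda>t. c * f t) = c * \<gamma> f) \<and>
         (\<forall>f\<in>Linf. (AE t in lebesgue_on {0<..}. f t \<ge> 0) \<longrightarrow> \<gamma> f \<ge> 0) \<and>
         (\<forall>f\<in>Linf. \<forall>l. ess_lim_at_top f l \<longrightarrow> \<gamma> f = l)}"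

text \<open>
  Evaluation on functions that are measurable and bounded only near infinity; for
  \<open>\<gamma> \<in> EL_half_line\<close> the value does not depend on the choice of \<open>t0\<close>.
\<close>

definition EL_eval :: "((real \<Rightarrow> real) \<Rightarrow> real) \<Rightarrow> (real \<Rightarrow> real) \<Rightarrow> real" where
  "EL_eval \<gamma> f =
     (let t0 = (SOME t0. t0 > 0 \<and> f \<in> borel_measurable (lebesgue_on {t0<..}) \<and>
                         bounded (f ` {t0<..}))
      in \<gamma> (\<lambda>t. f t * indicator {t0<..} t))"

text \<open>For \<open>T\<close> in \<open>ideal_Z G\<close> the trace below is finite for all large \<open>t\<close>.\<close>

definition zeta_pos ::
    "(real \<Rightarrow> real) \<Rightarrow> ((real \<Rightarrow> real) \<Rightarrow> real) \<Rightarrow> ('a::complex_hilbert_space \<Rightarrow> 'a) \<Rightarrow> real" where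
  "zeta_pos G \<gamma> T =
     EL_eval \<gamma> (\<lambda>t. 1 / G (exp t) * enn2real (trace_op (powr_op T (1 + 1/t))))"

definition zeta_residue ::
    "(real \<Rightarrow> real) \<Rightarrow> ((real \<Rightarrow> real) \<Rightarrow> real) \<Rightarrow> ('a::complex_hilbert_space \<Rightarrow> 'a) \<Rightarrow> complex" where
  "zeta_residue G \<gamma> T =
     complex_of_real (zeta_pos G \<gamma> (pos_part_op (Re_op T)))
     - complex_of_real (zeta_pos G \<gamma> (neg_part_op (Re_op T)))
     + \<i> * complex_of_real (zeta_pos G \<gamma> (pos_part_op (Im_op T)))
     - \<i> * complex_of_real (zeta_pos G \<gamma> (neg_part_op (Im_op T)))"

definition zeta_residue_on_I ::
    "(real \<Rightarrow> real) \<Rightarrow> (real \<Rightarrow> real) \<Rightarrow> (('a::complex_hilbert_space \<Rightarrow> 'a) \<Rightarrow> complex) \<Rightarrow> bool" where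
  "zeta_residue_on_I g G \<zeta> \<longleftrightarrow>
     (\<exists>\<gamma>\<in>EL_half_line. \<forall>T\<in>ideal_I g. \<zeta> T = zeta_residue G \<gamma> T)"

end

theory Submission
  imports Defs
begin

text \<open>
  Why the theorem holds.  Let \<open>T \<ge> 0\<close> be in the ideal of \<open>g\<close>, with singular values \<open>s(n) \<le> C g(n)\<close>.

  First, the residue is secretly linear in the singular values.  Since \<open>b\<^bsup>1+h\<^esup>\<close> tends to \<open>b\<close> uniformly on
  bounded sets, \<open>s(n)\<^bsup>1+1/t\<^esup>\<close> may be replaced by \<open>s(n) g(n)\<^bsup>1/t\<^esup>\<close>; the error is controlled by the zeta
  function of the sequence \<open>g(n)\<close>, which is \<open>O(G(e\<^sup>t))\<close> because the diagonal operator with entries \<open>g(n)\<close>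
  lies in the ideal of \<open>g\<close> and hence in the domain of the residues.  Summation by parts turns \<open>\<Sum> s(n) g(n)\<^bsup>1/t\<^esup>\<close> into
  \<open>\<Sum> (g(n)\<^bsup>1/t\<^esup> - g(n+1)\<^bsup>1/t\<^esup>) G(n+1) x(n)\<close>, where \<open>x(n) = (s(0) + \<dots> + s(n)) / G(n+1)\<close> is the very sequence
  to which a Dixmier trace applies its state.  The coefficients are non-negative, so the residue of \<open>T\<close>
  is \<open>\<Omega>(x)\<close> for a positive functional \<open>\<Omega>\<close> on bounded sequences with \<open>\<Omega>(x) = \<Omega>(1) lim x\<close> for convergent
  \<open>x\<close>; this is \<open>zeta_eval\<close>.

  Second, if \<open>\<Omega>(1) \<noteq> 0\<close>, the state \<open>\<Omega> / \<Omega>(1)\<close> can be made dilation invariant by averaging it over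
  iterated dilations.  The averages \<open>x\<close> do not notice, because \<open>G(2t)/G(t)\<close> tends to \<open>1\<close> and therefore
  \<open>x(n) - x(n div 2)\<close> tends to \<open>0\<close> (\<open>avg_slow\<close>, \<open>dilation_mean\<close>).  If \<open>\<Omega>(1) = 0\<close>, positivity makes the
  residue vanish, and any Dixmier trace serves with the factor \<open>0\<close>.

  Third, a dilation-invariant state does define a linear functional on the whole Lorentz ideal.  On
  the positive cone this is the classical argument with the two Ky Fan inequalities
  \<open>\<sigma>\<^sub>n(A + B) \<le> \<sigma>\<^sub>n(A) + \<sigma>\<^sub>n(B) \<le> \<sigma>\<^bsub>2n\<^esub>(A + B)\<close> for sums of the first \<open>n\<close> singular values; the extension by
  real, imaginary, positive and negative parts has the same form as the residue, so proportionality on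
  positive operators carries over to the ideal of \<open>g\<close>, which contains those parts.

  The operator theory rests on the spectral theorem for compact self-adjoint operators.  Everything
  defined through eigenvalues (absolute values, powers, singular values, traces) is computed on
  diagonal operators \<open>\<Sum> a\<^sub>n \<langle>e\<^sub>n, \<cdot>\<rangle> e\<^sub>n\<close>, and inequalities between singular values of different operators
  come from variational descriptions.
\<close>



section \<open>Geometry of a complex Hilbert space\<close>

instance complex_hilbert_space \<subseteq> banach ..

lemma cinner_add_left: "cinner (x + y) z = cinner x z + cinner y z"
  by (metis cinner_commute cinner_add_right complex_cnj_add)

lemma cinner_scaleC_left: "cinner (c *\<^sub>C x) y = cnj c * cinner x y"
  by (metis cinner_commute cinner_scaleC_right complex_cnj_mult)

lemma cinner_zero_right [simp]: "cinner x 0 = 0"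
  using cinner_add_right[of x 0 0] by simp

lemma cinner_zero_left [simp]: "cinner 0 x = 0"
  using cinner_add_left[of 0 0 x] by simp

lemma cinner_minus_right: "cinner x (- y) = - cinner x y"
  by (metis add_eq_0_iff cinner_add_right cinner_zero_right)

lemma cinner_minus_left: "cinner (- x) y = - cinner x y"
  by (metis add_eq_0_iff cinner_add_left cinner_zero_left)

lemma cinner_diff_right: "cinner x (y - z) = cinner x y - cinner x z"
  using cinner_add_right[of x y "- z"] by (simp add: cinner_minus_right)

lemma cinner_diff_left: "cinner (x - y) z = cinner x z - cinner y z"
  using cinner_add_left[of x "- y" z] by (simp add: cinner_minus_left)

lemma cinner_sum_right: "cinner x (\<Sum>i\<in>I. f i) = (\<Sum>i\<in>I. cinner x (f i))"
  by (induction I rule: infinite_finite_induct) (simp_all add: cinner_add_right)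

lemma cinner_sum_left: "cinner (\<Sum>i\<in>I. f i) x = (\<Sum>i\<in>I. cinner (f i) x)"
  by (induction I rule: infinite_finite_induct) (simp_all add: cinner_add_left)

lemma cinner_self: "cinner x x = of_real ((norm x)\<^sup>2)"
proof (rule complex_eqI)
  show "Re (cinner x x) = Re (of_real ((norm x)\<^sup>2))"
    by (simp add: Re_cinner power2_norm_eq_inner)
  have "Im (cinner x x) = - Im (cinner x x)"
    using arg_cong[OF cinner_commute[of x x], of Im] by simp
  then show "Im (cinner x x) = Im (of_real ((norm x)\<^sup>2))"
    by simp
qed

lemma scaleR_scaleC: "r *\<^sub>R x = complex_of_real r *\<^sub>C x"
  by (simp add: scaleC_of_real)

lemma cinner_scaleR_right: "cinner x (r *\<^sub>R y) = of_real r * cinner x y"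
  by (simp add: scaleR_scaleC cinner_scaleC_right)

lemma cinner_scaleR_left: "cinner (r *\<^sub>R x) y = of_real r * cinner x y"
  by (simp add: scaleR_scaleC cinner_scaleC_left)

lemma norm_scaleC: "norm (c *\<^sub>C x) = cmod c * norm x"
proof -
  have "complex_of_real ((norm (c *\<^sub>C x))\<^sup>2) = of_real ((cmod c * norm x)\<^sup>2)"
    unfolding cinner_self[symmetric] cinner_scaleC_left cinner_scaleC_right
    by (simp add: cinner_self power_mult_distrib complex_norm_square[symmetric] mult.assoc[symmetric]
        mult.commute del: of_real_power)
  then show ?thesis
    by (simp only: of_real_eq_iff) (simp add: power2_eq_iff_nonneg)
qed

lemma cinner_ext: "(\<And>z. cinner z x = cinner z y) \<Longrightarrow> x = y"
proof -
  assume "\<And>z. cinner z x = cinner z y"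
  then have "cinner (x - y) (x - y) = 0"
    by (simp add: cinner_diff_right)
  then show "x = y"
    by (simp add: cinner_self)
qed

lemma cauchy_schwarz: "cmod (cinner x y) \<le> norm x * norm y"
proof (cases "cinner x y = 0")
  case False
  define u where "u = cnj (cinner x y) / of_real (cmod (cinner x y))"
  have u: "cmod u = 1"
    using False by (simp add: u_def norm_divide)
  have "u * cinner x y = of_real (cmod (cinner x y))"
    using False by (simp add: u_def complex_norm_square[symmetric] mult.commute power2_eq_square
        flip: of_real_mult of_real_power)
      (metis complex_norm_square mult.commute of_real_power power2_eq_square
        nonzero_mult_div_cancel_left norm_eq_zero of_real_eq_0_iff times_divide_eq_right)
  then have "cmod (cinner x y) = inner x (u *\<^sub>C y)"
    by (metis Re_cinner Re_complex_of_real cinner_scaleC_right)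
  also have "\<dots> \<le> norm x * norm (u *\<^sub>C y)"
    by (rule norm_cauchy_schwarz)
  finally show ?thesis
    by (simp add: norm_scaleC u)
qed simp

lemma bounded_bilinear_cinner: "bounded_bilinear cinner"
proof
  show "\<exists>K. \<forall>a b. norm (cinner a b) \<le> norm a * norm b * K"
    using cauchy_schwarz by (metis mult.right_neutral)
qed (simp_all add: cinner_add_left cinner_add_right cinner_scaleR_left cinner_scaleR_right
    scaleR_conv_of_real)

lemma bounded_bilinear_scaleC: "bounded_bilinear (*\<^sub>C)"
proof
  show "\<exists>K. \<forall>a b. norm (a *\<^sub>C b) \<le> norm a * norm b * K"
    by (rule exI[of _ 1]) (simp add: norm_scaleC)
qed (simp_all add: scaleC_add_left scaleC_add_right scaleC_scaleC scaleR_scaleC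
    scaleR_conv_of_real mult.commute)

lemmas tendsto_cinner = bounded_bilinear.tendsto[OF bounded_bilinear_cinner]
lemmas tendsto_scaleC = bounded_bilinear.tendsto[OF bounded_bilinear_scaleC]
lemmas bounded_linear_cinner_right = bounded_bilinear.bounded_linear_right[OF bounded_bilinear_cinner]
lemmas bounded_linear_cinner_left = bounded_bilinear.bounded_linear_left[OF bounded_bilinear_cinner]
lemmas bounded_linear_scaleC_right = bounded_bilinear.bounded_linear_right[OF bounded_bilinear_scaleC]

text \<open>Bounds found by pairing a vector with itself, as for adjoints, come in this shape.\<close>

lemma norm_le_of_square_le:
  assumes "(norm y)\<^sup>2 \<le> c * norm y" "c \<ge> 0"
  shows "norm y \<le> c"
proof (cases "norm y = 0")
  case False
  then have "norm y > 0" by simp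
  moreover have "norm y * norm y \<le> norm y * c"
    using assms(1) by (simp add: power2_eq_square mult.commute)
  ultimately show ?thesis by (rule mult_left_le_imp_le[rotated])
qed (use assms(2) in simp)

lemma cmod_cinner_eq_norm_sq: "cinner x z = cinner y y \<Longrightarrow> (norm y)\<^sup>2 = cmod (cinner x z)"
  by (simp add: cinner_self norm_power)

lemma norm_add_sq:
  assumes "cinner x y = 0"
  shows "(norm (x + y))\<^sup>2 = (norm x)\<^sup>2 + (norm y)\<^sup>2"
proof -
  have "inner x y = 0"
    using assms Re_cinner by (metis zero_complex.simps(1))
  then show ?thesis
    by (simp add: power2_norm_eq_inner inner_add inner_commute)
qed


subsection \<open>Orthonormal families\<close>

text \<open>Indexed families cover sequences and, with the identity as indexing, sets of vectors.\<close>

definition orthonormal_on :: "'i set \<Rightarrow> ('i \<Rightarrow> 'a::complex_hilbert_space) \<Rightarrow> bool" where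
  "orthonormal_on I e \<longleftrightarrow> (\<forall>i\<in>I. \<forall>j\<in>I. cinner (e i) (e j) = (if i = j then 1 else 0))"

lemma orthonormal_onD: "orthonormal_on I e \<Longrightarrow> i \<in> I \<Longrightarrow> j \<in> I \<Longrightarrow> cinner (e i) (e j) = (if i = j then 1 else 0)"
  by (auto simp: orthonormal_on_def)

lemma orthonormal_on_subset: "orthonormal_on I e \<Longrightarrow> J \<subseteq> I \<Longrightarrow> orthonormal_on J e"
  unfolding orthonormal_on_def by blast

lemma orthonormal_on_norm: "orthonormal_on I e \<Longrightarrow> i \<in> I \<Longrightarrow> norm (e i) = 1"
  using orthonormal_onD[of I e i i] cinner_self[of "e i"]
  by (metis norm_ge_zero of_real_eq_1_iff power2_eq_1_iff le_minus_one_simps(3))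

lemma orthonormal_onI_less:
  fixes e :: "nat \<Rightarrow> 'a::complex_hilbert_space"
  assumes "\<And>n. norm (e n) = 1" "\<And>k n. k < n \<Longrightarrow> cinner (e k) (e n) = 0"
  shows "orthonormal_on UNIV e"
  unfolding orthonormal_on_def
proof (intro ballI)
  fix i j
  show "cinner (e i) (e j) = (if i = j then 1 else 0)"
    using assms(2)[of i j] assms(2)[of j i] cinner_commute[of "e i" "e j"] cinner_self[of "e i"] assms(1)[of i]
    by (cases i j rule: linorder_cases) auto
qed

lemma orthonormal_inj:
  assumes "orthonormal_on UNIV e" shows "inj e"
proof (rule injI)
  show "x = y" if "e x = e y" for x y
    using orthonormal_onD[OF assms, of x y] orthonormal_onD[OF assms, of y y] that by (simp split: if_splits)
qed

lemma orthonormal_image: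
  assumes "orthonormal_on UNIV e"
  shows "orthonormal_on (e ` N) (\<lambda>x. x)" "card (e ` N) = card N" "sum f (e ` N) = (\<Sum>k\<in>N. f (e k))"
proof -
  have inj: "inj_on e N" using orthonormal_inj[OF assms] by (rule inj_on_subset) simp
  show "orthonormal_on (e ` N) (\<lambda>x. x)"
    using orthonormal_onD[OF assms] orthonormal_inj[OF assms] by (auto simp: orthonormal_on_def inj_def)
  show "card (e ` N) = card N" by (rule card_image[OF inj])
  show "sum f (e ` N) = (\<Sum>k\<in>N. f (e k))" by (simp add: sum.reindex[OF inj])
qed

lemma cinner_orthonormal_sum:
  assumes "orthonormal_on I e" "finite J" "J \<subseteq> I" "i \<in> I"
  shows "cinner (e i) (\<Sum>j\<in>J. c j *\<^sub>C e j) = (if i \<in> J then c i else 0)"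
proof -
  have "cinner (e i) (\<Sum>j\<in>J. c j *\<^sub>C e j) = (\<Sum>j\<in>J. if j = i then c j else 0)"
    unfolding cinner_sum_right cinner_scaleC_right
    by (rule sum.cong) (use assms in \<open>auto simp: orthonormal_onD\<close>)
  then show ?thesis
    using assms(2) by simp
qed

lemma norm_orthonormal_sum:
  assumes "orthonormal_on I e" "finite I"
  shows "(norm (\<Sum>i\<in>I. c i *\<^sub>C e i))\<^sup>2 = (\<Sum>i\<in>I. (cmod (c i))\<^sup>2)"
proof -
  have "cinner (\<Sum>i\<in>I. c i *\<^sub>C e i) (\<Sum>i\<in>I. c i *\<^sub>C e i) = (\<Sum>i\<in>I. cnj (c i) * c i)"
    unfolding cinner_sum_left cinner_scaleC_left
    by (rule sum.cong) (use assms in \<open>auto simp: cinner_orthonormal_sum\<close>)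
  also have "\<dots> = of_real (\<Sum>i\<in>I. (cmod (c i))\<^sup>2)"
    by (simp add: complex_norm_square mult.commute del: of_real_power)
  finally show ?thesis
    by (simp only: cinner_self of_real_eq_iff)
qed

lemma bessel_identity:
  assumes "orthonormal_on I e" "finite I"
  shows "(norm (x - (\<Sum>i\<in>I. cinner (e i) x *\<^sub>C e i)))\<^sup>2
           = (norm x)\<^sup>2 - (\<Sum>i\<in>I. (cmod (cinner (e i) x))\<^sup>2)"
proof -
  let ?p = "\<Sum>i\<in>I. cinner (e i) x *\<^sub>C e i"
  have "cinner ?p (x - ?p) = 0"
    unfolding cinner_sum_left cinner_scaleC_left
    by (rule sum.neutral) (auto simp: cinner_diff_right cinner_orthonormal_sum[OF assms subset_refl])
  from norm_add_sq[OF this] show ?thesis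
    by (simp add: norm_orthonormal_sum[OF assms])
qed

lemma bessel:
  assumes "orthonormal_on I e" "finite I"
  shows "(\<Sum>i\<in>I. (cmod (cinner (e i) x))\<^sup>2) \<le> (norm x)\<^sup>2"
proof -
  have "0 \<le> (norm x)\<^sup>2 - (\<Sum>i\<in>I. (cmod (cinner (e i) x))\<^sup>2)"
    unfolding bessel_identity[OF assms, of x, symmetric] by simp
  then show ?thesis by simp
qed

lemma bessel_summable:
  fixes e :: "nat \<Rightarrow> 'a::complex_hilbert_space"
  assumes "orthonormal_on UNIV e"
  shows "summable (\<lambda>n. (cmod (cinner (e n) x))\<^sup>2)" "(\<Sum>n. (cmod (cinner (e n) x))\<^sup>2) \<le> (norm x)\<^sup>2"
proof -
  have *: "(\<Sum>i<n. (cmod (cinner (e i) x))\<^sup>2) \<le> (norm x)\<^sup>2" for n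
    by (rule bessel) (auto intro: orthonormal_on_subset[OF assms])
  show "summable (\<lambda>n. (cmod (cinner (e n) x))\<^sup>2)"
    by (rule summableI_nonneg_bounded[OF _ *]) simp
  then show "(\<Sum>n. (cmod (cinner (e n) x))\<^sup>2) \<le> (norm x)\<^sup>2"
    by (rule suminf_le_const) (rule *)
qed

text \<open>Riesz--Fischer: by Pythagoras the partial sums are Cauchy exactly when the squares are summable.\<close>

lemma summable_orthonormal:
  fixes e :: "nat \<Rightarrow> 'a::complex_hilbert_space"
  assumes e: "orthonormal_on UNIV e" and c: "summable (\<lambda>n. (cmod (c n))\<^sup>2)"
  shows "summable (\<lambda>n. c n *\<^sub>C e n)"
  unfolding summable_Cauchy
proof (intro allI impI)
  fix \<epsilon> :: real assume "\<epsilon> > 0"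
  then have "\<epsilon>\<^sup>2 > 0" by simp
  then obtain N where N: "\<And>m n. m \<ge> N \<Longrightarrow> norm (\<Sum>k\<in>{m..<n}. (cmod (c k))\<^sup>2) < \<epsilon>\<^sup>2"
    using c unfolding summable_Cauchy by blast
  have "norm (\<Sum>k\<in>{m..<n}. c k *\<^sub>C e k) < \<epsilon>" if "m \<ge> N" for m n
  proof -
    have "(norm (\<Sum>k\<in>{m..<n}. c k *\<^sub>C e k))\<^sup>2 < \<epsilon>\<^sup>2"
      using N[OF that, of n] by (subst norm_orthonormal_sum) (auto intro: orthonormal_on_subset[OF e])
    then show ?thesis
      using \<open>\<epsilon> > 0\<close> by (simp add: power_less_imp_less_base)
  qed
  then show "\<exists>N. \<forall>m\<ge>N. \<forall>n. norm (\<Sum>k\<in>{m..<n}. c k *\<^sub>C e k) < \<epsilon>"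
    by blast
qed

lemma cinner_suminf_orthonormal:
  fixes e :: "nat \<Rightarrow> 'a::complex_hilbert_space"
  assumes e: "orthonormal_on UNIV e" and c: "summable (\<lambda>n. c n *\<^sub>C e n)"
  shows "cinner (e k) (\<Sum>n. c n *\<^sub>C e n) = c k"
proof -
  have "(\<lambda>n. cinner (e k) (c n *\<^sub>C e n)) sums cinner (e k) (\<Sum>n. c n *\<^sub>C e n)"
    by (rule bounded_linear.sums[OF bounded_linear_cinner_right summable_sums[OF c]])
  moreover have "(\<lambda>n. cinner (e k) (c n *\<^sub>C e n)) = (\<lambda>n. if n = k then c k else 0)"
    using e by (auto simp: cinner_scaleC_right orthonormal_onD)
  moreover have "(\<lambda>n. if n = k then c k else 0) sums c k"
    using sums_single[of k c] by (simp add: eq_commute cong: if_cong)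
  ultimately show ?thesis
    using sums_unique2 by metis
qed

lemma norm_suminf_orthonormal:
  fixes e :: "nat \<Rightarrow> 'a::complex_hilbert_space"
  assumes e: "orthonormal_on UNIV e" and c: "summable (\<lambda>n. (cmod (c n))\<^sup>2)"
  shows "(norm (\<Sum>n. c n *\<^sub>C e n))\<^sup>2 = (\<Sum>n. (cmod (c n))\<^sup>2)"
proof -
  have "(\<lambda>N. (norm (\<Sum>n<N. c n *\<^sub>C e n))\<^sup>2) \<longlonglongrightarrow> (norm (\<Sum>n. c n *\<^sub>C e n))\<^sup>2"
    by (intro tendsto_power tendsto_norm summable_LIMSEQ summable_orthonormal[OF e c])
  moreover have "(norm (\<Sum>n<N. c n *\<^sub>C e n))\<^sup>2 = (\<Sum>n<N. (cmod (c n))\<^sup>2)" for N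
    by (rule norm_orthonormal_sum) (auto intro: orthonormal_on_subset[OF e])
  ultimately show ?thesis
    using summable_LIMSEQ[OF c] LIMSEQ_unique by auto
qed

text \<open>
  The sequence may be incomplete; \<open>y\<close> is the part of \<open>x\<close> that it does not see.
\<close>

lemma orthonormal_expansion:
  fixes e :: "nat \<Rightarrow> 'a::complex_hilbert_space"
  assumes e: "orthonormal_on UNIV e"
  obtains y where "(\<lambda>n. cinner (e n) x *\<^sub>C e n) sums (x - y)" "\<And>n. cinner (e n) y = 0"
proof -
  have s: "summable (\<lambda>n. cinner (e n) x *\<^sub>C e n)"
    by (rule summable_orthonormal[OF e bessel_summable(1)[OF e]])
  show ?thesis
  proof
    show "(\<lambda>n. cinner (e n) x *\<^sub>C e n) sums (x - (x - (\<Sum>n. cinner (e n) x *\<^sub>C e n)))"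
      using s by (simp add: summable_sums)
    show "cinner (e n) (x - (\<Sum>n. cinner (e n) x *\<^sub>C e n)) = 0" for n
      by (simp add: cinner_diff_right cinner_suminf_orthonormal[OF e s])
  qed
qed


subsection \<open>Finite Gram--Schmidt\<close>

lemma cspan_orthonormal_sum:
  "x \<in> cvec.span E \<Longrightarrow> finite E \<Longrightarrow> orthonormal_on E (\<lambda>x. x) \<Longrightarrow> x = (\<Sum>e\<in>E. cinner e x *\<^sub>C e)"
proof (induction rule: cvec.span_induct_alt)
  case (step c b y)
  have "(\<Sum>e\<in>E. cinner e b *\<^sub>C e) = (\<Sum>e\<in>E. if e = b then b else 0)"
    by (rule sum.cong) (use step in \<open>auto simp: orthonormal_on_def\<close>)
  then have b: "(\<Sum>e\<in>E. cinner e b *\<^sub>C e) = b"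
    using step by simp
  have y: "y = (\<Sum>e\<in>E. cinner e y *\<^sub>C e)" using step by blast
  have "(\<Sum>e\<in>E. cinner e (c *\<^sub>C b + y) *\<^sub>C e) = c *\<^sub>C (\<Sum>e\<in>E. cinner e b *\<^sub>C e) + (\<Sum>e\<in>E. cinner e y *\<^sub>C e)"
    by (simp add: cinner_add_right cinner_scaleC_right scaleC_add_left sum.distrib cvec.scale_sum_right scaleC_scaleC)
  then show ?case using b y by simp
qed simp

text \<open>Stated with a prescribed orthonormal subfamily, so that it also extends orthonormal sets.\<close>

lemma gram_schmidt_extend:
  assumes "finite W" "finite E0" "orthonormal_on E0 (\<lambda>x. x)"
  shows "\<exists>E. finite E \<and> E0 \<subseteq> E \<and> orthonormal_on E (\<lambda>x. x) \<and> cvec.span E = cvec.span (E0 \<union> W)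
             \<and> card E \<le> card E0 + card W"
  using assms
proof (induction W rule: finite_induct)
  case empty
  then show ?case by auto
next
  case (insert w W)
  then obtain E where E: "finite E" "E0 \<subseteq> E" "orthonormal_on E (\<lambda>x. x)" "cvec.span E = cvec.span (E0 \<union> W)"
    "card E \<le> card E0 + card W" by blast
  define z where "z = w - (\<Sum>e\<in>E. cinner e w *\<^sub>C e)"
  have zperp: "cinner e z = 0" if "e \<in> E" for e
    using cinner_orthonormal_sum[OF E(3,1) subset_refl that] that by (simp add: z_def cinner_diff_right)
  have sumspan: "(\<Sum>e\<in>E. cinner e w *\<^sub>C e) \<in> cvec.span E"
    by (intro cvec.span_sum cvec.span_scale cvec.span_base)
  have span: "cvec.span (E0 \<union> insert w W) = cvec.span (insert w E)"
    using E(4) cvec.span_insert[of w E] cvec.span_insert[of w "E0 \<union> W"] by simp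
  show ?case
  proof (cases "z = 0")
    case True
    then have "w \<in> cvec.span E" using sumspan by (simp add: z_def)
    then have "cvec.span (insert w E) = cvec.span E" by (rule cvec.span_redundant)
    then show ?thesis
      using E span insert by (intro exI[of _ E]) auto
  next
    case False
    define u where "u = complex_of_real (inverse (norm z)) *\<^sub>C z"
    have uz: "z = complex_of_real (norm z) *\<^sub>C u"
      using False by (simp add: u_def scaleC_scaleC flip: of_real_mult)
    have "norm u = 1" using False by (simp add: u_def norm_scaleC norm_inverse)
    then have uu: "cinner u u = 1" by (simp add: cinner_self)
    have ue: "cinner e u = 0" "cinner u e = 0" if "e \<in> E" for e
      using zperp[OF that] cinner_commute[of u e] by (simp_all add: u_def cinner_scaleC_right)
    have on: "orthonormal_on (insert u E) (\<lambda>x. x)"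
      unfolding orthonormal_on_def
    proof (intro ballI)
      fix x y assume "x \<in> insert u E" "y \<in> insert u E"
      moreover have "u \<notin> E" using ue uu by fastforce
      ultimately show "cinner x y = (if x = y then 1 else 0)"
        using E(3) ue uu by (auto simp: orthonormal_on_def)
    qed
    have "cvec.span (insert u E) = cvec.span (insert w E)"
    proof (intro equalityI cvec.span_minimal cvec.subspace_span)
      have "z \<in> cvec.span (insert w E)"
        unfolding z_def
        by (rule cvec.span_diff) (auto intro!: cvec.span_sum cvec.span_scale intro: cvec.span_base)
      then have "u \<in> cvec.span (insert w E)"
        unfolding u_def by (rule cvec.span_scale)
      then show "insert u E \<subseteq> cvec.span (insert w E)"
        by (auto intro: cvec.span_base)
      have "complex_of_real (norm z) *\<^sub>C u \<in> cvec.span (insert u E)"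
        by (intro cvec.span_scale cvec.span_base) simp
      then have "z \<in> cvec.span (insert u E)"
        using uz by simp
      moreover have "(\<Sum>e\<in>E. cinner e w *\<^sub>C e) \<in> cvec.span (insert u E)"
        using sumspan cvec.span_mono[of E "insert u E"] by blast
      ultimately have "z + (\<Sum>e\<in>E. cinner e w *\<^sub>C e) \<in> cvec.span (insert u E)"
        by (rule cvec.span_add)
      then have "w \<in> cvec.span (insert u E)" by (simp add: z_def)
      then show "insert w E \<subseteq> cvec.span (insert u E)"
        by (auto intro: cvec.span_base)
    qed
    moreover have "card (insert u E) \<le> card E0 + card (insert w W)"
      using E insert by (simp add: card_insert_if)
    ultimately show ?thesis
      using E on span by (intro exI[of _ "insert u E"]) auto
  qed
qed

lemma gram_schmidt:
  assumes "finite W"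
  obtains E where "finite E" "orthonormal_on E (\<lambda>x. x)" "cvec.span E = cvec.span W" "card E \<le> card W"
  using gram_schmidt_extend[OF assms, of "{}"] by (auto simp: orthonormal_on_def)

lemma orthogonal_projection:
  assumes "finite W"
  obtains p where "p \<in> cvec.span W" "\<And>w. w \<in> cvec.span W \<Longrightarrow> cinner w (x - p) = 0"
proof -
  obtain E where E: "finite E" "orthonormal_on E (\<lambda>x. x)" "cvec.span E = cvec.span W"
    using gram_schmidt[OF assms] by metis
  define p where "p = (\<Sum>e\<in>E. cinner e x *\<^sub>C e)"
  have "p \<in> cvec.span W"
    unfolding E(3)[symmetric] p_def by (intro cvec.span_sum cvec.span_scale cvec.span_base)
  moreover have "cinner w (x - p) = 0" if "w \<in> cvec.span W" for w
  proof -
    have e: "cinner e (x - p) = 0" if "e \<in> E" for e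
      using cinner_orthonormal_sum[OF E(2,1) subset_refl that] that by (simp add: p_def cinner_diff_right)
    have "w = (\<Sum>e\<in>E. cinner e w *\<^sub>C e)"
      using that E by (intro cspan_orthonormal_sum) auto
    then have "cinner w (x - p) = (\<Sum>e\<in>E. cnj (cinner e w) * cinner e (x - p))"
      by (metis (no_types, lifting) cinner_scaleC_left cinner_sum_left sum.cong)
    then show ?thesis by (simp add: e)
  qed
  ultimately show ?thesis using that by blast
qed

lemma independent_orthonormal:
  assumes "orthonormal_on E (\<lambda>x. x)"
  shows "cvec.independent E"
  unfolding cvec.dependent_explicit
proof clarify
  fix S u v assume S: "finite S" "S \<subseteq> E" and s: "(\<Sum>v\<in>S. u v *\<^sub>C v) = 0" and v: "v \<in> S" "u v \<noteq> 0"
  have "cinner v (\<Sum>v\<in>S. u v *\<^sub>C v) = u v"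
    using cinner_orthonormal_sum[OF assms S, of v u] v S by auto
  then show False using s v by simp
qed

text \<open>More orthonormal vectors than constraints: dimension counting leaves room.\<close>

lemma exists_perp_in_span:
  assumes "finite E" "orthonormal_on E (\<lambda>x. x)" "finite W" "card W < card E"
  obtains x where "x \<in> cvec.span E" "norm x = 1" "\<And>w. w \<in> W \<Longrightarrow> cinner w x = 0"
proof -
  \<comment> \<open>Replace the constraints by their projections to the span of \<open>E\<close>.\<close>
  define proj where "proj w = (\<Sum>e\<in>E. cinner e w *\<^sub>C e)" for w
  have proj: "proj w \<in> cvec.span E" for w
    unfolding proj_def by (intro cvec.span_sum cvec.span_scale cvec.span_base)
  have cproj: "cinner (proj w) x = cinner w x" if "x \<in> cvec.span E" for w x
  proof -
    have x: "x = (\<Sum>e\<in>E. cinner e x *\<^sub>C e)"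
      using that assms by (intro cspan_orthonormal_sum) auto
    have "cinner (proj w) x = (\<Sum>e\<in>E. cinner w e * cinner e x)"
      unfolding proj_def cinner_sum_left cinner_scaleC_left by (simp add: cinner_commute[symmetric])
    also have "\<dots> = cinner w x"
      using arg_cong[OF x, of "cinner w"] by (simp add: cinner_sum_right cinner_scaleC_right mult.commute)
    finally show ?thesis .
  qed
  have "\<not> E \<subseteq> cvec.span (proj ` W)"
  proof
    assume "E \<subseteq> cvec.span (proj ` W)"
    from cvec.independent_span_bound[OF _ independent_orthonormal[OF assms(2)] this]
    have "card E \<le> card (proj ` W)" using assms by simp
    then show False using card_image_le[OF assms(3), of proj] assms(4) by linarith
  qed
  then obtain e where e: "e \<in> E" "e \<notin> cvec.span (proj ` W)" by blast
  obtain p where p: "p \<in> cvec.span (proj ` W)" "\<And>w. w \<in> cvec.span (proj ` W) \<Longrightarrow> cinner w (e - p) = 0"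
    using orthogonal_projection[of "proj ` W" e] assms by blast
  have "cvec.span (proj ` W) \<subseteq> cvec.span E"
    using proj by (intro cvec.span_minimal) auto
  then have zE: "e - p \<in> cvec.span E"
    using p e by (auto intro: cvec.span_diff cvec.span_base)
  have z0: "e - p \<noteq> 0" using p e by auto
  show ?thesis
  proof
    show "complex_of_real (inverse (norm (e - p))) *\<^sub>C (e - p) \<in> cvec.span E"
      using zE by (rule cvec.span_scale)
    show "norm (complex_of_real (inverse (norm (e - p))) *\<^sub>C (e - p)) = 1"
      using z0 by (simp add: norm_scaleC norm_inverse)
    show "cinner w (complex_of_real (inverse (norm (e - p))) *\<^sub>C (e - p)) = 0" if "w \<in> W" for w
    proof -
      have "cinner w (e - p) = cinner (proj w) (e - p)" using cproj[OF zE] by simp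
      also have "\<dots> = 0" using that by (intro p(2) cvec.span_base) auto
      finally show ?thesis by (simp add: cinner_scaleC_right)
    qed
  qed
qed

lemma exists_unit_perp:
  fixes W :: "'a::complex_hilbert_space set"
  assumes inf: "\<not> (\<exists>B :: 'a set. finite B \<and> cvec.span B = UNIV)" and W: "finite W"
  obtains x where "norm x = 1" "\<And>w. w \<in> W \<Longrightarrow> cinner w x = 0"
proof -
  obtain v where v: "v \<notin> cvec.span W" using inf W by blast
  obtain p where p: "p \<in> cvec.span W" "\<And>w. w \<in> cvec.span W \<Longrightarrow> cinner w (v - p) = 0"
    using orthogonal_projection[OF W] by metis
  have z0: "v - p \<noteq> 0" using p v by auto
  show ?thesis
  proof
    show "norm (complex_of_real (inverse (norm (v - p))) *\<^sub>C (v - p)) = 1"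
      using z0 by (simp add: norm_scaleC norm_inverse)
    show "cinner w (complex_of_real (inverse (norm (v - p))) *\<^sub>C (v - p)) = 0" if "w \<in> W" for w
      using p(2)[OF cvec.span_base[OF that]] by (simp add: cinner_scaleC_right)
  qed
qed


section \<open>Bounded and compact operators\<close>

lemma bounded_opD: "bounded_op T \<Longrightarrow> bounded_linear T" "bounded_op T \<Longrightarrow> T (c *\<^sub>C x) = c *\<^sub>C T x"
  by (auto simp: bounded_op_def)

lemma bounded_op_simps:
  assumes "bounded_op T"
  shows "T (x + y) = T x + T y" "T (x - y) = T x - T y" "T (- x) = - T x" "T 0 = 0"
    "T (c *\<^sub>C x) = c *\<^sub>C T x" "T (r *\<^sub>R x) = r *\<^sub>R T x" "T (\<Sum>i\<in>I. f i) = (\<Sum>i\<in>I. T (f i))"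
proof -
  interpret bounded_linear T using assms by (rule bounded_opD)
  show "T (x + y) = T x + T y" "T (x - y) = T x - T y" "T (- x) = - T x" "T 0 = 0"
    "T (r *\<^sub>R x) = r *\<^sub>R T x" "T (\<Sum>i\<in>I. f i) = (\<Sum>i\<in>I. T (f i))"
    by (simp_all add: add diff neg zero scaleR sum)
  show "T (c *\<^sub>C x) = c *\<^sub>C T x" using assms by (rule bounded_opD)
qed

lemma bounded_opE:
  assumes "bounded_op T"
  obtains K where "K > 0" "\<And>x. norm (T x) \<le> K * norm x"
  using bounded_linear.pos_bounded[OF bounded_opD(1)[OF assms]] by (metis mult.commute)

lemma bounded_opI:
  assumes "\<And>x y. T (x + y) = T x + T y" "\<And>c x. T (c *\<^sub>C x) = c *\<^sub>C T x" "\<And>x. norm (T x) \<le> K * norm x"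
  shows "bounded_op T"
  unfolding bounded_op_def
  using assms by (auto intro!: bounded_linear_intro[of _ K] simp: scaleR_scaleC mult.commute)

lemma bounded_op_tendsto: "bounded_op T \<Longrightarrow> (f \<longlongrightarrow> l) F \<Longrightarrow> ((\<lambda>x. T (f x)) \<longlongrightarrow> T l) F"
  using bounded_linear.tendsto bounded_opD by blast

lemma bounded_op_add: "bounded_op S \<Longrightarrow> bounded_op T \<Longrightarrow> bounded_op (\<lambda>x. S x + T x)"
  unfolding bounded_op_def by (auto intro: bounded_linear_add simp: scaleC_add_right)

lemma bounded_op_scale: "bounded_op T \<Longrightarrow> bounded_op (\<lambda>x. c *\<^sub>C T x)"
  unfolding bounded_op_def
  using bounded_linear_compose[OF bounded_linear_scaleC_right[of c], of T]
  by (auto simp: scaleC_scaleC mult.commute)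

lemma bounded_op_comp: "bounded_op S \<Longrightarrow> bounded_op T \<Longrightarrow> bounded_op (S \<circ> T)"
  unfolding bounded_op_def using bounded_linear_compose[of S T] by (auto simp: o_def)

lemma compact_op_bounded: "compact_op T \<Longrightarrow> bounded_op T"
  by (simp add: compact_op_def)

lemma compact_op_subseq:
  assumes T: "compact_op T" and x: "\<And>n::nat. norm (x n) \<le> C"
  obtains r l where "strict_mono (r :: nat \<Rightarrow> nat)" "(\<lambda>n. T (x (r n))) \<longlonglongrightarrow> l"
proof -
  define c where "c = max C 1"
  have c: "c > 0" by (simp add: c_def)
  have nx: "norm (x n) \<le> c" for n using x[of n] by (simp add: c_def)
  define y where "y n = T (inverse c *\<^sub>R x n)" for n
  have "seq_compact (closure (T ` cball 0 1))"
    using T by (simp add: compact_op_def compact_eq_seq_compact_metric)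
  moreover have "\<forall>n. y n \<in> closure (T ` cball 0 1)"
  proof
    fix n
    have "norm (inverse c *\<^sub>R x n) = inverse c * norm (x n)" using c by simp
    also have "\<dots> \<le> inverse c * c" using nx[of n] c by (intro mult_left_mono) auto
    finally have "inverse c *\<^sub>R x n \<in> cball 0 1" using c by simp
    then have "y n \<in> T ` cball 0 1" unfolding y_def by (rule imageI)
    then show "y n \<in> closure (T ` cball 0 1)" by (rule subsetD[OF closure_subset])
  qed
  ultimately have "\<exists>l\<in>closure (T ` cball 0 1). \<exists>r. strict_mono (r :: nat \<Rightarrow> nat) \<and> (y \<circ> r) \<longlonglongrightarrow> l"
    unfolding seq_compact_def by (elim allE[of _ y] impE)
  then obtain l r where r: "strict_mono (r :: nat \<Rightarrow> nat)" and l: "(y \<circ> r) \<longlonglongrightarrow> l"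
    by (elim bexE exE conjE)
  have "(\<lambda>n. c *\<^sub>R (y \<circ> r) n) \<longlonglongrightarrow> c *\<^sub>R l"
    by (intro tendsto_intros l)
  moreover have "c *\<^sub>R (y \<circ> r) n = T (x (r n))" for n
    using c by (simp add: y_def bounded_op_simps(6)[OF compact_op_bounded[OF T]])
  ultimately have "(\<lambda>n. T (x (r n))) \<longlonglongrightarrow> c *\<^sub>R l" by simp
  with r show ?thesis by (rule that)
qed

text \<open>
  Points of the closure of the image are limits of values, so subsequences need only be extracted
  from images of sequences in the unit ball.
\<close>

lemma compact_opI:
  assumes T: "bounded_op T"
    and sub: "\<And>x. (\<And>n::nat. norm (x n) \<le> 1) \<Longrightarrow> \<exists>r l. strict_mono (r :: nat \<Rightarrow> nat) \<and> (\<lambda>n. T (x (r n))) \<longlonglongrightarrow> l"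
  shows "compact_op T"
proof -
  have "seq_compact (closure (T ` cball 0 1))"
    unfolding seq_compact_def
  proof (intro allI impI)
    fix f :: "nat \<Rightarrow> 'a" assume f: "\<forall>n. f n \<in> closure (T ` cball 0 1)"
    have "\<exists>x. norm x \<le> 1 \<and> dist (T x) (f n) < inverse (real (Suc n))" for n
    proof -
      have "inverse (real (Suc n)) > 0" by simp
      then obtain y where "y \<in> T ` cball 0 1" "dist y (f n) < inverse (real (Suc n))"
        using f closure_approachable by blast
      then show ?thesis by auto
    qed
    then obtain x where x: "\<And>n. norm (x n) \<le> 1" "\<And>n. dist (T (x n)) (f n) < inverse (real (Suc n))"
      by metis
    obtain r l where r: "strict_mono (r :: nat \<Rightarrow> nat)" and l: "(\<lambda>n. T (x (r n))) \<longlonglongrightarrow> l"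
      using sub[of x] x(1) by blast
    have d: "(\<lambda>n. f (r n) - T (x (r n))) \<longlonglongrightarrow> 0"
    proof (rule tendsto_norm_zero_cancel, rule tendsto_sandwich)
      show "\<forall>\<^sub>F n in sequentially. 0 \<le> norm (f (r n) - T (x (r n)))" by simp
      show "\<forall>\<^sub>F n in sequentially. norm (f (r n) - T (x (r n))) \<le> inverse (real (Suc (r n)))"
        using x(2) by (auto intro!: always_eventually less_imp_le simp: dist_norm norm_minus_commute)
      show "(\<lambda>n. inverse (real (Suc (r n)))) \<longlonglongrightarrow> 0"
        using LIMSEQ_subseq_LIMSEQ[OF LIMSEQ_inverse_real_of_nat r] by (simp add: o_def)
    qed simp
    have "(\<lambda>n. f (r n)) \<longlonglongrightarrow> l"
      using tendsto_add[OF d l] by simp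
    then have "(f \<circ> r) \<longlonglongrightarrow> l" by (simp add: o_def)
    moreover have "l \<in> closure (T ` cball 0 1)"
    proof (rule closed_sequentially[OF closed_closure _ \<open>(f \<circ> r) \<longlonglongrightarrow> l\<close>])
      show "(f \<circ> r) n \<in> closure (T ` cball 0 1)" for n using f by (simp del: closure_closure)
    qed
    ultimately show "\<exists>l\<in>closure (T ` cball 0 1). \<exists>r. strict_mono r \<and> (f \<circ> r) \<longlonglongrightarrow> l"
      using r by blast
  qed
  then show ?thesis
    using T by (simp add: compact_op_def compact_eq_seq_compact_metric)
qed

lemma compact_op_comp:
  assumes "bounded_op S" "compact_op T"
  shows "compact_op (S \<circ> T)"
proof (rule compact_opI)
  show "bounded_op (S \<circ> T)" using assms bounded_op_comp compact_op_bounded by blast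
  fix x :: "nat \<Rightarrow> 'a" assume "\<And>n. norm (x n) \<le> 1"
  then obtain r l where r: "strict_mono (r :: nat \<Rightarrow> nat)" and l: "(\<lambda>n. T (x (r n))) \<longlonglongrightarrow> l"
    using compact_op_subseq[OF assms(2)] by metis
  have "(\<lambda>n. (S \<circ> T) (x (r n))) \<longlonglongrightarrow> S l"
    using bounded_op_tendsto[OF assms(1) l] by simp
  then show "\<exists>r l. strict_mono (r :: nat \<Rightarrow> nat) \<and> (\<lambda>n. (S \<circ> T) (x (r n))) \<longlonglongrightarrow> l"
    using r by blast
qed

lemma compact_op_scale:
  assumes "compact_op T"
  shows "compact_op (\<lambda>x. c *\<^sub>C T x)"
proof -
  have "bounded_op (\<lambda>x :: 'a. c *\<^sub>C x)"
    by (rule bounded_opI[of _ "cmod c"]) (simp_all add: scaleC_add_right scaleC_scaleC mult.commute norm_scaleC)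
  from compact_op_comp[OF this assms] show ?thesis by (simp add: o_def)
qed

lemma compact_op_add:
  assumes S: "compact_op S" and T: "compact_op T"
  shows "compact_op (\<lambda>x. S x + T x)"
proof (rule compact_opI)
  show "bounded_op (\<lambda>x. S x + T x)" using assms bounded_op_add compact_op_bounded by blast
  fix x :: "nat \<Rightarrow> 'a" assume x: "\<And>n. norm (x n) \<le> 1"
  then obtain r l where r: "strict_mono (r :: nat \<Rightarrow> nat)" and l: "(\<lambda>n. S (x (r n))) \<longlonglongrightarrow> l"
    using compact_op_subseq[OF S] by metis
  obtain r' l' where r': "strict_mono (r' :: nat \<Rightarrow> nat)" and l': "(\<lambda>n. T (x (r (r' n)))) \<longlonglongrightarrow> l'"
    using compact_op_subseq[OF T, of "\<lambda>n. x (r n)" 1] x by metis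
  have "(\<lambda>n. S (x (r (r' n)))) \<longlonglongrightarrow> l"
    using LIMSEQ_subseq_LIMSEQ[OF l r'] by (simp add: o_def)
  from tendsto_add[OF this l']
  show "\<exists>r l. strict_mono (r :: nat \<Rightarrow> nat) \<and> (\<lambda>n. S (x (r n)) + T (x (r n))) \<longlonglongrightarrow> l"
    using strict_mono_o[OF r r'] by (intro exI[of _ "r \<circ> r'"]) auto
qed

lemma compact_op_zero: "compact_op (\<lambda>x. 0)"
  by (rule compact_opI) (auto intro!: bounded_opI[of _ 0] exI[of _ id] strict_mono_id)

lemma compact_op_sum: "(\<And>i. i \<in> I \<Longrightarrow> compact_op (T i)) \<Longrightarrow> compact_op (\<lambda>x. \<Sum>i\<in>I. T i x)"
  by (induction I rule: infinite_finite_induct) (auto intro: compact_op_add compact_op_zero)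

text \<open>
  A finite net for the image under a nearby compact operator is a slightly coarser net for the image
  under \<open>T\<close>.
\<close>

lemma compact_op_limit:
  assumes T: "bounded_op T"
    and lim: "\<And>\<epsilon>::real. \<epsilon> > 0 \<Longrightarrow> \<exists>S. compact_op S \<and> (\<forall>x. norm (T x - S x) \<le> \<epsilon> * norm x)"
  shows "compact_op T"
proof -
  have "\<exists>k. finite k \<and> closure (T ` cball 0 1) \<subseteq> (\<Union>x\<in>k. ball x e)" if "e > 0" for e
  proof -
    have "e / 4 > 0" using that by simp
    from lim[OF this] obtain S where S: "compact_op S" "\<And>x. norm (T x - S x) \<le> e/4 * norm x"
      by blast
    have "compact (closure (S ` cball 0 1))" using S(1) by (simp add: compact_op_def)
    then have "\<forall>\<epsilon>>0. \<exists>k. finite k \<and> closure (S ` cball 0 1) \<subseteq> (\<Union>x\<in>k. ball x \<epsilon>)"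
      unfolding compact_eq_totally_bounded by (rule conjunct2)
    from this[rule_format, OF \<open>e / 4 > 0\<close>]
    obtain k where k: "finite k" "closure (S ` cball 0 1) \<subseteq> (\<Union>x\<in>k. ball x (e/4))"
      by blast
    have "T ` cball 0 1 \<subseteq> (\<Union>x\<in>k. cball x (e/2))"
    proof clarify
      fix x :: 'a assume "x \<in> cball 0 1"
      then have x: "norm x \<le> 1" by simp
      then have "S x \<in> closure (S ` cball 0 1)" using closure_subset by force
      then obtain y where y: "y \<in> k" "dist y (S x) < e/4" using k by auto
      have "dist (S x) (T x) \<le> e/4"
        unfolding dist_norm norm_minus_commute[of "S x"]
        using order_trans[OF S(2) mult_left_le[OF x]] that by simp
      then have "dist y (T x) \<le> e/2" using y dist_triangle[of y "T x" "S x"] by linarith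
      then show "T x \<in> (\<Union>x\<in>k. cball x (e/2))" using y by auto
    qed
    moreover have "closed (\<Union>x\<in>k. cball x (e/2))" using k by auto
    ultimately have "closure (T ` cball 0 1) \<subseteq> (\<Union>x\<in>k. cball x (e/2))"
      by (rule closure_minimal)
    also have "\<dots> \<subseteq> (\<Union>x\<in>k. ball x e)" using that by fastforce
    finally show ?thesis using k by blast
  qed
  then have "compact (closure (T ` cball 0 1))"
    unfolding compact_eq_totally_bounded by (simp add: complete_eq_closed)
  then show ?thesis using T by (simp add: compact_op_def)
qed

lemma compact_op_rank_one: "compact_op (\<lambda>x. (c * cinner e x) *\<^sub>C e)"
proof (rule compact_opI)
  show "bounded_op (\<lambda>x. (c * cinner e x) *\<^sub>C e)"
  proof (rule bounded_opI)
    fix x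
    show "norm ((c * cinner e x) *\<^sub>C e) \<le> (cmod c * norm e * norm e) * norm x"
      using mult_left_mono[OF cauchy_schwarz[of e x], of "cmod c * norm e"]
      by (simp add: norm_scaleC norm_mult mult_ac)
  qed (simp_all add: cinner_add_right cinner_scaleC_right ring_distribs scaleC_add_left scaleC_scaleC mult_ac)
  fix x :: "nat \<Rightarrow> 'a" assume x: "\<And>n. norm (x n) \<le> 1"
  have "bounded (range (\<lambda>n. c * cinner e (x n)))"
  proof (rule boundedI)
    fix z assume "z \<in> range (\<lambda>n. c * cinner e (x n))"
    then obtain n where z: "z = c * cinner e (x n)" by blast
    have "cmod (cinner e (x n)) \<le> norm e"
      using cauchy_schwarz[of e "x n"] mult_left_mono[OF x[of n], of "norm e"] by simp
    then show "norm z \<le> cmod c * norm e" by (simp add: z norm_mult mult_left_mono)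
  qed
  then obtain l r where r: "strict_mono (r :: nat \<Rightarrow> nat)" and l: "((\<lambda>n. c * cinner e (x n)) \<circ> r) \<longlonglongrightarrow> l"
    using bounded_imp_convergent_subsequence by blast
  have "(\<lambda>n. (c * cinner e (x (r n))) *\<^sub>C e) \<longlonglongrightarrow> l *\<^sub>C e"
    using l by (intro tendsto_scaleC) (auto simp: o_def)
  then show "\<exists>r l. strict_mono (r :: nat \<Rightarrow> nat) \<and> (\<lambda>n. (c * cinner e (x (r n))) *\<^sub>C e) \<longlonglongrightarrow> l"
    using r by blast
qed


section \<open>Diagonal operators\<close>

text \<open>
  The sequence \<open>e\<close> is meant to be orthonormal but need not be complete: the operator vanishes on
  its orthogonal complement.  So a single sequence can list the eigenvalues in decreasing order even
  when the kernel is infinite-dimensional and the rank is infinite as well.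
\<close>

definition diag_op :: "(nat \<Rightarrow> real) \<Rightarrow> (nat \<Rightarrow> 'a::complex_hilbert_space) \<Rightarrow> 'a \<Rightarrow> 'a" where
  "diag_op a e x = (\<Sum>n. (of_real (a n) * cinner (e n) x) *\<^sub>C e n)"

lemma tendsto_imp_Bseq: "x \<longlonglongrightarrow> l \<Longrightarrow> Bseq x"
  by (intro convergent_imp_Bseq convergentI)

lemma BseqE_abs:
  fixes a :: "nat \<Rightarrow> real"
  assumes "Bseq a" obtains K where "K > 0" "\<And>n. \<bar>a n\<bar> \<le> K"
  using assms unfolding Bseq_def by auto

context
  fixes e :: "nat \<Rightarrow> 'a::complex_hilbert_space"
  assumes e: "orthonormal_on UNIV e"
begin

lemma summable_diag_coeff:
  assumes "\<And>n. \<bar>a n\<bar> \<le> K \<or> cinner (e n) x = 0"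
  shows "summable (\<lambda>n. (cmod (of_real (a n) * cinner (e n) x))\<^sup>2)"
    "(\<Sum>n. (cmod (of_real (a n) * cinner (e n) x))\<^sup>2) \<le> K\<^sup>2 * (norm x)\<^sup>2"
proof -
  have *: "(cmod (of_real (a n) * cinner (e n) x))\<^sup>2 \<le> K\<^sup>2 * (cmod (cinner (e n) x))\<^sup>2" for n
  proof (cases "cinner (e n) x = 0")
    case False
    then have "\<bar>a n\<bar>\<^sup>2 \<le> K\<^sup>2" using assms[of n] by (intro power_mono) auto
    then show ?thesis by (simp add: norm_mult power_mult_distrib mult_right_mono)
  qed simp
  have s: "summable (\<lambda>n. K\<^sup>2 * (cmod (cinner (e n) x))\<^sup>2)"
    by (intro summable_mult bessel_summable(1)[OF e])
  show 1: "summable (\<lambda>n. (cmod (of_real (a n) * cinner (e n) x))\<^sup>2)"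
    by (rule summable_comparison_test'[OF s, of 0]) (use * in auto)
  have "(\<Sum>n. (cmod (of_real (a n) * cinner (e n) x))\<^sup>2) \<le> (\<Sum>n. K\<^sup>2 * (cmod (cinner (e n) x))\<^sup>2)"
    by (rule suminf_le[OF * 1 s])
  also have "\<dots> \<le> K\<^sup>2 * (norm x)\<^sup>2"
    using bessel_summable[OF e, of x] by (simp add: suminf_mult mult_left_mono)
  finally show "(\<Sum>n. (cmod (of_real (a n) * cinner (e n) x))\<^sup>2) \<le> K\<^sup>2 * (norm x)\<^sup>2" .
qed

text \<open>
  The alternative in the hypothesis is there for vectors orthogonal to an initial segment of \<open>e\<close>,
  which only meet the later, smaller coefficients.
\<close>

lemma diag_op_norm:
  assumes "\<And>n. \<bar>a n\<bar> \<le> K \<or> cinner (e n) x = 0" "K \<ge> 0"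
  shows "norm (diag_op a e x) \<le> K * norm x"
proof -
  have "(norm (diag_op a e x))\<^sup>2 \<le> (K * norm x)\<^sup>2"
    unfolding diag_op_def norm_suminf_orthonormal[OF e summable_diag_coeff(1)[of a K x, OF assms(1)]] power_mult_distrib
    by (rule summable_diag_coeff(2)) (rule assms(1))
  then show ?thesis using assms(2) by (simp add: power2_le_iff_abs_le abs_mult)
qed

lemma diag_op_kernel: "(\<And>n. cinner (e n) x = 0) \<Longrightarrow> diag_op a e x = 0"
  by (simp add: diag_op_def)

lemma diag_op_sums:
  assumes "Bseq a"
  shows "(\<lambda>n. (of_real (a n) * cinner (e n) x) *\<^sub>C e n) sums diag_op a e x"
proof -
  obtain K where "\<And>n. \<bar>a n\<bar> \<le> K" using assms BseqE_abs by metis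
  then have "summable (\<lambda>n. (of_real (a n) * cinner (e n) x) *\<^sub>C e n)"
    by (intro summable_orthonormal[OF e] summable_diag_coeff(1)) auto
  then show ?thesis unfolding diag_op_def by (rule summable_sums)
qed

lemma cinner_diag_op:
  assumes "Bseq a" shows "cinner (e k) (diag_op a e x) = of_real (a k) * cinner (e k) x"
  unfolding diag_op_def
  using cinner_suminf_orthonormal[OF e sums_summable[OF diag_op_sums[OF assms]]] .

lemma diag_op_eigen:
  shows "diag_op a e (e k) = a k *\<^sub>R e k"
proof -
  have "(\<lambda>n. (of_real (a n) * cinner (e n) (e k)) *\<^sub>C e n) = (\<lambda>n. if n = k then a k *\<^sub>R e k else 0)"
    using orthonormal_onD[OF e] by (auto simp: scaleR_scaleC)
  moreover have "(\<lambda>n. if n = k then a k *\<^sub>R e k else 0) sums (a k *\<^sub>R e k)"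
    using sums_single[of k "\<lambda>_. a k *\<^sub>R e k"] by simp
  ultimately show ?thesis
    unfolding diag_op_def by (metis sums_unique)
qed

lemma bounded_op_diag_op:
  assumes "Bseq a" shows "bounded_op (diag_op a e)"
proof -
  obtain K where K: "K > 0" "\<And>n. \<bar>a n\<bar> \<le> K" using assms BseqE_abs by metis
  show ?thesis
  proof (rule bounded_opI)
    fix x y c
    have "(\<lambda>n. (of_real (a n) * cinner (e n) x) *\<^sub>C e n + (of_real (a n) * cinner (e n) y) *\<^sub>C e n)
            sums (diag_op a e x + diag_op a e y)"
      by (intro sums_add diag_op_sums assms)
    then show "diag_op a e (x + y) = diag_op a e x + diag_op a e y"
      using sums_unique2[OF diag_op_sums[OF assms, of "x + y"]]
      by (simp add: cinner_add_right ring_distribs scaleC_add_left)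
    have "(\<lambda>n. c *\<^sub>C (of_real (a n) * cinner (e n) x) *\<^sub>C e n) sums (c *\<^sub>C diag_op a e x)"
      by (rule bounded_linear.sums[OF bounded_linear_scaleC_right diag_op_sums[OF assms]])
    then show "diag_op a e (c *\<^sub>C x) = c *\<^sub>C diag_op a e x"
      using sums_unique2[OF diag_op_sums[OF assms, of "c *\<^sub>C x"]]
      by (simp add: cinner_scaleC_right scaleC_scaleC mult_ac)
    show "norm (diag_op a e x) \<le> K * norm x"
      using K by (intro diag_op_norm) auto
  qed
qed

lemma diag_op_form:
  assumes "Bseq a"
  shows "(\<lambda>n. of_real (a n) * (cinner x (e n) * cinner (e n) y)) sums cinner x (diag_op a e y)"
  using bounded_linear.sums[OF bounded_linear_cinner_right diag_op_sums[OF assms, of y], of x]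
  by (simp add: cinner_scaleC_right mult_ac)

lemma diag_op_selfadjoint:
  assumes "Bseq a" shows "cinner (diag_op a e x) y = cinner x (diag_op a e y)"
proof -
  have "(\<lambda>n. cnj (of_real (a n) * (cinner y (e n) * cinner (e n) x))) sums cnj (cinner y (diag_op a e x))"
    by (rule bounded_linear.sums[OF bounded_linear_cnj diag_op_form[OF assms]])
  moreover have "cnj (of_real (a n) * (cinner y (e n) * cinner (e n) x)) = of_real (a n) * (cinner x (e n) * cinner (e n) y)" for n
    by (simp add: cinner_commute[symmetric] mult_ac)
  ultimately have "(\<lambda>n. of_real (a n) * (cinner x (e n) * cinner (e n) y)) sums cnj (cinner y (diag_op a e x))"
    by (simp only:)
  then show ?thesis
    using sums_unique2[OF diag_op_form[OF assms, of x y]] by (simp add: cinner_commute[symmetric])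
qed

lemma diag_op_quadratic:
  assumes "Bseq a"
  shows "(\<lambda>n. a n * (cmod (cinner (e n) x))\<^sup>2) sums Re (cinner x (diag_op a e x))"
    and "cinner x (diag_op a e x) = of_real (Re (cinner x (diag_op a e x)))"
proof -
  have "of_real (a n) * (cinner x (e n) * cinner (e n) x) = complex_of_real (a n * (cmod (cinner (e n) x))\<^sup>2)" for n
  proof -
    have "cinner x (e n) * cinner (e n) x = complex_of_real ((cmod (cinner (e n) x))\<^sup>2)"
      by (simp add: complex_norm_square cinner_commute[of x "e n"] mult.commute del: of_real_power)
    then show ?thesis by simp
  qed
  then have *: "(\<lambda>n. complex_of_real (a n * (cmod (cinner (e n) x))\<^sup>2)) sums cinner x (diag_op a e x)"
    using diag_op_form[OF assms, of x x] by (simp only:)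
  from bounded_linear.sums[OF bounded_linear_Re *]
  show 1: "(\<lambda>n. a n * (cmod (cinner (e n) x))\<^sup>2) sums Re (cinner x (diag_op a e x))" by simp
  show "cinner x (diag_op a e x) = of_real (Re (cinner x (diag_op a e x)))"
    using sums_unique2[OF * sums_of_real[OF 1]] .
qed

lemma positive_op_diag_op:
  assumes "Bseq a" "\<And>n. a n \<ge> 0"
  shows "positive_op (diag_op a e)"
  unfolding positive_op_def
proof (intro conjI allI)
  fix x
  have "0 \<le> Re (cinner x (diag_op a e x))"
    by (rule sums_le[OF _ sums_zero diag_op_quadratic(1)[OF assms(1)]]) (use assms(2) in auto)
  then show "cinner x (diag_op a e x) \<in> \<real>\<^sub>\<ge>\<^sub>0"
    using diag_op_quadratic(2)[OF assms(1), of x] by (metis nonneg_Reals_of_real_iff)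
qed (rule bounded_op_diag_op[OF assms(1)])

text \<open>
  The finite truncations have finite rank and converge in norm, because the coefficients left out are
  uniformly small.
\<close>

lemma compact_op_diag_op:
  assumes "a \<longlonglongrightarrow> 0"
  shows "compact_op (diag_op a e)"
proof (rule compact_op_limit)
  have B: "Bseq a" using assms by (rule tendsto_imp_Bseq)
  then show "bounded_op (diag_op a e)" by (rule bounded_op_diag_op)
  fix \<epsilon> :: real assume "\<epsilon> > 0"
  then obtain N where N: "\<And>n. n \<ge> N \<Longrightarrow> \<bar>a n\<bar> < \<epsilon>"
    using LIMSEQ_D[OF assms] by auto
  define S where "S x = (\<Sum>n<N. (of_real (a n) * cinner (e n) x) *\<^sub>C e n)" for x
  have "compact_op S"
    unfolding S_def by (intro compact_op_sum compact_op_rank_one)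
  moreover have "norm (diag_op a e x - S x) \<le> \<epsilon> * norm x" for x
  proof -
    define a' where "a' n = (if n < N then 0 else a n)" for n
    have a': "\<bar>a' n\<bar> \<le> \<epsilon>" for n using N[of n] \<open>\<epsilon> > 0\<close> by (auto simp: a'_def not_less intro: less_imp_le)
    have "(\<lambda>n. (of_real (a n) * cinner (e n) x) *\<^sub>C e n - (if n \<in> {..<N} then (of_real (a n) * cinner (e n) x) *\<^sub>C e n else 0))
             sums (diag_op a e x - S x)"
      unfolding S_def by (intro sums_diff diag_op_sums[OF B] sums_If_finite_set) simp
    moreover have "(of_real (a n) * cinner (e n) x) *\<^sub>C e n - (if n \<in> {..<N} then (of_real (a n) * cinner (e n) x) *\<^sub>C e n else 0)
         = (of_real (a' n) * cinner (e n) x) *\<^sub>C e n" for n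
      by (auto simp: a'_def)
    ultimately have "diag_op a e x - S x = diag_op a' e x"
      unfolding diag_op_def by (simp add: sums_iff)
    then show ?thesis
      using diag_op_norm[of a' \<epsilon> x] a' \<open>\<epsilon> > 0\<close> by auto
  qed
  ultimately show "\<exists>S. compact_op S \<and> (\<forall>x. norm (diag_op a e x - S x) \<le> \<epsilon> * norm x)"
    by blast
qed

lemma diag_op_ext:
  assumes "bounded_op S" "bounded_op T" "\<And>n. S (e n) = T (e n)"
    and "\<And>x. (\<And>n. cinner (e n) x = 0) \<Longrightarrow> S x = T x"
  shows "S = T"
proof
  fix x
  obtain y where y: "(\<lambda>n. cinner (e n) x *\<^sub>C e n) sums (x - y)" "\<And>n. cinner (e n) y = 0"
    using orthonormal_expansion[OF e] by metis
  have "(\<lambda>n. S (cinner (e n) x *\<^sub>C e n)) sums S (x - y)" "(\<lambda>n. T (cinner (e n) x *\<^sub>C e n)) sums T (x - y)"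
    using y(1) by (auto intro: bounded_linear.sums[OF bounded_opD(1)] assms(1,2))
  then have "S (x - y) = T (x - y)"
    using assms(1-3) by (simp add: bounded_op_simps sums_iff)
  then show "S x = T x"
    using assms(4)[OF y(2)] by (simp add: bounded_op_simps[OF assms(1)] bounded_op_simps[OF assms(2)])
qed

lemma diag_op_comp:
  assumes "Bseq a" "Bseq b"
  shows "diag_op a e \<circ> diag_op b e = diag_op (\<lambda>n. a n * b n) e"
proof (rule diag_op_ext)
  have "Bseq (\<lambda>n. a n * b n)" using assms by (rule Bseq_mult)
  then show "bounded_op (diag_op (\<lambda>n. a n * b n) e)" by (rule bounded_op_diag_op)
  show "bounded_op (diag_op a e \<circ> diag_op b e)"
    using assms by (intro bounded_op_comp bounded_op_diag_op)
  show "(diag_op a e \<circ> diag_op b e) (e n) = diag_op (\<lambda>n. a n * b n) e (e n)" for n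
    using bounded_op_simps(6)[OF bounded_op_diag_op[OF assms(1)]]
    by (simp add: diag_op_eigen)
  show "(diag_op a e \<circ> diag_op b e) x = diag_op (\<lambda>n. a n * b n) e x" if "\<And>n. cinner (e n) x = 0" for x
    using that bounded_op_simps(4)[OF bounded_op_diag_op[OF assms(1)]] by (simp add: diag_op_kernel)
qed

end


section \<open>The spectral theorem for compact self-adjoint operators\<close>

definition selfadjoint :: "('a::complex_hilbert_space \<Rightarrow> 'a) \<Rightarrow> bool" where
  "selfadjoint A \<longleftrightarrow> (\<forall>x y. cinner (A x) y = cinner x (A y))"

lemma selfadjointD: "selfadjoint A \<Longrightarrow> cinner (A x) y = cinner x (A y)"
  by (simp add: selfadjoint_def)

lemma selfadjoint_inner: "selfadjoint A \<Longrightarrow> inner (A x) y = inner x (A y)"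
  by (metis selfadjointD Re_cinner)

text \<open>
  If \<open>L\<close> bounds \<open>A\<close> on an invariant subspace, then unit vectors there whose image has norm close
  to \<open>L\<close> are approximate eigenvectors of \<open>A\<^sup>2\<close>.
\<close>

lemma approx_eigen_square:
  assumes "bounded_op A" "selfadjoint A" "norm x = 1" "norm (A (A x)) \<le> L * norm (A x)" "L \<ge> 0"
  shows "(norm (A (A x) - L\<^sup>2 *\<^sub>R x))\<^sup>2 \<le> L\<^sup>2 * (L\<^sup>2 - (norm (A x))\<^sup>2)"
proof -
  have "inner (A (A x)) x = (norm (A x))\<^sup>2"
    by (simp add: selfadjoint_inner[OF assms(2)] power2_norm_eq_inner)
  then have "(norm (A (A x) - L\<^sup>2 *\<^sub>R x))\<^sup>2 = (norm (A (A x)))\<^sup>2 - 2 * L\<^sup>2 * (norm (A x))\<^sup>2 + L\<^sup>2 * L\<^sup>2 * (norm x)\<^sup>2"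
    by (simp add: power2_norm_eq_inner inner_diff inner_commute algebra_simps)
  moreover have "(norm (A (A x)))\<^sup>2 \<le> L\<^sup>2 * (norm (A x))\<^sup>2"
    using power_mono[OF assms(4), of 2] by (simp add: power_mult_distrib)
  ultimately show ?thesis
    using assms(3) by (simp add: algebra_simps)
qed

text \<open>
  Let \<open>L\<close> be the norm of \<open>A\<close> on the orthogonal complement of a set of eigenvectors, a subspace that
  is invariant because \<open>A\<close> is self-adjoint.  A maximising sequence consists of approximate eigenvectors
  of \<open>A\<^sup>2\<close>; compactness makes it converge along a subsequence, to an exact eigenvector for \<open>L\<^sup>2\<close>.
\<close>

lemma maximal_eigenvector:
  fixes A :: "'a::complex_hilbert_space \<Rightarrow> 'a"
  assumes A: "compact_op A" and sa: "selfadjoint A"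
    and eig: "\<And>w. w \<in> W \<Longrightarrow> \<exists>c::real. A w = c *\<^sub>R w"
    and unit: "norm u = 1" "\<And>w. w \<in> W \<Longrightarrow> cinner w u = 0"
  obtains x c where "norm x = 1" "\<forall>w\<in>W. cinner w x = 0" "A x = c *\<^sub>R x"
    "\<forall>y. (\<forall>w\<in>W. cinner w y = 0) \<longrightarrow> norm (A y) \<le> \<bar>c\<bar> * norm y"
proof -
  note bA = compact_op_bounded[OF A]
  obtain K where K: "K > 0" "\<And>x. norm (A x) \<le> K * norm x" using bounded_opE[OF bA] by metis
  define M where "M = {x. norm x = 1 \<and> (\<forall>w\<in>W. cinner w x = 0)}"
  define L where "L = (SUP x\<in>M. norm (A x))"
  have uM: "u \<in> M" using unit by (auto simp: M_def)
  have bdd: "bdd_above ((\<lambda>x. norm (A x)) ` M)"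
    using K(2) by (intro bdd_aboveI2[of _ _ K]) (metis (mono_tags, lifting) M_def mem_Collect_eq mult.right_neutral)
  have LM: "norm (A x) \<le> L" if "x \<in> M" for x
    unfolding L_def using bdd that by (rule cSUP_upper2) simp
  have L0: "L \<ge> 0" using LM[OF uM] norm_ge_zero order_trans by blast
  have Ly: "norm (A y) \<le> L * norm y" if y: "\<And>w. w \<in> W \<Longrightarrow> cinner w y = 0" for y
  proof (cases "y = 0")
    case False
    have "inverse (norm y) *\<^sub>R y \<in> M"
      using False y by (auto simp: M_def cinner_scaleR_right)
    from LM[OF this] show ?thesis
      using False by (simp add: bounded_op_simps[OF bA] field_simps)
  qed (simp add: bounded_op_simps[OF bA])
  have AM: "cinner w (A x) = 0" if "w \<in> W" "cinner w x = 0" for w x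
  proof -
    obtain c where "A w = c *\<^sub>R w" using eig[OF \<open>w \<in> W\<close>] by blast
    then show ?thesis
      using selfadjointD[OF sa, of w x] that by (simp add: cinner_scaleR_left)
  qed
  show ?thesis
  proof (cases "L = 0")
    case True
    then have "A u = 0 *\<^sub>R u" using LM[OF uM] by simp
    then show ?thesis
      using that[of u 0] unit Ly True by simp
  next
    case False
    then have Lpos: "L > 0" using L0 by simp
    have "\<exists>x. x \<in> M \<and> L - inverse (real (Suc n)) < norm (A x)" for n
    proof -
      have "L - inverse (real (Suc n)) < (SUP x\<in>M. norm (A x))" unfolding L_def[symmetric] by simp
      then show ?thesis
        using less_cSUP_iff[of M "\<lambda>x. norm (A x)"] bdd uM by blast
    qed
    then obtain x where xM: "\<And>n. x n \<in> M" and xL: "\<And>n. L - inverse (real (Suc n)) < norm (A (x n))"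
      by metis
    have lim: "(\<lambda>n. norm (A (x n))) \<longlonglongrightarrow> L"
    proof (rule tendsto_sandwich)
      show "\<forall>\<^sub>F n in sequentially. L - inverse (real (Suc n)) \<le> norm (A (x n))"
        using xL by (auto intro: always_eventually less_imp_le)
      show "\<forall>\<^sub>F n in sequentially. norm (A (x n)) \<le> L" using LM xM by auto
      show "(\<lambda>n. L - inverse (real (Suc n))) \<longlonglongrightarrow> L"
        using tendsto_diff[OF tendsto_const LIMSEQ_inverse_real_of_nat, of L] by simp
    qed simp
    have nx: "norm (x n) \<le> 1" for n using xM[of n] by (simp add: M_def)
    obtain r l where r: "strict_mono (r :: nat \<Rightarrow> nat)" and l: "(\<lambda>n. A (x (r n))) \<longlonglongrightarrow> l"
      by (rule compact_op_subseq[OF A nx]) (rule that)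
    have "(\<lambda>n. norm (A (A (x n)) - L\<^sup>2 *\<^sub>R x n)) \<longlonglongrightarrow> 0"
    proof (rule tendsto_sandwich)
      show "\<forall>\<^sub>F n in sequentially. 0 \<le> norm (A (A (x n)) - L\<^sup>2 *\<^sub>R x n)" by simp
      show "\<forall>\<^sub>F n in sequentially. norm (A (A (x n)) - L\<^sup>2 *\<^sub>R x n) \<le> sqrt (L\<^sup>2 * (L\<^sup>2 - (norm (A (x n)))\<^sup>2))"
      proof (rule always_eventually, rule allI)
        fix n
        have "norm (A (A (x n))) \<le> L * norm (A (x n))"
          using xM[of n] by (intro Ly AM) (auto simp: M_def)
        then show "norm (A (A (x n)) - L\<^sup>2 *\<^sub>R x n) \<le> sqrt (L\<^sup>2 * (L\<^sup>2 - (norm (A (x n)))\<^sup>2))"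
          using approx_eigen_square[OF bA sa, of "x n" L] xM[of n] L0
          by (intro real_le_rsqrt) (auto simp: M_def)
      qed
      have "(\<lambda>n. sqrt (L\<^sup>2 * (L\<^sup>2 - (norm (A (x n)))\<^sup>2))) \<longlonglongrightarrow> sqrt (L\<^sup>2 * (L\<^sup>2 - L\<^sup>2))"
        by (intro tendsto_intros lim)
      then show "(\<lambda>n. sqrt (L\<^sup>2 * (L\<^sup>2 - (norm (A (x n)))\<^sup>2))) \<longlonglongrightarrow> 0" by simp
    qed auto
    then have "(\<lambda>n. A (A (x n)) - L\<^sup>2 *\<^sub>R x n) \<longlonglongrightarrow> 0" by (rule tendsto_norm_zero_cancel)
    from LIMSEQ_subseq_LIMSEQ[OF this r]
    have d: "(\<lambda>n. A (A (x (r n))) - L\<^sup>2 *\<^sub>R x (r n)) \<longlonglongrightarrow> 0" by (simp add: o_def)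
    have "(\<lambda>n. A (A (x (r n))) - (A (A (x (r n))) - L\<^sup>2 *\<^sub>R x (r n))) \<longlonglongrightarrow> A l - 0"
      by (intro tendsto_diff d bounded_op_tendsto[OF bA l])
    then have "(\<lambda>n. inverse (L\<^sup>2) *\<^sub>R L\<^sup>2 *\<^sub>R x (r n)) \<longlonglongrightarrow> inverse (L\<^sup>2) *\<^sub>R A l"
      by (intro tendsto_intros) simp
    then have xz: "(\<lambda>n. x (r n)) \<longlonglongrightarrow> inverse (L\<^sup>2) *\<^sub>R A l" using Lpos by simp
    define z where "z = inverse (L\<^sup>2) *\<^sub>R A l"
    have xz: "(\<lambda>n. x (r n)) \<longlonglongrightarrow> z" using xz by (simp add: z_def)
    have "norm z = 1"
      using LIMSEQ_unique[OF tendsto_norm[OF xz]] xM by (auto simp: M_def)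
    have zW: "cinner w z = 0" if "w \<in> W" for w
      using LIMSEQ_unique[OF tendsto_cinner[OF tendsto_const xz, of w], of 0] xM that by (auto simp: M_def)
    have "(\<lambda>n. A (A (x (r n))) - L\<^sup>2 *\<^sub>R x (r n)) \<longlonglongrightarrow> A (A z) - L\<^sup>2 *\<^sub>R z"
      by (intro tendsto_intros bounded_op_tendsto[OF bA] xz)
    from LIMSEQ_unique[OF this d] have AAz: "A (A z) = L\<^sup>2 *\<^sub>R z" by simp
    \<comment> \<open>\<open>A\<^sup>2 - L\<^sup>2 = (A - L)(A + L)\<close>, so \<open>z\<close> or its image under \<open>A + L\<close> is an eigenvector of \<open>A\<close>.\<close>
    define y where "y = A z + L *\<^sub>R z"
    have yW: "cinner w y = 0" if "w \<in> W" for w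
      using AM[OF that zW[OF that]] zW[OF that] by (simp add: y_def cinner_add_right cinner_scaleR_right)
    have Ay: "A y = L *\<^sub>R y"
      by (simp add: y_def bounded_op_simps[OF bA] AAz scaleR_add_right power2_eq_square)
    show ?thesis
    proof (cases "y = 0")
      case True
      then have "A z = (- L) *\<^sub>R z" by (simp add: y_def add_eq_0_iff2)
      then show ?thesis using that[of z "- L"] \<open>norm z = 1\<close> zW Ly L0 by simp
    next
      case False
      then show ?thesis
        using that[of "inverse (norm y) *\<^sub>R y" L] yW Ly L0 Ay
        by (simp add: cinner_scaleR_right bounded_op_simps[OF bA])
    qed
  qed
qed

text \<open>
  Choose maximal eigenvectors one after the other, each orthogonal to all earlier ones.  The moduli of
  the eigenvalues decrease, and they tend to \<open>0\<close>: otherwise the vectors \<open>A e\<^sub>n = a\<^sub>n e\<^sub>n\<close> would stay a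
  fixed distance apart.  As \<open>\<bar>a\<^sub>n\<bar>\<close> bounds \<open>A\<close> on everything orthogonal to the first \<open>n\<close> eigenvectors, \<open>A\<close>
  vanishes on the common orthogonal complement.  The dimension is infinite, so the choice never stops.
\<close>

theorem spectral_theorem:
  fixes A :: "'a::complex_hilbert_space \<Rightarrow> 'a"
  assumes A: "compact_op A" and sa: "selfadjoint A"
    and inf: "\<not> (\<exists>B :: 'a set. finite B \<and> cvec.span B = UNIV)"
  obtains a e where "orthonormal_on UNIV e" "a \<longlonglongrightarrow> 0" "decseq (\<lambda>n::nat. \<bar>a n\<bar>)" "A = diag_op a e"
proof -
  note bA = compact_op_bounded[OF A]
  define P where "P f n x \<longleftrightarrow> norm x = 1 \<and> (\<forall>k<n. cinner (f k) x = 0) \<and>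
      (\<exists>c::real. A x = c *\<^sub>R x \<and> (\<forall>y. (\<forall>k<n. cinner (f k) y = 0) \<longrightarrow> norm (A y) \<le> \<bar>c\<bar> * norm y))"
    for f and n :: nat and x
  have "\<exists>e. \<forall>n. P e n (e n)"
  proof (rule dependent_wf_choice[OF wf_less_than])
    fix f g :: "nat \<Rightarrow> 'a" and n x
    assume "\<And>k. (k, n) \<in> less_than \<Longrightarrow> f k = g k"
    then show "P f n x = P g n x" by (auto simp: P_def)
  next
    fix n and f :: "nat \<Rightarrow> 'a"
    assume IH: "\<And>k. (k, n) \<in> less_than \<Longrightarrow> P f k (f k)"
    have eig: "\<exists>c. A w = c *\<^sub>R w" if "w \<in> f ` {..<n}" for w
    proof -
      obtain k where "k < n" "w = f k" using \<open>w \<in> f ` {..<n}\<close> by blast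
      then show ?thesis using IH[of k] unfolding P_def by auto
    qed
    obtain u where u: "norm u = 1" "\<And>w. w \<in> f ` {..<n} \<Longrightarrow> cinner w u = 0"
      using exists_unit_perp[OF inf, of "f ` {..<n}"] by auto
    obtain x c where x: "norm x = 1" "\<forall>w\<in>f ` {..<n}. cinner w x = 0" "A x = c *\<^sub>R x"
      and mx: "\<forall>y. (\<forall>w\<in>f ` {..<n}. cinner w y = 0) \<longrightarrow> norm (A y) \<le> \<bar>c\<bar> * norm y"
      by (rule maximal_eigenvector[OF A sa eig u])
    show "\<exists>x. P f n x"
      unfolding P_def
      by (rule exI[of _ x], intro conjI exI[of _ c]) (use x mx in simp_all)
  qed
  then obtain e where e: "\<And>n. P e n (e n)" by blast
  have "\<exists>a. \<forall>n. A (e n) = a n *\<^sub>R e n \<and> (\<forall>y. (\<forall>k<n. cinner (e k) y = 0) \<longrightarrow> norm (A y) \<le> \<bar>a n\<bar> * norm y)"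
    using e unfolding P_def by metis
  then obtain a where a: "\<And>n. A (e n) = a n *\<^sub>R e n"
    and amax: "\<And>n y. (\<And>k. k < n \<Longrightarrow> cinner (e k) y = 0) \<Longrightarrow> norm (A y) \<le> \<bar>a n\<bar> * norm y" by metis
  have en: "norm (e n) = 1" for n using e[of n] by (simp add: P_def)
  have lt: "cinner (e k) (e n) = 0" if "k < n" for k n using e[of n] that by (simp add: P_def)
  have on: "orthonormal_on UNIV e"
    by (rule orthonormal_onI_less[OF en lt])
  have dec: "decseq (\<lambda>n. \<bar>a n\<bar>)"
  proof (rule decseq_SucI)
    fix n
    have "norm (A (e (Suc n))) \<le> \<bar>a n\<bar> * norm (e (Suc n))"
      by (rule amax) (simp add: lt)
    then show "\<bar>a (Suc n)\<bar> \<le> \<bar>a n\<bar>" by (simp add: a en)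
  qed
  have a0: "a \<longlonglongrightarrow> 0"
  proof (rule ccontr)
    assume "\<not> a \<longlonglongrightarrow> 0"
    then obtain \<delta> where \<delta>: "\<delta> > 0" "\<And>N. \<exists>n\<ge>N. \<delta> \<le> \<bar>a n\<bar>"
      unfolding LIMSEQ_iff by (auto simp: not_less)
    have big: "\<delta> \<le> \<bar>a n\<bar>" for n
      using \<delta>(2)[of n] decseqD[OF dec] order_trans by blast
    obtain r l where r: "strict_mono (r :: nat \<Rightarrow> nat)" and l: "(\<lambda>n. A (e (r n))) \<longlonglongrightarrow> l"
      by (rule compact_op_subseq[OF A, of e 1]) (auto simp: en intro: that)
    have "\<delta>\<^sup>2 \<le> (norm (A (e (r (Suc n))) - A (e (r n))))\<^sup>2" for n
    proof -
      have "cinner (A (e (r (Suc n)))) (- A (e (r n))) = 0"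
        using orthonormal_onD[OF on, of "r (Suc n)" "r n"] r
        by (simp add: a cinner_minus_right cinner_scaleR_left cinner_scaleR_right strict_mono_eq)
      from norm_add_sq[OF this]
      have "(norm (A (e (r (Suc n))) - A (e (r n))))\<^sup>2 = \<bar>a (r (Suc n))\<bar>\<^sup>2 + \<bar>a (r n)\<bar>\<^sup>2"
        by (simp add: a en)
      moreover have "\<delta>\<^sup>2 \<le> \<bar>a (r n)\<bar>\<^sup>2" using big[of "r n"] \<delta>(1) by (intro power_mono) auto
      ultimately show ?thesis by (simp add: add_increasing)
    qed
    moreover have "(\<lambda>n. (norm (A (e (r (Suc n))) - A (e (r n))))\<^sup>2) \<longlonglongrightarrow> (norm (l - l))\<^sup>2"
      by (intro tendsto_intros l LIMSEQ_Suc[OF l])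
    ultimately have "\<delta>\<^sup>2 \<le> (norm (l - l))\<^sup>2"
      by (intro LIMSEQ_le_const[of _ "(norm (l - l))\<^sup>2"]) blast+
    then show False using \<delta>(1) by simp
  qed
  have "A = diag_op a e"
  proof (rule diag_op_ext[OF on])
    have "Bseq a" using a0 by (rule tendsto_imp_Bseq)
    then show "bounded_op (diag_op a e)" by (rule bounded_op_diag_op[OF on])
    show "A (e n) = diag_op a e (e n)" for n by (simp add: a diag_op_eigen[OF on])
    show "A x = diag_op a e x" if x: "\<And>n. cinner (e n) x = 0" for x
    proof -
      have "norm (A x) \<le> \<bar>a n\<bar> * norm x" for n using x by (intro amax)
      moreover have "(\<lambda>n. \<bar>a n\<bar> * norm x) \<longlonglongrightarrow> \<bar>0\<bar> * norm x" by (intro tendsto_intros a0)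
      ultimately have "norm (A x) \<le> \<bar>0\<bar> * norm x" by (intro LIMSEQ_le_const) auto
      then show ?thesis using x by (simp add: diag_op_kernel[OF on])
    qed
  qed (rule bA)
  with on a0 dec show ?thesis by (rule that)
qed


section \<open>Orthonormal bases and adjoints\<close>

text \<open>
  Gram--Schmidt along a dense sequence: each new vector brings the first member of the sequence that
  is not yet in the span into it, so after \<open>n\<close> steps the first \<open>n\<close> members are there.
\<close>

lemma ex_orthonormal_basis:
  fixes D :: "'a::complex_hilbert_space set"
  assumes D: "countable D" "closure D = UNIV"
    and inf: "\<not> (\<exists>B :: 'a set. finite B \<and> cvec.span B = UNIV)"
  obtains b :: "nat \<Rightarrow> 'a" where "orthonormal_on UNIV b" "closure (cvec.span (range b)) = UNIV"
proof -
  have "D \<noteq> {}" using D(2) by auto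
  define d where "d = from_nat_into D"
  have dD: "range d = D" unfolding d_def using \<open>D \<noteq> {}\<close> D(1) by (rule range_from_nat_into)
  define P where "P f n x \<longleftrightarrow> norm x = 1 \<and> (\<forall>k<n. cinner (f k) x = 0) \<and>
      d (LEAST m. d m \<notin> cvec.span (f ` {..<n})) \<in> cvec.span (insert x (f ` {..<n}))"
    for f and n :: nat and x :: 'a
  have ex: "\<exists>m. d m \<notin> cvec.span W" if W: "finite W" for W
  proof (rule ccontr)
    assume "\<nexists>m. d m \<notin> cvec.span W"
    then have DW: "D \<subseteq> cvec.span W" using dD by blast
    obtain u where u: "norm u = 1" "\<And>w. w \<in> W \<Longrightarrow> cinner w u = 0"
      using exists_unit_perp[OF inf W] by blast
    have uW: "cinner x u = 0" if "x \<in> cvec.span W" for x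
      using that by (induction rule: cvec.span_induct_alt) (auto simp: cinner_add_left cinner_scaleC_left u)
    have "u \<in> closure D" using D by simp
    then obtain s where s: "\<And>n. s n \<in> D" "s \<longlonglongrightarrow> u" using closure_sequential by blast
    have "(\<lambda>n. cinner (s n) u) \<longlonglongrightarrow> cinner u u" by (intro tendsto_cinner s tendsto_const)
    moreover have "cinner (s n) u = 0" for n using s(1)[of n] DW uW by blast
    ultimately have "cinner u u = 0" using LIMSEQ_unique[of "\<lambda>n. 0" 0 "cinner u u"] by simp
    then show False using u(1) by (simp add: cinner_self)
  qed
  have "\<exists>b. \<forall>n. P b n (b n)"
  proof (rule dependent_wf_choice[OF wf_less_than])
    fix f g :: "nat \<Rightarrow> 'a" and n x
    assume "\<And>k. (k, n) \<in> less_than \<Longrightarrow> f k = g k"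
    then have "f ` {..<n} = g ` {..<n}" "\<forall>k<n. f k = g k" by auto
    then show "P f n x = P g n x" by (auto simp: P_def)
  next
    fix n and f :: "nat \<Rightarrow> 'a"
    let ?W = "f ` {..<n}"
    define v where "v = d (LEAST m. d m \<notin> cvec.span ?W)"
    have v: "v \<notin> cvec.span ?W" unfolding v_def using LeastI_ex[OF ex[of ?W]] by simp
    have "finite ?W" by simp
    then obtain p where p: "p \<in> cvec.span ?W" "\<And>w. w \<in> cvec.span ?W \<Longrightarrow> cinner w (v - p) = 0"
      by (rule orthogonal_projection[of ?W v]) blast
    have z: "v - p \<noteq> 0" using p(1) v by auto
    define x where "x = complex_of_real (inverse (norm (v - p))) *\<^sub>C (v - p)"
    have "complex_of_real (norm (v - p)) *\<^sub>C x = v - p"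
      using z by (simp add: x_def scaleC_scaleC flip: of_real_mult)
    then have "v = p + complex_of_real (norm (v - p)) *\<^sub>C x" by simp
    moreover have "p \<in> cvec.span (insert x ?W)" using p(1) cvec.span_mono[of ?W "insert x ?W"] by blast
    moreover have "complex_of_real (norm (v - p)) *\<^sub>C x \<in> cvec.span (insert x ?W)"
      by (intro cvec.span_scale cvec.span_base) simp
    ultimately have "v \<in> cvec.span (insert x ?W)"
      using cvec.span_add[of p "insert x ?W" "complex_of_real (norm (v - p)) *\<^sub>C x"] by simp
    moreover have "norm x = 1" using z by (simp add: x_def norm_scaleC norm_inverse)
    moreover have "cinner (f k) x = 0" if "k < n" for k
      using p(2)[OF cvec.span_base, of "f k"] that by (simp add: x_def cinner_scaleC_right)
    ultimately show "\<exists>x. P f n x" unfolding P_def v_def by blast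
  qed
  then obtain b where b: "\<And>n. P b n (b n)" by blast
  have bn: "norm (b n) = 1" for n using b[of n] by (simp add: P_def)
  have lt: "cinner (b k) (b n) = 0" if "k < n" for k n using b[of n] that by (simp add: P_def)
  have on: "orthonormal_on UNIV b"
    by (rule orthonormal_onI_less[OF bn lt])
  have "\<forall>k<n. d k \<in> cvec.span (b ` {..<n})" for n
  proof (induction n)
    case (Suc n)
    have sub: "cvec.span (b ` {..<n}) \<subseteq> cvec.span (b ` {..<Suc n})" by (intro cvec.span_mono) auto
    have "d n \<in> cvec.span (b ` {..<Suc n})"
    proof (cases "d n \<in> cvec.span (b ` {..<n})")
      case False
      have "(LEAST m. d m \<notin> cvec.span (b ` {..<n})) = n"
        by (rule Least_equality) (use False Suc in \<open>auto simp: not_less[symmetric]\<close>)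
      then show ?thesis using b[of n] by (simp add: P_def lessThan_Suc)
    qed (use sub in blast)
    then show ?case using Suc sub by (auto simp: less_Suc_eq)
  qed simp
  then have "d k \<in> cvec.span (range b)" for k
    using cvec.span_mono[of "b ` {..<Suc k}" "range b"] by blast
  then have "D \<subseteq> cvec.span (range b)" using dD by blast
  then have "closure (cvec.span (range b)) = UNIV" using closure_mono[of D] D(2) by auto
  with on show ?thesis by (rule that)
qed


locale separable_hilbert =
  assumes separable: "\<exists>D :: 'a::complex_hilbert_space set. countable D \<and> closure D = UNIV"
    and infinite_dim: "\<not> (\<exists>B :: 'a set. finite B \<and> cvec.span B = UNIV)"

lemma cinner_span_zero:
  "x \<in> cvec.span W \<Longrightarrow> (\<And>w. w \<in> W \<Longrightarrow> cinner w y = 0) \<Longrightarrow> cinner x y = 0"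
  by (induction rule: cvec.span_induct_alt) (auto simp: cinner_add_left cinner_scaleC_left)

lemma dense_span_perp:
  assumes "closure (cvec.span W) = UNIV" "\<And>w. w \<in> W \<Longrightarrow> cinner w y = 0"
  shows "y = 0"
proof -
  have "y \<in> closure (cvec.span W)" using assms(1) by simp
  then obtain s where s: "\<And>n. s n \<in> cvec.span W" "s \<longlonglongrightarrow> y"
    unfolding closure_sequential by blast
  have "cinner (s n) y = 0" for n using cinner_span_zero[OF s(1)] assms(2) by blast
  then have "cinner y y = 0"
    using LIMSEQ_unique[OF tendsto_cinner[OF s(2) tendsto_const, of y], of 0] by simp
  then show ?thesis by (simp add: cinner_self)
qed

lemma (in separable_hilbert) obtain_basis:
  obtains b :: "nat \<Rightarrow> 'a" where "orthonormal_on UNIV b" "closure (cvec.span (range b)) = UNIV"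
    "\<forall>x. (\<lambda>n. cinner (b n) x *\<^sub>C b n) sums x"
proof -
  obtain D :: "'a set" where D: "countable D" "closure D = UNIV" using separable by blast
  obtain b :: "nat \<Rightarrow> 'a" where b: "orthonormal_on UNIV b" "closure (cvec.span (range b)) = UNIV"
    by (rule ex_orthonormal_basis[OF D infinite_dim])
  have "(\<lambda>n. cinner (b n) x *\<^sub>C b n) sums x" for x
  proof -
    obtain y where y: "(\<lambda>n. cinner (b n) x *\<^sub>C b n) sums (x - y)" "\<And>n. cinner (b n) y = 0"
      using orthonormal_expansion[OF b(1)] by metis
    have "y = 0" using y(2) by (intro dense_span_perp[OF b(2)]) auto
    then show ?thesis using y(1) by simp
  qed
  then have "\<forall>x. (\<lambda>n. cinner (b n) x *\<^sub>C b n) sums x" by blast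
  with b show ?thesis by (rule that)
qed

lemma adj_op_eqI:
  assumes "\<And>x y. cinner (T x) y = cinner x (S y)"
  shows "adj_op T = S"
  unfolding adj_op_def
proof (rule the_equality)
  show "\<forall>x y. cinner (T x) y = cinner x (S y)" using assms by blast
  fix S' assume S': "\<forall>x y. cinner (T x) y = cinner x (S' y)"
  show "S' = S"
  proof
    show "S' y = S y" for y
      by (rule cinner_ext) (metis assms S')
  qed
qed

context separable_hilbert
begin

text \<open>Riesz representation, through the coefficients with respect to a basis.\<close>

lemma ex_adjoint:
  fixes T :: "'a \<Rightarrow> 'a"
  assumes T: "bounded_op T"
  shows "\<exists>S. \<forall>x y. cinner (T x) y = cinner x (S y)"
proof -
  obtain b :: "nat \<Rightarrow> 'a" where b: "orthonormal_on UNIV b" "closure (cvec.span (range b)) = UNIV"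
    and exp: "\<forall>x. (\<lambda>n. cinner (b n) x *\<^sub>C b n) sums x"
    by (rule obtain_basis)
  obtain K where K: "K > 0" "\<And>x. norm (T x) \<le> K * norm x" using bounded_opE[OF T] by metis
  have "\<exists>z. \<forall>x. cinner (T x) y = cinner x z" for y
  proof -
    define c where "c n = cinner (T (b n)) y" for n
    have bound: "(\<Sum>n<N. (cmod (c n))\<^sup>2) \<le> (K * norm y)\<^sup>2" for N
    proof -
      define z where "z = (\<Sum>n<N. c n *\<^sub>C b n)"
      have nz: "(norm z)\<^sup>2 = (\<Sum>n<N. (cmod (c n))\<^sup>2)"
        unfolding z_def by (rule norm_orthonormal_sum) (auto intro: orthonormal_on_subset[OF b(1)])
      have "cinner (T z) y = (\<Sum>n<N. cnj (c n) * c n)"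
        by (simp add: z_def bounded_op_simps[OF T] cinner_sum_left cinner_scaleC_left c_def)
      also have "\<dots> = of_real ((norm z)\<^sup>2)"
        by (simp add: nz complex_norm_square mult.commute del: of_real_power)
      finally have "(norm z)\<^sup>2 = cmod (cinner (T z) y)" by (simp add: norm_power)
      also have "\<dots> \<le> norm (T z) * norm y" by (rule cauchy_schwarz)
      also have "\<dots> \<le> K * norm z * norm y" using K by (intro mult_right_mono) auto
      finally have "(norm z)\<^sup>2 \<le> (K * norm y) * norm z" by (simp add: mult_ac)
      then have "norm z \<le> K * norm y" by (rule norm_le_of_square_le) (use K in auto)
      then show ?thesis unfolding nz[symmetric] by (intro power_mono) auto
    qed
    have s: "summable (\<lambda>n. c n *\<^sub>C b n)"
      by (intro summable_orthonormal[OF b(1)] summableI_nonneg_bounded[OF _ bound]) auto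
    have "cinner (T x) y = cinner x (\<Sum>n. c n *\<^sub>C b n)" for x
    proof -
      have "(\<lambda>n. cinner (T (cinner (b n) x *\<^sub>C b n)) y) sums cinner (T x) y"
        by (intro bounded_linear.sums[OF bounded_linear_cinner_left] bounded_linear.sums[OF bounded_opD(1)[OF T]] exp[rule_format])
      moreover have "(\<lambda>n. cinner (cinner (b n) x *\<^sub>C b n) (\<Sum>n. c n *\<^sub>C b n)) sums cinner x (\<Sum>n. c n *\<^sub>C b n)"
        by (intro bounded_linear.sums[OF bounded_linear_cinner_left] exp[rule_format])
      ultimately show ?thesis
        by (simp add: bounded_op_simps[OF T] cinner_scaleC_left cinner_suminf_orthonormal[OF b(1) s] c_def[symmetric] sums_iff)
    qed
    then show ?thesis by blast
  qed
  then show ?thesis by metis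
qed

lemma adj_op:
  fixes T :: "'a \<Rightarrow> 'a"
  assumes "bounded_op T"
  shows "cinner (T x) y = cinner x (adj_op T y)" "cinner (adj_op T x) y = cinner x (T y)"
proof -
  obtain S where S: "\<And>x y. cinner (T x) y = cinner x (S y)" using ex_adjoint[OF assms] by blast
  have "adj_op T = S" by (rule adj_op_eqI) (rule S)
  then show 1: "cinner (T x) y = cinner x (adj_op T y)" for x y by (simp add: S)
  show "cinner (adj_op T x) y = cinner x (T y)"
    using arg_cong[OF 1[of y x], of cnj] by (simp add: cinner_commute[symmetric])
qed

lemma bounded_op_adj:
  fixes T :: "'a \<Rightarrow> 'a"
  assumes T: "bounded_op T" shows "bounded_op (adj_op T)"
proof -
  obtain K where K: "K > 0" "\<And>x. norm (T x) \<le> K * norm x" using bounded_opE[OF T] by metis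
  show ?thesis
  proof (rule bounded_opI)
    show "adj_op T (x + y) = adj_op T x + adj_op T y" for x y
      by (rule cinner_ext) (simp add: adj_op(1)[OF T, symmetric] cinner_add_right)
    show "adj_op T (c *\<^sub>C x) = c *\<^sub>C adj_op T x" for c x
      by (rule cinner_ext) (simp add: adj_op(1)[OF T, symmetric] cinner_scaleC_right)
    show "norm (adj_op T y) \<le> K * norm y" for y
    proof (rule norm_le_of_square_le)
      have "(norm (adj_op T y))\<^sup>2 = cmod (cinner (T (adj_op T y)) y)"
        by (rule cmod_cinner_eq_norm_sq) (rule adj_op(1)[OF T])
      also have "\<dots> \<le> norm (T (adj_op T y)) * norm y" by (rule cauchy_schwarz)
      also have "\<dots> \<le> K * norm (adj_op T y) * norm y" using K by (intro mult_right_mono) auto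
      finally show "(norm (adj_op T y))\<^sup>2 \<le> (K * norm y) * norm (adj_op T y)" by (simp add: mult_ac)
    qed (use K in auto)
  qed
qed

lemma adj_op_add:
  fixes S T :: "'a \<Rightarrow> 'a"
  assumes "bounded_op S" "bounded_op T"
  shows "adj_op (\<lambda>x. S x + T x) = (\<lambda>x. adj_op S x + adj_op T x)"
  by (rule adj_op_eqI) (simp add: cinner_add_left cinner_add_right adj_op(1) assms)

lemma adj_op_scale:
  fixes T :: "'a \<Rightarrow> 'a"
  assumes "bounded_op T"
  shows "adj_op (\<lambda>x. c *\<^sub>C T x) = (\<lambda>x. cnj c *\<^sub>C adj_op T x)"
  by (rule adj_op_eqI) (simp add: cinner_scaleC_left cinner_scaleC_right adj_op(1) assms)

text \<open>\<open>\<parallel>T\<^sup>* x\<parallel>\<^sup>2 \<le> \<parallel>x\<parallel> \<parallel>T T\<^sup>* x\<parallel>\<close> turns convergence of \<open>T T\<^sup>* x\<^sub>n\<close> into that of \<open>T\<^sup>* x\<^sub>n\<close>.\<close>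

lemma compact_op_adj:
  fixes T :: "'a \<Rightarrow> 'a"
  assumes T: "compact_op T" shows "compact_op (adj_op T)"
proof (rule compact_opI)
  note bT = compact_op_bounded[OF T]
  show bA: "bounded_op (adj_op T)" by (rule bounded_op_adj[OF bT])
  obtain K where K: "K > 0" "\<And>x. norm (adj_op T x) \<le> K * norm x" using bounded_opE[OF bA] by metis
  fix x :: "nat \<Rightarrow> 'a" assume x: "\<And>n. norm (x n) \<le> 1"
  have "norm (adj_op T (x n)) \<le> K" for n
    using order_trans[OF K(2) mult_left_le[OF x]] K(1) by simp
  then obtain r l where r: "strict_mono (r :: nat \<Rightarrow> nat)" and l: "(\<lambda>n. T (adj_op T (x (r n)))) \<longlonglongrightarrow> l"
    by (rule compact_op_subseq[OF T])
  have "Cauchy (\<lambda>n. adj_op T (x (r n)))"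
    unfolding Cauchy_iff
  proof (intro allI impI)
    fix \<epsilon> :: real assume \<epsilon>: "\<epsilon> > 0"
    then have "\<epsilon>\<^sup>2 / 2 > 0" by simp
    then obtain M where M: "\<And>m n. m \<ge> M \<Longrightarrow> n \<ge> M \<Longrightarrow> norm (T (adj_op T (x (r m))) - T (adj_op T (x (r n)))) < \<epsilon>\<^sup>2 / 2"
      using LIMSEQ_imp_Cauchy[OF l] unfolding Cauchy_iff by blast
    have "norm (adj_op T (x (r m)) - adj_op T (x (r n))) < \<epsilon>" if mn: "m \<ge> M" "n \<ge> M" for m n
    proof -
      define u where "u = x (r m) - x (r n)"
      have u: "norm u \<le> 2" using norm_triangle_ineq4[of "x (r m)" "x (r n)"] x[of "r m"] x[of "r n"] by (simp add: u_def)
      have "(norm (adj_op T u))\<^sup>2 = cmod (cinner u (T (adj_op T u)))"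
        by (rule cmod_cinner_eq_norm_sq) (rule adj_op(2)[OF bT, symmetric])
      also have "\<dots> \<le> norm u * norm (T (adj_op T u))" by (rule cauchy_schwarz)
      also have "\<dots> \<le> 2 * norm (T (adj_op T u))" using u by (intro mult_right_mono) auto
      also have "T (adj_op T u) = T (adj_op T (x (r m))) - T (adj_op T (x (r n)))"
        by (simp add: u_def bounded_op_simps(2)[OF bA] bounded_op_simps(2)[OF bT])
      also have "2 * norm (T (adj_op T (x (r m))) - T (adj_op T (x (r n)))) < \<epsilon>\<^sup>2"
        using M[OF mn] by simp
      finally have "norm (adj_op T u) < \<epsilon>" using \<epsilon> by (simp add: power_less_imp_less_base)
      then show ?thesis by (simp add: u_def bounded_op_simps(2)[OF bA])
    qed
    then show "\<exists>M. \<forall>m\<ge>M. \<forall>n\<ge>M. norm (adj_op T (x (r m)) - adj_op T (x (r n))) < \<epsilon>" by blast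
  qed
  then obtain l' where "(\<lambda>n. adj_op T (x (r n))) \<longlonglongrightarrow> l'"
    using Cauchy_convergent_iff convergent_def by blast
  then show "\<exists>r l. strict_mono (r :: nat \<Rightarrow> nat) \<and> (\<lambda>n. adj_op T (x (r n))) \<longlonglongrightarrow> l"
    using r by blast
qed

end

section \<open>Absolute values and singular values\<close>

lemma adj_op_selfadjoint: "selfadjoint A \<Longrightarrow> adj_op A = A"
  by (rule adj_op_eqI) (simp add: selfadjoint_def)

text \<open>In a complex space a real quadratic form comes from a self-adjoint operator (polarisation).\<close>

lemma positive_op_selfadjoint:
  assumes "positive_op R" shows "selfadjoint R"
  unfolding selfadjoint_def
proof (intro allI)
  fix x y
  have bR: "bounded_op R" using assms by (simp add: positive_op_def)
  have real: "Im (cinner z (R z)) = 0" for z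
    using assms by (auto simp: positive_op_def complex_nonneg_Reals_iff)
  have "Im (cinner x (R y) + cinner y (R x)) = 0"
    using real[of "x + y"] real[of x] real[of y]
    by (simp add: bounded_op_simps[OF bR] cinner_add_left cinner_add_right)
  moreover have "Im (\<i> * cinner x (R y) - \<i> * cinner y (R x)) = 0"
    using real[of "x + \<i> *\<^sub>C y"] real[of x] real[of y]
    by (simp add: bounded_op_simps[OF bR] cinner_add_left cinner_add_right cinner_scaleC_left cinner_scaleC_right)
  moreover have "cinner (R x) y = cnj (cinner y (R x))" by (rule cinner_commute)
  ultimately show "cinner (R x) y = cinner x (R y)"
    by (simp add: complex_eq_iff)
qed

text \<open>
  A positive square root is forced on eigenvectors of its square: \<open>R x - \<surd>c x\<close> is an eigenvector of
  \<open>R\<close> for \<open>-\<surd>c\<close>, so it vanishes by positivity if \<open>c > 0\<close>; for \<open>c = 0\<close>, \<open>\<parallel>R x\<parallel>\<^sup>2\<close> is the pairing of \<open>x\<close> with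
  \<open>R (R x)\<close>.
\<close>

lemma positive_root_eigen:
  assumes R: "positive_op R" and x: "R (R x) = c *\<^sub>R x" and c: "c \<ge> 0"
  shows "R x = sqrt c *\<^sub>R x"
proof (cases "c = 0")
  case True
  have "cinner (R x) (R x) = cinner x (R (R x))"
    by (rule selfadjointD[OF positive_op_selfadjoint[OF R]])
  then have "cinner (R x) (R x) = 0" using x True by simp
  then show ?thesis using True by (simp add: cinner_self)
next
  case False
  have bR: "bounded_op R" using R by (simp add: positive_op_def)
  define y where "y = R x - sqrt c *\<^sub>R x"
  have "R y = - (sqrt c *\<^sub>R y)"
    using c by (simp add: y_def bounded_op_simps[OF bR] x scaleR_diff_right)
  then have "cinner y (R y) = of_real (- (sqrt c * (norm y)\<^sup>2))"
    by (simp add: cinner_minus_right cinner_scaleR_right cinner_self)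
  moreover have "cinner y (R y) \<in> \<real>\<^sub>\<ge>\<^sub>0" using R by (simp add: positive_op_def)
  ultimately have "complex_of_real (- (sqrt c * (norm y)\<^sup>2)) \<in> \<real>\<^sub>\<ge>\<^sub>0" by (simp only:)
  then have "sqrt c * (norm y)\<^sup>2 \<le> 0"
    unfolding nonneg_Reals_of_real_iff by linarith
  moreover have "sqrt c > 0" using False c by simp
  ultimately have "y = 0" by (simp add: mult_le_0_iff)
  then show ?thesis by (simp add: y_def)
qed

lemma Bseq_sqrt: "Bseq q \<Longrightarrow> (\<And>n. q n \<ge> 0) \<Longrightarrow> Bseq (\<lambda>n. sqrt (q n))"
proof -
  assume "Bseq q" "\<And>n. q n \<ge> 0"
  then obtain K where "\<And>n. \<bar>q n\<bar> \<le> K" using BseqE_abs by metis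
  then have "norm (sqrt (q n)) \<le> sqrt K" for n
    using \<open>\<And>n. q n \<ge> 0\<close> by (simp add: abs_le_iff real_sqrt_le_mono)
  then show ?thesis by (rule BseqI')
qed

lemma positive_root_diag:
  assumes e: "orthonormal_on UNIV e" and q: "Bseq q" "\<And>n. q n \<ge> 0"
    and R: "positive_op R" "R \<circ> R = diag_op q e"
  shows "R = diag_op (\<lambda>n. sqrt (q n)) e"
proof (rule diag_op_ext[OF e])
  show "bounded_op R" using R(1) by (simp add: positive_op_def)
  show "bounded_op (diag_op (\<lambda>n. sqrt (q n)) e)"
    by (intro bounded_op_diag_op[OF e] Bseq_sqrt q)
  have RR: "R (R x) = diag_op q e x" for x using R(2) by (simp add: o_def fun_eq_iff)
  show "R (e n) = diag_op (\<lambda>n. sqrt (q n)) e (e n)" for n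
    using positive_root_eigen[OF R(1), of "e n" "q n"] q by (simp add: RR diag_op_eigen[OF e])
  show "R x = diag_op (\<lambda>n. sqrt (q n)) e x" if "\<And>n. cinner (e n) x = 0" for x
    using positive_root_eigen[OF R(1), of x 0] that by (simp add: RR diag_op_kernel[OF e])
qed

context separable_hilbert
begin

text \<open>
  The spectral theorem for \<open>T\<^sup>*T\<close> provides a positive square root, and a positive square root of a
  diagonal operator is unique.  The uniqueness is exported too, to identify \<open>\<bar>T\<bar>\<close> in special cases.
\<close>

lemma abs_op_diag:
  fixes T :: "'a \<Rightarrow> 'a"
  assumes T: "compact_op T"
  obtains s e where "orthonormal_on UNIV e" "s \<longlonglongrightarrow> 0" "decseq s" "\<forall>n. s n \<ge> 0" "abs_op T = diag_op s e"
    "\<forall>P. positive_op P \<and> P \<circ> P = adj_op T \<circ> T \<longrightarrow> P = diag_op s e"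
    "diag_op s e \<circ> diag_op s e = adj_op T \<circ> T"
proof -
  note bT = compact_op_bounded[OF T]
  have "compact_op (adj_op T \<circ> T)" by (intro compact_op_comp bounded_op_adj bT T)
  moreover have "selfadjoint (adj_op T \<circ> T)"
    unfolding selfadjoint_def o_def by (simp add: adj_op(2)[OF bT] adj_op(1)[OF bT, symmetric])
  ultimately obtain q e where e: "orthonormal_on UNIV e" and q: "q \<longlonglongrightarrow> 0" "decseq (\<lambda>n. \<bar>q n\<bar>)"
    and Q: "adj_op T \<circ> T = diag_op q e"
    by (rule spectral_theorem[OF _ _ infinite_dim])
  have B: "Bseq q" using q(1) by (rule tendsto_imp_Bseq)
  have q0: "q n \<ge> 0" for n
  proof -
    have "cinner (T (e n)) (T (e n)) = cinner (e n) ((adj_op T \<circ> T) (e n))"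
      by (simp add: adj_op(1)[OF bT])
    also have "\<dots> = of_real (q n)"
      unfolding Q by (simp add: cinner_diag_op[OF e B] orthonormal_onD[OF e])
    finally have "(norm (T (e n)))\<^sup>2 = q n" unfolding cinner_self of_real_eq_iff .
    then show ?thesis by (metis zero_le_power2)
  qed
  define s where "s n = sqrt (q n)" for n
  have s0: "s \<longlonglongrightarrow> 0" unfolding s_def using tendsto_real_sqrt[OF q(1)] by simp
  have Bs: "Bseq s" unfolding s_def by (intro Bseq_sqrt B q0)
  have sn: "\<forall>n. s n \<ge> 0" by (simp add: s_def q0)
  have dec: "decseq s"
    unfolding decseq_def s_def
  proof (intro allI impI real_sqrt_le_mono)
    show "q n \<le> q m" if "m \<le> n" for m n using decseqD[OF q(2) that] q0 by (simp add: abs_of_nonneg)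
  qed
  have uniq: "\<forall>P. positive_op P \<and> P \<circ> P = adj_op T \<circ> T \<longrightarrow> P = diag_op s e"
    unfolding Q s_def using positive_root_diag[OF e B q0] by blast
  have pos: "positive_op (diag_op s e)" using sn by (intro positive_op_diag_op[OF e Bs]) simp
  have sq: "diag_op s e \<circ> diag_op s e = adj_op T \<circ> T"
    unfolding Q diag_op_comp[OF e Bs Bs] by (rule arg_cong[of _ _ "\<lambda>a. diag_op a e"]) (simp add: fun_eq_iff s_def q0)
  have "abs_op T = diag_op s e"
    unfolding abs_op_def using pos sq uniq by (intro the_equality) blast+
  from that[OF e s0 dec sn this uniq sq] show ?thesis .
qed

lemma abs_op_eqI:
  fixes T :: "'a \<Rightarrow> 'a"
  assumes "compact_op T" "positive_op P" "P \<circ> P = adj_op T \<circ> T"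
  shows "abs_op T = P"
proof -
  obtain s and e :: "nat \<Rightarrow> 'a" where "abs_op T = diag_op s e" "\<forall>P. positive_op P \<and> P \<circ> P = adj_op T \<circ> T \<longrightarrow> P = diag_op s e"
    by (rule abs_op_diag[OF assms(1)])
  then show ?thesis using assms(2,3) by metis
qed

lemma abs_op_positive:
  fixes P :: "'a \<Rightarrow> 'a"
  assumes "compact_op P" "positive_op P" shows "abs_op P = P"
  by (rule abs_op_eqI[OF assms]) (simp add: adj_op_selfadjoint[OF positive_op_selfadjoint[OF assms(2)]])

end

text \<open>
  If \<open>t n < s n\<close>, the values of \<open>s\<close> up to index \<open>n\<close> are taken at least \<open>n + 1\<close> times by \<open>s\<close>, but all of them
  lie above \<open>t n\<close> and so are taken at most \<open>n\<close> times by \<open>t\<close>.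
\<close>

lemma decseq_le_of_multiplicity:
  fixes s t :: "nat \<Rightarrow> real"
  assumes "decseq s" "decseq t" "\<And>n. t n \<ge> 0"
    and fin: "\<And>a. a > 0 \<Longrightarrow> finite {n. s n = a}" "\<And>a. a > 0 \<Longrightarrow> finite {n. t n = a}"
    and card: "\<And>a. a > 0 \<Longrightarrow> card {n. s n = a} = card {n. t n = a}"
  shows "s n \<le> t n"
proof (rule ccontr)
  assume "\<not> s n \<le> t n"
  then have lt: "t n < s n" by simp
  define V where "V = s ` {..n}"
  have V: "finite V" by (simp add: V_def)
  have Vpos: "v > t n" if "v \<in> V" for v
    using that lt decseqD[OF assms(1)] by (fastforce simp: V_def)
  have Vpos0: "v > 0" if "v \<in> V" for v using Vpos[OF that] assms(3)[of n] by linarith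
  have "Suc n = card {..n}" by simp
  also have "\<dots> \<le> card (\<Union>v\<in>V. {k. s k = v})"
    using V fin(1)[OF Vpos0] by (intro card_mono) (auto simp: V_def)
  also have "\<dots> = (\<Sum>v\<in>V. card {k. s k = v})"
    using V fin(1)[OF Vpos0] by (intro card_UN_disjoint) auto
  also have "\<dots> = (\<Sum>v\<in>V. card {k. t k = v})"
    by (rule sum.cong) (auto simp: card[OF Vpos0])
  also have "\<dots> = card (\<Union>v\<in>V. {k. t k = v})"
    using V fin(2)[OF Vpos0] by (intro card_UN_disjoint[symmetric]) auto
  also have "\<dots> \<le> card {..<n}"
  proof (intro card_mono)
    show "(\<Union>v\<in>V. {k. t k = v}) \<subseteq> {..<n}"
    proof
      fix k assume "k \<in> (\<Union>v\<in>V. {k. t k = v})"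
      then have "t k \<in> V" by blast
      then have "t n < t k" by (rule Vpos)
      then show "k \<in> {..<n}" using decseqD[OF assms(2), of n k] by (cases "n \<le> k") auto
    qed
  qed simp
  finally show False by simp
qed

lemma finite_level_set:
  fixes s :: "nat \<Rightarrow> real"
  assumes "s \<longlonglongrightarrow> 0" "a > 0"
  shows "finite {n. s n = a}"
proof -
  obtain N where N: "\<And>n. n \<ge> N \<Longrightarrow> \<bar>s n\<bar> < a" using LIMSEQ_D[OF assms] by auto
  have "{n. s n = a} \<subseteq> {..<N}"
  proof
    fix n assume "n \<in> {n. s n = a}"
    then have "s n = a" by simp
    then show "n \<in> {..<N}" using N[of n] assms(2) by (cases "n < N") auto
  qed
  then show ?thesis by (rule finite_subset) simp
qed

text \<open>
  An eigenvector for \<open>a > 0\<close> has no component off the finitely many \<open>e\<^sub>n\<close> with \<open>s\<^sub>n = a\<close>, nor off the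
  sequence \<open>e\<close>.
\<close>

lemma dim_eigenspace_diag_op:
  assumes e: "orthonormal_on UNIV e" and s: "s \<longlonglongrightarrow> 0" and a: "a > 0"
  shows "cvec.dim {x. diag_op s e x = a *\<^sub>R x} = card {n. s n = a}"
proof -
  define N where "N = {n. s n = a}"
  have B: "Bseq s" using s by (rule tendsto_imp_Bseq)
  have fin: "finite N" unfolding N_def by (rule finite_level_set[OF s a])
  have "{x. diag_op s e x = a *\<^sub>R x} = cvec.span (e ` N)"
  proof (intro equalityI subsetI)
    fix x assume "x \<in> cvec.span (e ` N)"
    then show "x \<in> {x. diag_op s e x = a *\<^sub>R x}"
    proof (induction rule: cvec.span_induct_alt)
      case (step c b y)
      then show ?case
        by (auto simp: N_def bounded_op_simps[OF bounded_op_diag_op[OF e B]] diag_op_eigen[OF e] scaleC_add_right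
            scaleR_scaleC scaleC_scaleC mult.commute)
    qed (simp add: bounded_op_simps[OF bounded_op_diag_op[OF e B]])
  next
    fix x assume "x \<in> {x. diag_op s e x = a *\<^sub>R x}"
    then have x: "diag_op s e x = a *\<^sub>R x" by simp
    have c: "cinner (e n) x = 0" if "n \<notin> N" for n
    proof -
      have "of_real (s n) * cinner (e n) x = of_real a * cinner (e n) x"
        using arg_cong[OF x, of "cinner (e n)"] by (simp add: cinner_diag_op[OF e B] cinner_scaleR_right)
      then show ?thesis using that by (auto simp: N_def)
    qed
    have "(\<lambda>n. (of_real (s n) * cinner (e n) x) *\<^sub>C e n) sums (\<Sum>n\<in>N. (of_real (s n) * cinner (e n) x) *\<^sub>C e n)"
      by (rule sums_finite[OF fin]) (simp add: c)
    then have "a *\<^sub>R x = (\<Sum>n\<in>N. (of_real (s n) * cinner (e n) x) *\<^sub>C e n)"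
      using diag_op_sums[OF e B, of x] x by (simp add: sums_iff)
    also have "\<dots> \<in> cvec.span (e ` N)"
      by (intro cvec.span_sum cvec.span_scale cvec.span_base) simp
    finally have "complex_of_real (inverse a) *\<^sub>C a *\<^sub>R x \<in> cvec.span (e ` N)"
      by (rule cvec.span_scale)
    moreover have "complex_of_real (inverse a) *\<^sub>C a *\<^sub>R x = x"
      using a unfolding scaleR_scaleC scaleC_scaleC by (simp flip: of_real_mult)
    ultimately show "x \<in> cvec.span (e ` N)" by simp
  qed
  then have "cvec.dim {x. diag_op s e x = a *\<^sub>R x} = card (e ` N)"
    using cvec.dim_span_eq_card_independent[OF independent_orthonormal[OF orthonormal_image(1)[OF e]]] by simp
  then show ?thesis by (simp add: orthonormal_image(2)[OF e] N_def)
qed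

lemma singular_value_eqI:
  assumes e: "orthonormal_on UNIV e" and s: "s \<longlonglongrightarrow> 0" "decseq s" "\<And>n. s n \<ge> 0"
    and T: "abs_op T = diag_op s e"
  shows "singular_value T = s"
  unfolding singular_value_def T
proof (rule the_equality)
  show "decseq s \<and> (\<forall>n. 0 \<le> s n) \<and> (\<forall>a>0. finite {n. s n = a} \<and> card {n. s n = a} = cvec.dim {x. diag_op s e x = a *\<^sub>R x})"
    using s finite_level_set[OF s(1)] dim_eigenspace_diag_op[OF e s(1)] by simp
  fix t assume t: "decseq t \<and> (\<forall>n. 0 \<le> t n) \<and> (\<forall>a>0. finite {n. t n = a} \<and> card {n. t n = a} = cvec.dim {x. diag_op s e x = a *\<^sub>R x})"
  have fin: "finite {n. t n = a}" "finite {n. s n = a}" "card {n. t n = a} = card {n. s n = a}" if "a > 0" for a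
    using t that finite_level_set[OF s(1) that] dim_eigenspace_diag_op[OF e s(1) that] by auto
  show "t = s"
  proof
    fix n
    show "t n = s n"
    proof (rule antisym)
      show "t n \<le> s n" by (rule decseq_le_of_multiplicity) (use t s fin in auto)
      show "s n \<le> t n" by (rule decseq_le_of_multiplicity) (use t s fin in auto)
    qed
  qed
qed

context separable_hilbert
begin

lemma singular_value_diag:
  fixes T :: "'a \<Rightarrow> 'a"
  assumes T: "compact_op T"
  obtains e where "orthonormal_on UNIV e" "abs_op T = diag_op (singular_value T) e"
    "singular_value T \<longlonglongrightarrow> 0" "decseq (singular_value T)" "\<forall>n. singular_value T n \<ge> 0"
    "\<forall>x. norm (T x) = norm (diag_op (singular_value T) e x)"
proof -
  obtain s e where e: "orthonormal_on UNIV e" and s: "s \<longlonglongrightarrow> 0" "decseq s" "\<forall>n. s n \<ge> 0"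
    and a: "abs_op T = diag_op s e" and sq: "diag_op s e \<circ> diag_op s e = adj_op T \<circ> T"
    by (rule abs_op_diag[OF T])
  have B: "Bseq s" using s(1) by (rule tendsto_imp_Bseq)
  have sv: "singular_value T = s" by (rule singular_value_eqI[OF e s(1,2) _ a]) (use s in simp)
  have "norm (T x) = norm (diag_op s e x)" for x
  proof -
    have "cinner (T x) (T x) = cinner x ((adj_op T \<circ> T) x)"
      by (simp add: adj_op(1)[OF compact_op_bounded[OF T]])
    also have "\<dots> = cinner (diag_op s e x) (diag_op s e x)"
      unfolding sq[symmetric] by (simp add: diag_op_selfadjoint[OF e B])
    finally have "(norm (T x))\<^sup>2 = (norm (diag_op s e x))\<^sup>2" unfolding cinner_self of_real_eq_iff .
    then show ?thesis by simp
  qed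
  then show ?thesis using that[of e] e a s unfolding sv by blast
qed

lemma norm_abs_op:
  fixes T :: "'a \<Rightarrow> 'a"
  assumes T: "compact_op T"
  shows "norm (abs_op T x) = norm (T x)"
proof -
  obtain e :: "nat \<Rightarrow> 'a" where "abs_op T = diag_op (singular_value T) e"
    "\<forall>x. norm (T x) = norm (diag_op (singular_value T) e x)"
    by (rule singular_value_diag[OF T])
  then show ?thesis by simp
qed

lemma singular_value_basic:
  fixes T :: "'a \<Rightarrow> 'a"
  assumes T: "compact_op T"
  shows "singular_value T \<longlonglongrightarrow> 0" "decseq (singular_value T)" "singular_value T n \<ge> 0"
proof -
  obtain e :: "nat \<Rightarrow> 'a" where
    "singular_value T \<longlonglongrightarrow> 0" "decseq (singular_value T)" "\<forall>n. singular_value T n \<ge> 0"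
    by (rule singular_value_diag[OF T])
  then show "singular_value T \<longlonglongrightarrow> 0" "decseq (singular_value T)" "singular_value T n \<ge> 0" by blast+
qed

text \<open>
  This lemma and the next are the min-max principle: the \<open>n\<close>-th singular value is the least bound for
  \<open>T\<close> on the orthogonal complement of \<open>n\<close> vectors.  The termwise inequalities between singular values
  of different operators below all come from it.
\<close>

lemma singular_value_witness:
  fixes T :: "'a \<Rightarrow> 'a"
  assumes T: "compact_op T"
  obtains W where "finite W" "card W \<le> n" "\<forall>x. (\<forall>w\<in>W. cinner w x = 0) \<longrightarrow> norm (T x) \<le> singular_value T n * norm x"
proof -
  obtain e where e: "orthonormal_on UNIV e"
    and dec: "decseq (singular_value T)" and s: "\<forall>n. singular_value T n \<ge> 0"
    and nT: "\<forall>x. norm (T x) = norm (diag_op (singular_value T) e x)"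
    by (rule singular_value_diag[OF T])
  have "norm (T x) \<le> singular_value T n * norm x" if x: "\<forall>w\<in>e ` {..<n}. cinner w x = 0" for x
    unfolding nT[rule_format]
  proof (rule diag_op_norm[OF e])
    show "\<bar>singular_value T k\<bar> \<le> singular_value T n \<or> cinner (e k) x = 0" for k
      using x s decseqD[OF dec, of n k] by (cases "k < n") auto
    show "0 \<le> singular_value T n" using s by simp
  qed
  moreover have "card (e ` {..<n}) \<le> n" using card_image_le[of "{..<n}" e] by simp
  ultimately show ?thesis using that[of "e ` {..<n}"] by blast
qed

text \<open>
  The span of the first \<open>n + 1\<close> singular directions contains a unit vector orthogonal to \<open>W\<close>, and
  there \<open>T\<close> is bounded below by its \<open>n\<close>-th singular value.
\<close>

lemma singular_value_le:
  fixes T :: "'a \<Rightarrow> 'a"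
  assumes T: "compact_op T" and W: "finite W" "card W \<le> n"
    and c: "\<And>x. (\<forall>w\<in>W. cinner w x = 0) \<Longrightarrow> norm (T x) \<le> c * norm x"
  shows "singular_value T n \<le> c"
proof -
  obtain e where e: "orthonormal_on UNIV e" and s0: "singular_value T \<longlonglongrightarrow> 0"
    and dec: "decseq (singular_value T)" and s: "\<forall>n. singular_value T n \<ge> 0"
    and nT: "\<forall>x. norm (T x) = norm (diag_op (singular_value T) e x)"
    by (rule singular_value_diag[OF T])
  let ?s = "singular_value T"
  have B: "Bseq ?s" using s0 by (rule tendsto_imp_Bseq)
  note on = orthonormal_image(1)[OF e, of "{..n}"]
  have "card W < card (e ` {..n})" using W by (simp add: orthonormal_image(2)[OF e])
  then obtain x where x: "x \<in> cvec.span (e ` {..n})" "norm x = 1" "\<And>w. w \<in> W \<Longrightarrow> cinner w x = 0"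
    using exists_perp_in_span[OF _ on W(1)] by (metis finite_atMost finite_imageI)
  have "x = (\<Sum>v\<in>e ` {..n}. cinner v x *\<^sub>C v)"
    by (rule cspan_orthonormal_sum[OF x(1) _ on]) simp
  also have "\<dots> = (\<Sum>k\<le>n. cinner (e k) x *\<^sub>C e k)"
    by (rule orthonormal_image(3)[OF e])
  finally have xs: "x = (\<Sum>k\<le>n. cinner (e k) x *\<^sub>C e k)" .
  have one: "(\<Sum>k\<le>n. (cmod (cinner (e k) x))\<^sup>2) = 1"
    using norm_orthonormal_sum[OF orthonormal_on_subset[OF e], of "{..n}" "\<lambda>k. cinner (e k) x"] xs x(2) by simp
  have "diag_op ?s e x = (\<Sum>k\<le>n. (of_real (?s k) * cinner (e k) x) *\<^sub>C e k)"
    by (subst xs) (simp add: bounded_op_simps[OF bounded_op_diag_op[OF e B]] diag_op_eigen[OF e] scaleR_scaleC scaleC_scaleC mult.commute)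
  then have "(norm (diag_op ?s e x))\<^sup>2 = (\<Sum>k\<le>n. (cmod (of_real (?s k) * cinner (e k) x))\<^sup>2)"
    using norm_orthonormal_sum[OF orthonormal_on_subset[OF e], of "{..n}"] by simp
  also have "\<dots> \<ge> (\<Sum>k\<le>n. (?s n)\<^sup>2 * (cmod (cinner (e k) x))\<^sup>2)"
  proof (rule sum_mono)
    fix k assume "k \<in> {..n}"
    then have "(?s n)\<^sup>2 \<le> (?s k)\<^sup>2" using decseqD[OF dec, of k n] s by (intro power_mono) auto
    then show "(?s n)\<^sup>2 * (cmod (cinner (e k) x))\<^sup>2 \<le> (cmod (of_real (?s k) * cinner (e k) x))\<^sup>2"
      by (simp add: norm_mult power_mult_distrib mult_right_mono)
  qed
  finally have "(?s n)\<^sup>2 \<le> (norm (diag_op ?s e x))\<^sup>2"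
    by (simp add: sum_distrib_left[symmetric] one)
  then have "?s n \<le> norm (T x)" using nT by (simp add: power2_le_iff_abs_le)
  also have "\<dots> \<le> c" using c[of x] x by simp
  finally show ?thesis .
qed

lemma singular_value_add:
  fixes S T :: "'a \<Rightarrow> 'a"
  assumes S: "compact_op S" and T: "compact_op T"
  shows "singular_value (\<lambda>x. S x + T x) (m + n) \<le> singular_value S m + singular_value T n"
proof -
  obtain W where W: "finite W" "card W \<le> m" "\<forall>x. (\<forall>w\<in>W. cinner w x = 0) \<longrightarrow> norm (S x) \<le> singular_value S m * norm x"
    by (rule singular_value_witness[OF S])
  obtain V where V: "finite V" "card V \<le> n" "\<forall>x. (\<forall>w\<in>V. cinner w x = 0) \<longrightarrow> norm (T x) \<le> singular_value T n * norm x"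
    by (rule singular_value_witness[OF T])
  show ?thesis
  proof (rule singular_value_le)
    show "compact_op (\<lambda>x. S x + T x)" using S T by (rule compact_op_add)
    show "finite (W \<union> V)" using W V by simp
    show "card (W \<union> V) \<le> m + n" using card_Un_le[of W V] W V by linarith
    show "norm (S x + T x) \<le> (singular_value S m + singular_value T n) * norm x" if "\<forall>w\<in>W \<union> V. cinner w x = 0" for x
    proof -
      have "norm (S x) \<le> singular_value S m * norm x" "norm (T x) \<le> singular_value T n * norm x"
        using W V that by auto
      then show ?thesis using norm_triangle_ineq[of "S x" "T x"] by (simp add: distrib_right)
    qed
  qed
qed

lemma singular_value_scale:
  fixes T :: "'a \<Rightarrow> 'a"
  assumes T: "compact_op T"
  shows "singular_value (\<lambda>x. c *\<^sub>C T x) n \<le> cmod c * singular_value T n"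
proof -
  obtain W where W: "finite W" "card W \<le> n" "\<forall>x. (\<forall>w\<in>W. cinner w x = 0) \<longrightarrow> norm (T x) \<le> singular_value T n * norm x"
    by (rule singular_value_witness[OF T])
  show ?thesis
    by (rule singular_value_le[OF compact_op_scale[OF T] W(1,2)])
      (use W(3) in \<open>simp add: norm_scaleC mult.assoc mult_left_mono\<close>)
qed

lemma singular_value_norm_le:
  fixes S T :: "'a \<Rightarrow> 'a"
  assumes S: "compact_op S" and T: "compact_op T" and "\<And>x. norm (S x) \<le> norm (T x)"
  shows "singular_value S n \<le> singular_value T n"
proof -
  obtain W where W: "finite W" "card W \<le> n" "\<forall>x. (\<forall>w\<in>W. cinner w x = 0) \<longrightarrow> norm (T x) \<le> singular_value T n * norm x"
    by (rule singular_value_witness[OF T])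
  show ?thesis
    by (rule singular_value_le[OF S W(1,2)]) (use W(3) assms(3) order_trans in blast)
qed

text \<open>
  If \<open>\<parallel>T y\<parallel> \<le> c \<parallel>y\<parallel>\<close> off the span of \<open>W\<close>, then \<open>\<parallel>T\<^sup>* x\<parallel> \<le> c \<parallel>x\<parallel>\<close> off \<open>T W\<close>: pairing \<open>x\<close> with \<open>T y\<close>
  only sees the part of \<open>y\<close> orthogonal to \<open>W\<close>.
\<close>

lemma singular_value_adj:
  fixes T :: "'a \<Rightarrow> 'a"
  assumes T: "compact_op T"
  shows "singular_value (adj_op T) n \<le> singular_value T n"
proof -
  note bT = compact_op_bounded[OF T]
  let ?c = "singular_value T n"
  obtain W where W: "finite W" "card W \<le> n" "\<forall>x. (\<forall>w\<in>W. cinner w x = 0) \<longrightarrow> norm (T x) \<le> ?c * norm x"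
    by (rule singular_value_witness[OF T])
  have c0: "?c \<ge> 0" by (rule singular_value_basic[OF T])
  obtain E where E: "finite E" "orthonormal_on E (\<lambda>x. x)" "cvec.span E = cvec.span W" "card E \<le> card W"
    by (rule gram_schmidt[OF W(1)])
  show ?thesis
  proof (rule singular_value_le[OF compact_op_adj[OF T]])
    show "finite (T ` E)" using E by simp
    show "card (T ` E) \<le> n" using card_image_le[OF E(1), of T] E(4) W(2) by linarith
    fix x assume x: "\<forall>w\<in>T ` E. cinner w x = 0"
    define y where "y = adj_op T x"
    define p where "p = (\<Sum>e\<in>E. cinner e y *\<^sub>C e)"
    have perpE: "cinner e (y - p) = 0" if "e \<in> E" for e
      using cinner_orthonormal_sum[OF E(2,1) subset_refl that] that by (simp add: p_def cinner_diff_right)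
    have "cinner w (y - p) = 0" if "w \<in> W" for w
      by (rule cinner_span_zero[of w E]) (use that perpE E(3) cvec.span_base in auto)
    then have le: "norm (T (y - p)) \<le> ?c * norm (y - p)" using W(3) by blast
    have "(norm (y - p))\<^sup>2 \<le> (norm y)\<^sup>2"
      unfolding p_def bessel_identity[OF E(2,1)] by (simp add: sum_nonneg)
    then have yp: "norm (y - p) \<le> norm y" by (simp add: power2_le_iff_abs_le)
    have "cinner (T p) x = 0"
      unfolding p_def using x by (simp add: bounded_op_simps[OF bT] cinner_sum_left cinner_scaleC_left)
    then have "cinner (T (y - p)) x = cinner y (adj_op T x)"
      by (simp add: bounded_op_simps(2)[OF bT] cinner_diff_left adj_op(1)[OF bT])
    then have "cinner (T (y - p)) x = cinner y y" by (simp only: y_def)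
    then have "(norm y)\<^sup>2 = cmod (cinner (T (y - p)) x)"
      by (rule cmod_cinner_eq_norm_sq)
    also have "\<dots> \<le> norm (T (y - p)) * norm x" by (rule cauchy_schwarz)
    also have "\<dots> \<le> (?c * norm y) * norm x"
      using order_trans[OF le mult_left_mono[OF yp c0]] by (intro mult_right_mono) auto
    finally have "(norm y)\<^sup>2 \<le> (?c * norm x) * norm y" by (simp add: mult_ac)
    then have "norm y \<le> ?c * norm x" by (rule norm_le_of_square_le) (use c0 in simp)
    then show "norm (adj_op T x) \<le> ?c * norm x" by (simp add: y_def)
  qed
qed

end


section \<open>Traces of powers\<close>

lemma infsum_suminf_swap_ennreal:
  fixes f :: "'i \<Rightarrow> nat \<Rightarrow> ennreal"
  shows "(\<Sum>\<^sub>\<infinity>b\<in>B. \<Sum>n. f b n) = (\<Sum>n. \<Sum>\<^sub>\<infinity>b\<in>B. f b n)"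
proof (rule antisym)
  have "(\<Sum>b\<in>F. \<Sum>n. f b n) \<le> (\<Sum>n. \<Sum>\<^sub>\<infinity>b\<in>B. f b n)" if F: "finite F" "F \<subseteq> B" for F
  proof -
    have "(\<Sum>b\<in>F. \<Sum>n. f b n) = (\<Sum>n. \<Sum>b\<in>F. f b n)"
      by (rule suminf_sum[symmetric]) simp
    also have "\<dots> \<le> (\<Sum>n. \<Sum>\<^sub>\<infinity>b\<in>B. f b n)"
    proof (rule suminf_le)
      show "(\<Sum>b\<in>F. f b n) \<le> (\<Sum>\<^sub>\<infinity>b\<in>B. f b n)" for n
        unfolding nonneg_infsum_complete[OF zero_le] by (rule SUP_upper) (use F in simp)
    qed auto
    finally show ?thesis .
  qed
  then show "(\<Sum>\<^sub>\<infinity>b\<in>B. \<Sum>n. f b n) \<le> (\<Sum>n. \<Sum>\<^sub>\<infinity>b\<in>B. f b n)"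
    by (subst nonneg_infsum_complete[OF zero_le]) (auto intro: SUP_least)
  have "(\<Sum>n<N. \<Sum>\<^sub>\<infinity>b\<in>B. f b n) \<le> (\<Sum>\<^sub>\<infinity>b\<in>B. \<Sum>n. f b n)" for N
  proof -
    have "(\<Sum>n<N. \<Sum>\<^sub>\<infinity>b\<in>B. f b n) = (\<Sum>\<^sub>\<infinity>b\<in>B. \<Sum>n<N. f b n)"
    proof (induction N)
      case (Suc N)
      then show ?case by (simp add: infsum_add nonneg_summable_on_complete)
    qed simp
    also have "\<dots> \<le> (\<Sum>\<^sub>\<infinity>b\<in>B. \<Sum>n. f b n)"
      by (intro infsum_mono nonneg_summable_on_complete sum_le_suminf) auto
    finally show ?thesis .
  qed
  then show "(\<Sum>n. \<Sum>\<^sub>\<infinity>b\<in>B. f b n) \<le> (\<Sum>\<^sub>\<infinity>b\<in>B. \<Sum>n. f b n)"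
    by (intro suminf_le_const) auto
qed

text \<open>
  The basis is arbitrary, not a sequence, because the trace is defined with an unspecified one.
\<close>

lemma parseval_onb:
  assumes "is_onb B"
  shows "(\<Sum>\<^sub>\<infinity>b\<in>B. ennreal ((cmod (cinner b x))\<^sup>2)) = ennreal ((norm x)\<^sup>2)"
proof (rule antisym)
  have on: "orthonormal_on B (\<lambda>x. x)" and dense: "closure (cvec.span B) = UNIV"
    using assms by (auto simp: is_onb_def orthonormal_on_def)
  have "(\<Sum>b\<in>F. ennreal ((cmod (cinner b x))\<^sup>2)) \<le> ennreal ((norm x)\<^sup>2)" if "finite F" "F \<subseteq> B" for F
    using bessel[OF orthonormal_on_subset[OF on that(2)] that(1), of x] by (simp add: ennreal_leI)
  then show "(\<Sum>\<^sub>\<infinity>b\<in>B. ennreal ((cmod (cinner b x))\<^sup>2)) \<le> ennreal ((norm x)\<^sup>2)"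
    by (subst nonneg_infsum_complete[OF zero_le]) (auto intro: SUP_least)
  show "ennreal ((norm x)\<^sup>2) \<le> (\<Sum>\<^sub>\<infinity>b\<in>B. ennreal ((cmod (cinner b x))\<^sup>2))"
  proof (rule ennreal_le_epsilon)
    fix \<epsilon> :: real assume \<epsilon>: "\<epsilon> > 0"
    have "x \<in> closure (cvec.span B)" using dense by simp
    moreover have "sqrt \<epsilon> > 0" using \<epsilon> by simp
    ultimately obtain y where y: "y \<in> cvec.span B" "dist y x < sqrt \<epsilon>"
      using closure_approachable by blast
    obtain F u where F: "finite F" "F \<subseteq> B" and yF: "y = (\<Sum>a\<in>F. u a *\<^sub>C a)"
      using y(1) unfolding cvec.span_explicit by blast
    have "y \<in> cvec.span F"
      unfolding yF by (intro cvec.span_sum cvec.span_scale cvec.span_base)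
    have onF: "orthonormal_on F (\<lambda>x. x)" by (rule orthonormal_on_subset[OF on F(2)])
    have yp: "y = (\<Sum>b\<in>F. cinner b y *\<^sub>C b)"
      by (rule cspan_orthonormal_sum[OF \<open>y \<in> cvec.span F\<close> F(1) onF])
    have "x - (\<Sum>b\<in>F. cinner b x *\<^sub>C b) = (x - y) - (\<Sum>b\<in>F. cinner b (x - y) *\<^sub>C b)"
      using yp by (simp add: cinner_diff_right cvec.scale_left_diff_distrib sum_subtractf)
    then have "(norm (x - (\<Sum>b\<in>F. cinner b x *\<^sub>C b)))\<^sup>2 = (norm ((x - y) - (\<Sum>b\<in>F. cinner b (x - y) *\<^sub>C b)))\<^sup>2"
      by (rule arg_cong)
    then have "(norm x)\<^sup>2 - (\<Sum>b\<in>F. (cmod (cinner b x))\<^sup>2) \<le> (norm (x - y))\<^sup>2"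
      unfolding bessel_identity[OF onF F(1)] by (simp add: sum_nonneg)
    also have "\<dots> \<le> \<epsilon>"
    proof -
      have "norm (x - y) \<le> sqrt \<epsilon>" using y(2) by (simp add: dist_norm norm_minus_commute)
      from power_mono[OF this, of 2] show ?thesis using \<epsilon> by simp
    qed
    finally have "(norm x)\<^sup>2 \<le> (\<Sum>b\<in>F. (cmod (cinner b x))\<^sup>2) + \<epsilon>" by simp
    then have "ennreal ((norm x)\<^sup>2) \<le> ennreal (\<Sum>b\<in>F. (cmod (cinner b x))\<^sup>2) + ennreal \<epsilon>"
      using \<epsilon> by (metis ennreal_leI ennreal_plus less_imp_le sum_nonneg zero_le_power2)
    also have "\<dots> = (\<Sum>b\<in>F. ennreal ((cmod (cinner b x))\<^sup>2)) + ennreal \<epsilon>" by simp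
    also have "\<dots> \<le> (\<Sum>\<^sub>\<infinity>b\<in>B. ennreal ((cmod (cinner b x))\<^sup>2)) + ennreal \<epsilon>"
      unfolding nonneg_infsum_complete[OF zero_le]
      by (intro add_right_mono SUP_upper) (use F in simp)
    finally show "ennreal ((norm x)\<^sup>2) \<le> (\<Sum>\<^sub>\<infinity>b\<in>B. ennreal ((cmod (cinner b x))\<^sup>2)) + ennreal \<epsilon>" .
  qed
qed

text \<open>
  Interchanging the sum over the basis with the sum over \<open>e\<close> leaves the Parseval sums of the unit
  vectors \<open>e\<^sub>n\<close>.
\<close>

lemma infsum_form_diag_op:
  assumes B: "is_onb B" and e: "orthonormal_on UNIV e" and a: "Bseq a" "\<And>n. a n \<ge> 0"
  shows "(\<Sum>\<^sub>\<infinity>b\<in>B. ennreal (Re (cinner b (diag_op a e b)))) = (\<Sum>n. ennreal (a n))"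
proof -
  have "(\<Sum>\<^sub>\<infinity>b\<in>B. ennreal (Re (cinner b (diag_op a e b))))
      = (\<Sum>\<^sub>\<infinity>b\<in>B. \<Sum>n. ennreal (a n * (cmod (cinner b (e n)))\<^sup>2))"
  proof (rule infsum_cong)
    fix b
    have c: "cmod (cinner (e n) b) = cmod (cinner b (e n))" for n
      by (metis cinner_commute complex_mod_cnj)
    show "ennreal (Re (cinner b (diag_op a e b))) = (\<Sum>n. ennreal (a n * (cmod (cinner b (e n)))\<^sup>2))"
      by (rule suminf_ennreal_eq[symmetric]) (use a diag_op_quadratic(1)[OF e a(1), of b] in \<open>simp_all add: c\<close>)
  qed
  also have "\<dots> = (\<Sum>n. \<Sum>\<^sub>\<infinity>b\<in>B. ennreal (a n * (cmod (cinner b (e n)))\<^sup>2))"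
    by (rule infsum_suminf_swap_ennreal)
  also have "\<dots> = (\<Sum>n. ennreal (a n))"
  proof (rule suminf_cong)
    fix n
    have "(\<Sum>\<^sub>\<infinity>b\<in>B. ennreal (a n * (cmod (cinner b (e n)))\<^sup>2))
        = (SUP F\<in>{F. finite F \<and> F \<subseteq> B}. \<Sum>b\<in>F. ennreal (a n) * ennreal ((cmod (cinner b (e n)))\<^sup>2))"
      by (subst nonneg_infsum_complete[OF zero_le]) (simp add: ennreal_mult a)
    also have "\<dots> = ennreal (a n) * (SUP F\<in>{F. finite F \<and> F \<subseteq> B}. \<Sum>b\<in>F. ennreal ((cmod (cinner b (e n)))\<^sup>2))"
      unfolding sum_distrib_left[symmetric] by (rule SUP_mult_left_ennreal[symmetric])
    also have "\<dots> = ennreal (a n) * ennreal ((norm (e n))\<^sup>2)"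
      unfolding nonneg_infsum_complete[OF zero_le, symmetric] parseval_onb[OF B] ..
    finally show "(\<Sum>\<^sub>\<infinity>b\<in>B. ennreal (a n * (cmod (cinner b (e n)))\<^sup>2)) = ennreal (a n)"
      by (simp add: orthonormal_on_norm[OF e])
  qed
  finally show ?thesis .
qed

lemma powr_op_diag:
  assumes e: "orthonormal_on UNIV e" and s: "s \<longlonglongrightarrow> 0" "\<And>n. s n \<ge> 0" and p: "p > 0"
  shows "powr_op (diag_op s e) p = diag_op (\<lambda>n. s n powr p) e"
proof -
  have B: "Bseq s" using s(1) by (rule tendsto_imp_Bseq)
  have "(\<lambda>n. s n powr p) \<longlonglongrightarrow> 0 powr p"
    by (rule tendsto_powr'[OF s(1) tendsto_const]) (use p s(2) in auto)
  then have sp: "(\<lambda>n. s n powr p) \<longlonglongrightarrow> 0" using p by simp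
  have Bp: "Bseq (\<lambda>n. s n powr p)" using sp by (rule tendsto_imp_Bseq)
  note bD = bounded_op_diag_op[OF e Bp]
  have act: "diag_op (\<lambda>n. s n powr p) e x = (a powr p) *\<^sub>R x" if a: "a \<ge> 0" and x: "diag_op s e x = a *\<^sub>R x" for a x
  proof -
    have c: "s n = a \<or> cinner (e n) x = 0" for n
    proof -
      have "of_real (s n) * cinner (e n) x = of_real a * cinner (e n) x"
        using arg_cong[OF x, of "cinner (e n)"] by (simp add: cinner_diag_op[OF e B] cinner_scaleR_right)
      then show ?thesis by auto
    qed
    have *: "(\<lambda>n. (of_real (s n powr p) * cinner (e n) x) *\<^sub>C e n) = (\<lambda>n. (of_real (a powr p) * cinner (e n) x) *\<^sub>C e n)"
      using c by fastforce
    show ?thesis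
    proof (cases "a = 0")
      case True
      then show ?thesis unfolding diag_op_def * using p by simp
    next
      case False
      have "(\<lambda>n. (of_real (s n) * cinner (e n) x) *\<^sub>C e n) = (\<lambda>n. (of_real a * cinner (e n) x) *\<^sub>C e n)"
        using c by fastforce
      then have "(\<lambda>n. (of_real a * cinner (e n) x) *\<^sub>C e n) sums (a *\<^sub>R x)"
        using diag_op_sums[OF e B, of x] x by simp
      from bounded_linear.sums[OF bounded_linear_scaleC_right this, of "of_real (a powr p / a)"]
      have "(\<lambda>n. (of_real (a powr p) * cinner (e n) x) *\<^sub>C e n) sums ((a powr p) *\<^sub>R x)"
        using False by (simp add: scaleC_scaleC scaleR_scaleC)
      then show ?thesis unfolding diag_op_def * by (simp add: sums_iff)
    qed
  qed
  show ?thesis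
    unfolding powr_op_def
  proof (rule the_equality)
    show "bounded_op (diag_op (\<lambda>n. s n powr p) e) \<and>
       (\<forall>a x. 0 \<le> a \<and> diag_op s e x = a *\<^sub>R x \<longrightarrow> diag_op (\<lambda>n. s n powr p) e x = (a powr p) *\<^sub>R x)"
      using bD act by blast
    fix A assume A: "bounded_op A \<and> (\<forall>a x. 0 \<le> a \<and> diag_op s e x = a *\<^sub>R x \<longrightarrow> A x = (a powr p) *\<^sub>R x)"
    show "A = diag_op (\<lambda>n. s n powr p) e"
    proof (rule diag_op_ext[OF e _ bD])
      show "bounded_op A" using A by blast
      show "A (e n) = diag_op (\<lambda>n. s n powr p) e (e n)" for n
        using A s(2)[of n] diag_op_eigen[OF e, of s n] by (simp add: diag_op_eigen[OF e])
      show "A x = diag_op (\<lambda>n. s n powr p) e x" if x: "\<And>n. cinner (e n) x = 0" for x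
      proof -
        have "diag_op s e x = 0 *\<^sub>R x" using diag_op_kernel[OF e x] by simp
        then have "A x = (0 powr p) *\<^sub>R x" using A by blast
        then show ?thesis using diag_op_kernel[OF e x] p by simp
      qed
    qed
  qed
qed

context separable_hilbert
begin

lemma trace_powr_abs_op:
  fixes T :: "'a \<Rightarrow> 'a"
  assumes T: "compact_op T" and p: "p > 0"
  shows "trace_op (powr_op (abs_op T) p) = (\<Sum>n. ennreal (singular_value T n powr p))"
proof -
  obtain e where e: "orthonormal_on UNIV e" and a: "abs_op T = diag_op (singular_value T) e"
    and s: "singular_value T \<longlonglongrightarrow> 0" "decseq (singular_value T)" "\<forall>n. singular_value T n \<ge> 0"
    by (rule singular_value_diag[OF T])
  obtain b :: "nat \<Rightarrow> 'a" where b: "orthonormal_on UNIV b" "closure (cvec.span (range b)) = UNIV"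
    "\<forall>x. (\<lambda>n. cinner (b n) x *\<^sub>C b n) sums x"
    by (rule obtain_basis)
  have "is_onb (range b)"
    using orthonormal_image(1)[OF b(1), of UNIV] b(2) by (simp add: is_onb_def orthonormal_on_def)
  then have B: "is_onb (SOME B :: 'a set. is_onb B)" by (rule someI)
  have "(\<lambda>n. singular_value T n powr p) \<longlonglongrightarrow> 0 powr p"
    by (rule tendsto_powr'[OF s(1) tendsto_const]) (use p s in auto)
  then have "Bseq (\<lambda>n. singular_value T n powr p)" by (rule tendsto_imp_Bseq)
  then have "trace_op (diag_op (\<lambda>n. singular_value T n powr p) e) = (\<Sum>n. ennreal (singular_value T n powr p))"
    unfolding trace_op_def by (intro infsum_form_diag_op[OF B e]) auto
  then show ?thesis
    unfolding a using powr_op_diag[OF e s(1) _ p] s(3) by simp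
qed

end

section \<open>Ky Fan inequalities\<close>

text \<open>Moving weight to the front of a decreasing sequence increases a weighted sum.\<close>

lemma weighted_sum_le:
  fixes s c :: "nat \<Rightarrow> real"
  assumes s: "decseq s" "\<And>n. s n \<ge> 0" and c: "\<And>k. 0 \<le> c k" "\<And>k. c k \<le> 1" "\<And>N. (\<Sum>k<N. c k) \<le> real n"
  shows "(\<Sum>k<N. s k * c k) \<le> (\<Sum>k<n. s k)"
proof -
  define M where "M = max N n"
  have "(\<Sum>k<N. s k * c k) \<le> (\<Sum>k<M. s k * c k)"
    by (rule sum_mono2) (auto simp: M_def s c)
  also have "\<dots> = (\<Sum>k<n. s k * c k) + (\<Sum>k=n..<M. s k * c k)"
    by (simp add: M_def lessThan_atLeast0 sum.atLeastLessThan_concat)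
  also have "\<dots> \<le> (\<Sum>k<n. s k) + s n * (\<Sum>k<n. c k - 1) + s n * (\<Sum>k=n..<M. c k)"
  proof -
    have "(\<Sum>k<n. s k * c k) \<le> (\<Sum>k<n. s k + s n * (c k - 1))"
    proof (rule sum_mono)
      fix k assume "k \<in> {..<n}"
      then have "s n \<le> s k" using decseqD[OF s(1), of k n] by simp
      then have "(s k - s n) * (c k - 1) \<le> 0" using c(2)[of k] by (simp add: mult_le_0_iff)
      then show "s k * c k \<le> s k + s n * (c k - 1)" by (simp add: algebra_simps)
    qed
    moreover have "(\<Sum>k=n..<M. s k * c k) \<le> (\<Sum>k=n..<M. s n * c k)"
      using decseqD[OF s(1)] c(1) by (intro sum_mono mult_right_mono) auto
    ultimately show ?thesis by (simp add: sum.distrib sum_distrib_left)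
  qed
  also have "\<dots> = (\<Sum>k<n. s k) + s n * ((\<Sum>k<M. c k) - real n)"
  proof -
    have "(\<Sum>k<M. c k) = (\<Sum>k<n. c k) + (\<Sum>k=n..<M. c k)"
      by (simp add: M_def lessThan_atLeast0 sum.atLeastLessThan_concat)
    then show ?thesis by (simp add: sum_subtractf algebra_simps)
  qed
  also have "\<dots> \<le> (\<Sum>k<n. s k)"
    using c(3)[of M] s(2)[of n] by (simp add: mult_le_0_iff)
  finally show ?thesis .
qed

lemma trace_on_span:
  assumes "bounded_op T"
    and E: "finite E" "orthonormal_on E (\<lambda>x. x)" and F: "finite F" "orthonormal_on F (\<lambda>x. x)"
    and span: "cvec.span E = cvec.span F"
  shows "(\<Sum>x\<in>E. cinner x (T x)) = (\<Sum>y\<in>F. cinner y (T y))"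
proof -
  have xF: "x = (\<Sum>y\<in>F. cinner y x *\<^sub>C y)" if "x \<in> E" for x
    by (rule cspan_orthonormal_sum[OF _ F]) (use that span cvec.span_base in blast)
  have yE: "y = (\<Sum>x\<in>E. cinner x y *\<^sub>C x)" if "y \<in> F" for y
    by (rule cspan_orthonormal_sum[OF _ E]) (use that span cvec.span_base in blast)
  have "(\<Sum>x\<in>E. cinner x (T x)) = (\<Sum>x\<in>E. \<Sum>y\<in>F. cinner y x * cinner x (T y))"
  proof (rule sum.cong[OF refl])
    fix x assume "x \<in> E"
    have "cinner x (T x) = cinner x (T (\<Sum>y\<in>F. cinner y x *\<^sub>C y))" using xF[OF \<open>x \<in> E\<close>] by simp
    also have "\<dots> = (\<Sum>y\<in>F. cinner y x * cinner x (T y))"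
      by (simp add: bounded_op_simps[OF assms(1)] cinner_sum_right cinner_scaleC_right)
    finally show "cinner x (T x) = (\<Sum>y\<in>F. cinner y x * cinner x (T y))" .
  qed
  also have "\<dots> = (\<Sum>y\<in>F. \<Sum>x\<in>E. cinner y x * cinner x (T y))" by (rule sum.swap)
  also have "\<dots> = (\<Sum>y\<in>F. cinner y (T y))"
  proof (rule sum.cong[OF refl])
    fix y assume "y \<in> F"
    have "cinner y (T y) = cinner (\<Sum>x\<in>E. cinner x y *\<^sub>C x) (T y)" using yE[OF \<open>y \<in> F\<close>] by simp
    also have "\<dots> = (\<Sum>x\<in>E. cinner y x * cinner x (T y))"
      by (simp add: cinner_sum_left cinner_scaleC_left cinner_commute[symmetric])
    finally show "(\<Sum>x\<in>E. cinner y x * cinner x (T y)) = cinner y (T y)" by simp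
  qed
  finally show ?thesis .
qed

context separable_hilbert
begin

lemma positive_diag:
  fixes P :: "'a \<Rightarrow> 'a"
  assumes P: "compact_op P" "positive_op P"
  obtains e where "orthonormal_on UNIV e" "P = diag_op (singular_value P) e"
proof -
  obtain e where e: "orthonormal_on UNIV e" and a: "abs_op P = diag_op (singular_value P) e"
    by (rule singular_value_diag[OF P(1)])
  show ?thesis using that[of e] e a abs_op_positive[OF P] by simp
qed

lemma Bseq_singular_value: "compact_op T \<Longrightarrow> Bseq (singular_value (T :: 'a \<Rightarrow> 'a))"
  using singular_value_basic(1) by (rule tendsto_imp_Bseq)

text \<open>
  Expanding in the eigenvectors of \<open>P\<close> gives a weighted sum of singular values.  The weight of each is
  at most \<open>1\<close>, by Bessel for \<open>F\<close>, and the weights add up to at most \<open>n\<close>, by Bessel for the eigenvectors.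
\<close>

lemma ky_fan_le:
  fixes P :: "'a \<Rightarrow> 'a"
  assumes P: "compact_op P" "positive_op P" and F: "finite F" "orthonormal_on F (\<lambda>x. x)" "card F \<le> n"
  shows "(\<Sum>x\<in>F. Re (cinner x (P x))) \<le> (\<Sum>k<n. singular_value P k)"
proof -
  let ?s = "singular_value P"
  obtain e where e: "orthonormal_on UNIV e" and Pd: "P = diag_op ?s e" by (rule positive_diag[OF P])
  define c where "c k = (\<Sum>x\<in>F. (cmod (cinner (e k) x))\<^sup>2)" for k
  have "c k \<le> 1" for k
  proof -
    have "c k = (\<Sum>x\<in>F. (cmod (cinner x (e k)))\<^sup>2)"
      unfolding c_def by (rule sum.cong) (metis cinner_commute complex_mod_cnj)+
    also have "\<dots> \<le> (norm (e k))\<^sup>2" by (rule bessel[OF F(2,1)])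
    finally show ?thesis by (simp add: orthonormal_on_norm[OF e])
  qed
  moreover have "(\<Sum>k<N. c k) \<le> real n" for N
  proof -
    have "(\<Sum>k<N. c k) = (\<Sum>x\<in>F. \<Sum>k<N. (cmod (cinner (e k) x))\<^sup>2)"
      unfolding c_def by (rule sum.swap)
    also have "\<dots> \<le> (\<Sum>x\<in>F. 1)"
    proof (rule sum_mono)
      fix x assume "x \<in> F"
      then have "norm x = 1" using orthonormal_on_norm[OF F(2)] by simp
      then show "(\<Sum>k<N. (cmod (cinner (e k) x))\<^sup>2) \<le> 1"
        using bessel[OF orthonormal_on_subset[OF e], of "{..<N}" x] by simp
    qed
    also have "\<dots> \<le> real n" using F(3) by simp
    finally show ?thesis .
  qed
  ultimately have "(\<Sum>k<N. ?s k * c k) \<le> (\<Sum>k<n. ?s k)" for N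
    using singular_value_basic[OF P(1)] by (intro weighted_sum_le) (auto simp: c_def sum_nonneg)
  moreover have "(\<lambda>k. ?s k * c k) sums (\<Sum>x\<in>F. Re (cinner x (P x)))"
  proof -
    have "(\<lambda>k. \<Sum>x\<in>F. ?s k * (cmod (cinner (e k) x))\<^sup>2) sums (\<Sum>x\<in>F. Re (cinner x (diag_op ?s e x)))"
      by (intro sums_sum diag_op_quadratic(1)[OF e Bseq_singular_value[OF P(1)]])
    then show ?thesis unfolding c_def Pd[symmetric] by (simp add: sum_distrib_left)
  qed
  ultimately show ?thesis
    unfolding sums_def by (intro LIMSEQ_le_const2[of _ "\<Sum>x\<in>F. Re (cinner x (P x))"]) auto
qed

lemma ky_fan_attained:
  fixes P :: "'a \<Rightarrow> 'a"
  assumes P: "compact_op P" "positive_op P"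
  obtains F where "finite F" "orthonormal_on F (\<lambda>x. x)" "card F = n"
    "(\<Sum>x\<in>F. Re (cinner x (P x))) = (\<Sum>k<n. singular_value P k)"
proof -
  let ?s = "singular_value P"
  obtain e where e: "orthonormal_on UNIV e" and Pd: "P = diag_op ?s e" by (rule positive_diag[OF P])
  show ?thesis
  proof
    show "orthonormal_on (e ` {..<n}) (\<lambda>x. x)"
      by (rule orthonormal_image(1)[OF e])
    show "card (e ` {..<n}) = n" by (simp add: orthonormal_image(2)[OF e])
    have "(\<Sum>x\<in>e ` {..<n}. Re (cinner x (P x))) = (\<Sum>k<n. Re (cinner (e k) (P (e k))))"
      by (rule orthonormal_image(3)[OF e])
    also have "\<dots> = (\<Sum>k<n. ?s k)"
    proof (rule sum.cong[OF refl])
      fix k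
      have "P (e k) = ?s k *\<^sub>R e k" using diag_op_eigen[OF e, of ?s k] Pd by simp
      then show "Re (cinner (e k) (P (e k))) = ?s k"
        by (simp add: cinner_scaleR_right orthonormal_onD[OF e])
    qed
    finally show "(\<Sum>x\<in>e ` {..<n}. Re (cinner x (P x))) = (\<Sum>k<n. ?s k)" .
  qed simp
qed

lemma positive_op_add: "positive_op S \<Longrightarrow> positive_op T \<Longrightarrow> positive_op (\<lambda>x. S x + T x)"
  unfolding positive_op_def by (simp add: bounded_op_add cinner_add_right nonneg_Reals_add_I)

lemma singular_value_sum_add_le:
  fixes S T :: "'a \<Rightarrow> 'a"
  assumes S: "compact_op S" "positive_op S" and T: "compact_op T" "positive_op T"
  shows "(\<Sum>k<n. singular_value (\<lambda>x. S x + T x) k) \<le> (\<Sum>k<n. singular_value S k) + (\<Sum>k<n. singular_value T k)"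
proof -
  obtain F where F: "finite F" "orthonormal_on F (\<lambda>x. x)" "card F = n"
    "(\<Sum>x\<in>F. Re (cinner x (S x + T x))) = (\<Sum>k<n. singular_value (\<lambda>x. S x + T x) k)"
    by (rule ky_fan_attained[OF compact_op_add[OF S(1) T(1)] positive_op_add[OF S(2) T(2)]])
  have "(\<Sum>x\<in>F. Re (cinner x (S x + T x))) = (\<Sum>x\<in>F. Re (cinner x (S x))) + (\<Sum>x\<in>F. Re (cinner x (T x)))"
    by (simp add: cinner_add_right sum.distrib)
  moreover have "(\<Sum>x\<in>F. Re (cinner x (S x))) \<le> (\<Sum>k<n. singular_value S k)"
    "(\<Sum>x\<in>F. Re (cinner x (T x))) \<le> (\<Sum>k<n. singular_value T k)"
    using F by (auto intro!: ky_fan_le S T)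
  ultimately show ?thesis using F(4) by linarith
qed

text \<open>The span of optimal \<open>n\<close>-frames for \<open>S\<close> and \<open>T\<close> has dimension at most \<open>2n\<close> and serves both.\<close>

lemma singular_value_sum_add_ge:
  fixes S T :: "'a \<Rightarrow> 'a"
  assumes S: "compact_op S" "positive_op S" and T: "compact_op T" "positive_op T"
  shows "(\<Sum>k<n. singular_value S k) + (\<Sum>k<n. singular_value T k) \<le> (\<Sum>k<2*n. singular_value (\<lambda>x. S x + T x) k)"
proof -
  have nn: "Re (cinner x (P x)) \<ge> 0" if "positive_op P" for P :: "'a \<Rightarrow> 'a" and x
    using that by (auto simp: positive_op_def complex_nonneg_Reals_iff)
  obtain F where F: "finite F" "orthonormal_on F (\<lambda>x. x)" "card F = n"
    "(\<Sum>x\<in>F. Re (cinner x (S x))) = (\<Sum>k<n. singular_value S k)"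
    by (rule ky_fan_attained[OF S])
  obtain H where H: "finite H" "orthonormal_on H (\<lambda>x. x)" "card H = n"
    "(\<Sum>x\<in>H. Re (cinner x (T x))) = (\<Sum>k<n. singular_value T k)"
    by (rule ky_fan_attained[OF T])
  obtain E where E: "finite E" "F \<subseteq> E" "orthonormal_on E (\<lambda>x. x)" "cvec.span E = cvec.span (F \<union> H)"
    "card E \<le> card F + card H"
    using gram_schmidt_extend[OF H(1) F(1,2)] by blast
  obtain E' where E': "finite E'" "H \<subseteq> E'" "orthonormal_on E' (\<lambda>x. x)" "cvec.span E' = cvec.span (H \<union> F)"
    using gram_schmidt_extend[OF F(1) H(1,2)] by blast
  have "(\<Sum>k<n. singular_value S k) \<le> (\<Sum>x\<in>E. Re (cinner x (S x)))"
    unfolding F(4)[symmetric] using E nn[OF S(2)] by (intro sum_mono2) auto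
  moreover have "(\<Sum>k<n. singular_value T k) \<le> (\<Sum>x\<in>E'. Re (cinner x (T x)))"
    unfolding H(4)[symmetric] using E' nn[OF T(2)] by (intro sum_mono2) auto
  moreover have "(\<Sum>x\<in>E'. Re (cinner x (T x))) = (\<Sum>x\<in>E. Re (cinner x (T x)))"
  proof -
    have "cvec.span E' = cvec.span E" unfolding E(4) E'(4) by (simp add: Un_commute)
    from trace_on_span[OF compact_op_bounded[OF T(1)] E'(1,3) E(1,3) this]
    have "Re (\<Sum>x\<in>E'. cinner x (T x)) = Re (\<Sum>x\<in>E. cinner x (T x))" by simp
    then show ?thesis by simp
  qed
  moreover have "(\<Sum>x\<in>E. Re (cinner x (S x))) + (\<Sum>x\<in>E. Re (cinner x (T x))) = (\<Sum>x\<in>E. Re (cinner x (S x + T x)))"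
    by (simp add: cinner_add_right sum.distrib)
  moreover have "(\<Sum>x\<in>E. Re (cinner x (S x + T x))) \<le> (\<Sum>k<2*n. singular_value (\<lambda>x. S x + T x) k)"
    using E F(3) H(3) by (intro ky_fan_le compact_op_add positive_op_add S T) auto
  ultimately show ?thesis by linarith
qed

lemma singular_value_scale_positive:
  fixes P :: "'a \<Rightarrow> 'a"
  assumes P: "compact_op P" "positive_op P" and r: "r \<ge> 0"
  shows "singular_value (\<lambda>x. of_real r *\<^sub>C P x) = (\<lambda>n. r * singular_value P n)"
proof
  fix n
  show "singular_value (\<lambda>x. of_real r *\<^sub>C P x) n = r * singular_value P n"
  proof (cases "r = 0")
    case True
    have "singular_value (\<lambda>x. of_real r *\<^sub>C P x) n \<le> cmod (of_real r) * singular_value P n"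
      by (rule singular_value_scale[OF P(1)])
    then show ?thesis using singular_value_basic(3)[OF compact_op_scale[OF P(1)], of "of_real r" n] True by simp
  next
    case False
    have "singular_value (\<lambda>x. of_real (inverse r) *\<^sub>C of_real r *\<^sub>C P x) n \<le> cmod (of_real (inverse r)) * singular_value (\<lambda>x. of_real r *\<^sub>C P x) n"
      by (rule singular_value_scale[OF compact_op_scale[OF P(1)]])
    moreover have "of_real (inverse r) *\<^sub>C of_real r *\<^sub>C P x = P x" for x
      using False unfolding scaleC_scaleC by (simp flip: of_real_mult)
    ultimately have "singular_value P n \<le> inverse r * singular_value (\<lambda>x. of_real r *\<^sub>C P x) n"
      using r by (simp only: norm_of_real) simp
    then have "r * singular_value P n \<le> singular_value (\<lambda>x. of_real r *\<^sub>C P x) n"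
      using False r by (simp add: field_simps)
    moreover have "singular_value (\<lambda>x. of_real r *\<^sub>C P x) n \<le> r * singular_value P n"
      using singular_value_scale[OF P(1), of "of_real r" n] r by simp
    ultimately show ?thesis by simp
  qed
qed

end


section \<open>Positive and negative parts\<close>

context separable_hilbert
begin

text \<open>
  In a diagonalisation of \<open>A\<close> the absolute value and both parts are diagonal as well.  The singular
  values are compared through norms: \<open>\<bar>A\<bar>\<close> and \<open>A\<close> have the same norm on every vector.
\<close>

lemma parts_selfadjoint:
  fixes A :: "'a \<Rightarrow> 'a"
  assumes A: "compact_op A" "selfadjoint A"
  shows "compact_op (pos_part_op A)" "positive_op (pos_part_op A)"
    "compact_op (neg_part_op A)" "positive_op (neg_part_op A)"
    "A = (\<lambda>x. pos_part_op A x - neg_part_op A x)"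
    "singular_value (pos_part_op A) n \<le> singular_value A n"
    "singular_value (neg_part_op A) n \<le> singular_value A n"
proof -
  obtain a e where e: "orthonormal_on UNIV e" and a: "a \<longlonglongrightarrow> 0" and Ad: "A = diag_op a e"
    by (rule spectral_theorem[OF A infinite_dim])
  note bA = compact_op_bounded[OF A(1)]
  have B: "Bseq a" using a by (rule tendsto_imp_Bseq)
  have a': "(\<lambda>n. \<bar>a n\<bar>) \<longlonglongrightarrow> 0" using tendsto_rabs[OF a] by simp
  then have B': "Bseq (\<lambda>n. \<bar>a n\<bar>)" by (rule tendsto_imp_Bseq)
  note bD = bounded_op_diag_op[OF e B']
  have "diag_op (\<lambda>n. \<bar>a n\<bar>) e \<circ> diag_op (\<lambda>n. \<bar>a n\<bar>) e = adj_op A \<circ> A"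
    unfolding adj_op_selfadjoint[OF A(2)] unfolding Ad diag_op_comp[OF e B' B'] diag_op_comp[OF e B B] by simp
  from abs_op_eqI[OF A(1) positive_op_diag_op[OF e B'] this]
  have abs: "abs_op A = diag_op (\<lambda>n. \<bar>a n\<bar>) e" by simp
  have p: "(\<lambda>n. max (a n) 0) \<longlonglongrightarrow> 0" using tendsto_max[OF a tendsto_const[of 0]] by simp
  have m: "(\<lambda>n. max (- a n) 0) \<longlonglongrightarrow> 0" using tendsto_max[OF tendsto_minus[OF a] tendsto_const[of 0]] by simp
  have Bp: "Bseq (\<lambda>n. max (a n) 0)" using p by (rule tendsto_imp_Bseq)
  have Bm: "Bseq (\<lambda>n. max (- a n) 0)" using m by (rule tendsto_imp_Bseq)
  have bA': "bounded_op (\<lambda>x. - 1 *\<^sub>C A x)" by (rule bounded_op_scale[OF bA])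
  have half: "(1/2 :: complex) *\<^sub>C (r *\<^sub>R x + t *\<^sub>R x) = ((r + t) / 2) *\<^sub>R x"
    "(1/2 :: complex) *\<^sub>C (r *\<^sub>R x - t *\<^sub>R x) = ((r - t) / 2) *\<^sub>R x" for r t and x :: 'a
    unfolding scaleR_scaleC scaleC_scaleC scaleC_add_left[symmetric] cvec.scale_left_diff_distrib[symmetric]
    by simp_all
  have pos: "pos_part_op A = diag_op (\<lambda>n. max (a n) 0) e"
  proof (rule diag_op_ext[OF e])
    show "bounded_op (diag_op (\<lambda>n. max (a n) 0) e)" by (rule bounded_op_diag_op[OF e Bp])
    show "bounded_op (pos_part_op A)" unfolding pos_part_op_def abs by (intro bounded_op_scale bounded_op_add bD bA)
    show "pos_part_op A (e n) = diag_op (\<lambda>n. max (a n) 0) e (e n)" for n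
      unfolding pos_part_op_def abs unfolding Ad diag_op_eigen[OF e] half
      by (rule arg_cong[of _ _ "\<lambda>r. r *\<^sub>R e n"]) (simp add: max_def abs_if)
    show "pos_part_op A x = diag_op (\<lambda>n. max (a n) 0) e x" if x: "\<And>n. cinner (e n) x = 0" for x
      unfolding pos_part_op_def abs unfolding Ad by (simp add: diag_op_kernel[OF e x])
  qed
  have neg: "neg_part_op A = diag_op (\<lambda>n. max (- a n) 0) e"
  proof (rule diag_op_ext[OF e])
    show "bounded_op (diag_op (\<lambda>n. max (- a n) 0) e)" by (rule bounded_op_diag_op[OF e Bm])
    have "bounded_op (\<lambda>x. (1/2) *\<^sub>C (diag_op (\<lambda>n. \<bar>a n\<bar>) e x + - 1 *\<^sub>C A x))"
      by (intro bounded_op_scale bounded_op_add bD bA')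
    then show "bounded_op (neg_part_op A)" unfolding neg_part_op_def abs by simp
    show "neg_part_op A (e n) = diag_op (\<lambda>n. max (- a n) 0) e (e n)" for n
      unfolding neg_part_op_def abs unfolding Ad diag_op_eigen[OF e] half
      by (rule arg_cong[of _ _ "\<lambda>r. r *\<^sub>R e n"]) (simp add: max_def abs_if)
    show "neg_part_op A x = diag_op (\<lambda>n. max (- a n) 0) e x" if x: "\<And>n. cinner (e n) x = 0" for x
      unfolding neg_part_op_def abs unfolding Ad by (simp add: diag_op_kernel[OF e x])
  qed
  show cp: "compact_op (pos_part_op A)" unfolding pos by (rule compact_op_diag_op[OF e p])
  show cm: "compact_op (neg_part_op A)" unfolding neg by (rule compact_op_diag_op[OF e m])
  show "positive_op (pos_part_op A)" unfolding pos by (rule positive_op_diag_op[OF e Bp]) simp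
  show "positive_op (neg_part_op A)" unfolding neg by (rule positive_op_diag_op[OF e Bm]) simp
  show "A = (\<lambda>x. pos_part_op A x - neg_part_op A x)"
  proof
    fix x
    have "pos_part_op A x - neg_part_op A x = (1/2) *\<^sub>C (A x + A x)"
      unfolding pos_part_op_def neg_part_op_def cvec.scale_right_diff_distrib[symmetric]
      by (rule arg_cong[of _ _ "\<lambda>y. (1/2) *\<^sub>C y"]) (simp add: algebra_simps)
    also have "\<dots> = A x"
      using half(1)[of 1 "A x" 1] by simp
    finally show "A x = pos_part_op A x - neg_part_op A x" by simp
  qed
  have "norm (pos_part_op A x) \<le> norm (A x)" "norm (neg_part_op A x) \<le> norm (A x)" for x
    using norm_triangle_ineq[of "abs_op A x" "A x"] norm_triangle_ineq4[of "abs_op A x" "A x"]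
    by (auto simp: pos_part_op_def neg_part_op_def norm_scaleC norm_divide norm_abs_op[OF A(1)])
  then show "singular_value (pos_part_op A) n \<le> singular_value A n"
    "singular_value (neg_part_op A) n \<le> singular_value A n"
    using singular_value_norm_le[OF cp A(1)] singular_value_norm_le[OF cm A(1)] by auto
qed

text \<open>
  The index is halved because \<open>Re T\<close> and \<open>Im T\<close> are sums of two operators, \<open>T\<close> and \<open>T\<^sup>*\<close>, each of which
  spends half of the orthogonality conditions.
\<close>

lemma Re_Im_op:
  fixes T :: "'a \<Rightarrow> 'a"
  assumes T: "compact_op T"
  shows "compact_op (Re_op T)" "selfadjoint (Re_op T)" "compact_op (Im_op T)" "selfadjoint (Im_op T)"
    "singular_value (Re_op T) n \<le> singular_value T (n div 2)"
    "singular_value (Im_op T) n \<le> singular_value T (n div 2)"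
proof -
  note bT = compact_op_bounded[OF T] and T' = compact_op_adj[OF T]
  have im: "Im_op T = (\<lambda>x. (1 / (2 * \<i>)) *\<^sub>C (T x + (- 1) *\<^sub>C adj_op T x))"
    by (simp add: Im_op_def)
  show c1: "compact_op (Re_op T)" unfolding Re_op_def by (intro compact_op_scale compact_op_add T T')
  show c2: "compact_op (Im_op T)" unfolding im by (intro compact_op_scale compact_op_add T T')
  show "selfadjoint (Re_op T)"
    by (simp add: selfadjoint_def Re_op_def cinner_scaleC_left cinner_scaleC_right cinner_add_left cinner_add_right
        adj_op(1)[OF bT] adj_op(2)[OF bT])
  show "selfadjoint (Im_op T)"
    by (simp add: selfadjoint_def Im_op_def cinner_scaleC_left cinner_scaleC_right cinner_diff_left cinner_diff_right
        adj_op(1)[OF bT] adj_op(2)[OF bT] algebra_simps)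
  let ?m = "n div 2"
  have "singular_value (Re_op T) n \<le> singular_value (Re_op T) (?m + ?m)"
    by (rule decseqD[OF singular_value_basic(2)[OF c1]]) simp
  also have "\<dots> \<le> cmod (1/2) * singular_value (\<lambda>x. T x + adj_op T x) (?m + ?m)"
    unfolding Re_op_def by (rule singular_value_scale[OF compact_op_add[OF T T']])
  also have "\<dots> \<le> cmod (1/2) * (singular_value T ?m + singular_value T ?m)"
    by (intro mult_left_mono order_trans[OF singular_value_add[OF T T']] add_left_mono singular_value_adj[OF T]) simp
  also have "\<dots> = singular_value T ?m" by (simp add: norm_divide)
  finally show "singular_value (Re_op T) n \<le> singular_value T ?m" .
  have "singular_value (\<lambda>x. (- 1) *\<^sub>C adj_op T x) ?m \<le> cmod (- 1) * singular_value (adj_op T) ?m"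
    by (rule singular_value_scale[OF T'])
  also have "\<dots> \<le> singular_value T ?m" using singular_value_adj[OF T] by simp
  finally have *: "singular_value (\<lambda>x. (- 1) *\<^sub>C adj_op T x) ?m \<le> singular_value T ?m" .
  have "singular_value (Im_op T) n \<le> singular_value (Im_op T) (?m + ?m)"
    by (rule decseqD[OF singular_value_basic(2)[OF c2]]) simp
  also have "\<dots> \<le> cmod (1 / (2 * \<i>)) * singular_value (\<lambda>x. T x + (- 1) *\<^sub>C adj_op T x) (?m + ?m)"
    unfolding im by (rule singular_value_scale[OF compact_op_add[OF T compact_op_scale[OF T']]])
  also have "\<dots> \<le> cmod (1 / (2 * \<i>)) * (singular_value T ?m + singular_value T ?m)"
    by (intro mult_left_mono order_trans[OF singular_value_add[OF T compact_op_scale[OF T']]] add_left_mono *) simp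
  also have "\<dots> = singular_value T ?m" by (simp add: norm_divide norm_mult)
  finally show "singular_value (Im_op T) n \<le> singular_value T ?m" .
qed

end


section \<open>Dixmier traces\<close>

lemma EL_nat_add: "\<omega> \<in> EL_nat \<Longrightarrow> Bseq x \<Longrightarrow> Bseq y \<Longrightarrow> \<omega> (\<lambda>n. x n + y n) = \<omega> x + \<omega> y"
  and EL_nat_scale: "\<omega> \<in> EL_nat \<Longrightarrow> Bseq x \<Longrightarrow> \<omega> (\<lambda>n. c * x n) = c * \<omega> x"
  and EL_nat_nonneg: "\<omega> \<in> EL_nat \<Longrightarrow> Bseq x \<Longrightarrow> (\<And>n. x n \<ge> 0) \<Longrightarrow> \<omega> x \<ge> 0"
  and EL_nat_lim: "\<omega> \<in> EL_nat \<Longrightarrow> x \<longlonglongrightarrow> l \<Longrightarrow> \<omega> x = l"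
  by (auto simp: EL_nat_def)

lemma Bseq_scale_real: "Bseq x \<Longrightarrow> Bseq (\<lambda>n. c * x n)" for c :: real
  using Bseq_mult[of "\<lambda>_. c" x] by simp

lemma EL_nat_diff: "\<omega> \<in> EL_nat \<Longrightarrow> Bseq x \<Longrightarrow> Bseq y \<Longrightarrow> \<omega> (\<lambda>n. x n - y n) = \<omega> x - \<omega> y"
  using EL_nat_add[of \<omega> x "\<lambda>n. - 1 * y n"] EL_nat_scale[of \<omega> y "- 1"] Bseq_scale_real[of y "- 1"] by simp

lemma Bseq_diff_real: "Bseq x \<Longrightarrow> Bseq y \<Longrightarrow> Bseq (\<lambda>n. x n - y n)" for x y :: "nat \<Rightarrow> real"
  using Bseq_add_iff Bseq_scale_real[of y "- 1"] by (simp add: Bseq_eq_bounded bounded_minus_comp)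

lemma EL_nat_mono:
  assumes "\<omega> \<in> EL_nat" "Bseq x" "Bseq y" "\<And>n. x n \<le> y n" shows "\<omega> x \<le> \<omega> y"
  using EL_nat_nonneg[OF assms(1) Bseq_diff_real[OF assms(3,2)]] EL_nat_diff[OF assms(1,3,2)] assms(4) by simp

lemma EL_nat_cong_lim:
  assumes "\<omega> \<in> EL_nat" "Bseq x" "(\<lambda>n. x n - y n) \<longlonglongrightarrow> 0" shows "\<omega> x = \<omega> y"
proof -
  have B: "Bseq (\<lambda>n. x n - y n)" using assms(3) by (rule tendsto_imp_Bseq)
  from Bseq_diff_real[OF assms(2) B] have "Bseq y" by simp
  then show ?thesis
    using EL_nat_diff[OF assms(1,2)] EL_nat_lim[OF assms(1,3)] by simp
qed

lemma sum_div2_le: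
  fixes f :: "nat \<Rightarrow> real"
  assumes "\<And>k. f k \<ge> 0"
  shows "(\<Sum>k\<le>n. f (k div 2)) \<le> 2 * (\<Sum>k\<le>n. f k)"
proof -
  have "(\<Sum>k<2 * m. f (k div 2)) = 2 * (\<Sum>k<m. f k)" for m
    by (induction m) (simp_all add: algebra_simps)
  from this[of "Suc n"] have "(\<Sum>k<2 * Suc n. f (k div 2)) = 2 * (\<Sum>k\<le>n. f k)"
    by (simp only: lessThan_Suc_atMost)
  moreover have "(\<Sum>k\<le>n. f (k div 2)) \<le> (\<Sum>k<2 * Suc n. f (k div 2))"
    by (rule sum_mono2) (use assms in auto)
  ultimately show ?thesis by simp
qed

lemma positive_op_scale:
  assumes "positive_op P" "r \<ge> 0" shows "positive_op (\<lambda>x. of_real r *\<^sub>C P x)"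
  using assms unfolding positive_op_def
  by (auto intro!: bounded_op_scale nonneg_Reals_mult_I simp: cinner_scaleC_right)

lemma Re_Im_scale:
  fixes u v :: "'a::complex_hilbert_space"
  shows "(1/2) *\<^sub>C (c *\<^sub>C u + cnj c *\<^sub>C v)
       = of_real (Re c) *\<^sub>C (1/2) *\<^sub>C (u + v) + of_real (- Im c) *\<^sub>C (1 / (2 * \<i>)) *\<^sub>C (u - v)"
    and "(1 / (2 * \<i>)) *\<^sub>C (c *\<^sub>C u - cnj c *\<^sub>C v)
       = of_real (Re c) *\<^sub>C (1 / (2 * \<i>)) *\<^sub>C (u - v) + of_real (Im c) *\<^sub>C (1/2) *\<^sub>C (u + v)"
proof -
  have collect: "a *\<^sub>C (u + v) + b *\<^sub>C (u - v) = (a + b) *\<^sub>C u + (a - b) *\<^sub>C v"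
    "b *\<^sub>C (u - v) + a *\<^sub>C (u + v) = (a + b) *\<^sub>C u + (a - b) *\<^sub>C v" for a b
    by (simp_all add: scaleC_add_right scaleC_add_left cvec.scale_right_diff_distrib cvec.scale_left_diff_distrib)
  have lhs: "(1/2) *\<^sub>C (c *\<^sub>C u + cnj c *\<^sub>C v) = (c / 2) *\<^sub>C u + (cnj c / 2) *\<^sub>C v"
    "(1 / (2 * \<i>)) *\<^sub>C (c *\<^sub>C u - cnj c *\<^sub>C v) = (c / (2 * \<i>)) *\<^sub>C u + (- (cnj c / (2 * \<i>))) *\<^sub>C v"
    by (simp_all add: scaleC_add_right cvec.scale_right_diff_distrib scaleC_scaleC)
  have "c / 2 = of_real (Re c) * (1/2) + of_real (- Im c) * (1 / (2 * \<i>))"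
    "cnj c / 2 = of_real (Re c) * (1/2) - of_real (- Im c) * (1 / (2 * \<i>))"
    by (simp_all add: complex_eq_iff Re_divide Im_divide)
  then show "(1/2) *\<^sub>C (c *\<^sub>C u + cnj c *\<^sub>C v)
       = of_real (Re c) *\<^sub>C (1/2) *\<^sub>C (u + v) + of_real (- Im c) *\<^sub>C (1 / (2 * \<i>)) *\<^sub>C (u - v)"
    unfolding scaleC_scaleC collect by (simp only: lhs)
  have "c / (2 * \<i>) = of_real (Im c) * (1/2) + of_real (Re c) * (1 / (2 * \<i>))"
    "- (cnj c / (2 * \<i>)) = of_real (Im c) * (1/2) - of_real (Re c) * (1 / (2 * \<i>))"
    by (simp_all add: complex_eq_iff Re_divide Im_divide)
  then show "(1 / (2 * \<i>)) *\<^sub>C (c *\<^sub>C u - cnj c *\<^sub>C v)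
       = of_real (Re c) *\<^sub>C (1 / (2 * \<i>)) *\<^sub>C (u - v) + of_real (Im c) *\<^sub>C (1/2) *\<^sub>C (u + v)"
    unfolding scaleC_scaleC collect by (simp only: lhs)
qed

text \<open>
  The linear extension of \<open>\<omega>\<close> applied to averages.  It has the same form as \<^const>\<open>zeta_residue\<close>, so that
  the two functionals need only be compared on positive operators.
\<close>

definition dixmier_ext :: "(real \<Rightarrow> real) \<Rightarrow> ((nat \<Rightarrow> real) \<Rightarrow> real) \<Rightarrow> ('a::complex_hilbert_space \<Rightarrow> 'a) \<Rightarrow> complex" where
  "dixmier_ext G \<omega> T =
     complex_of_real (\<omega> (lorentz_avg G (pos_part_op (Re_op T))))
     - complex_of_real (\<omega> (lorentz_avg G (neg_part_op (Re_op T))))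
     + \<i> * complex_of_real (\<omega> (lorentz_avg G (pos_part_op (Im_op T))))
     - \<i> * complex_of_real (\<omega> (lorentz_avg G (neg_part_op (Im_op T))))"

text \<open>
  The properties of a primitive \<open>G\<close> on which additivity of the Dixmier trace rests; only its values at
  integers enter.
\<close>

locale dixmier_setting = separable_hilbert +
  fixes G :: "real \<Rightarrow> real" and \<omega> :: "(nat \<Rightarrow> real) \<Rightarrow> real"
  assumes G_pos: "\<And>n. G (real (n + 1)) > 0"
    and G_mono: "\<And>m n. m \<le> n \<Longrightarrow> G (real (m + 1)) \<le> G (real (n + 1))"
    and G_slow: "(\<lambda>n. G (real (2 * n + 2)) / G (real (n + 1))) \<longlonglongrightarrow> 1"
    and \<omega>: "\<omega> \<in> EL_nat" and dil: "dilation_invariant \<omega>"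
begin

abbreviation M :: "('a \<Rightarrow> 'a) set" where "M \<equiv> lorentz_M G"

text \<open>
  The functional on positive operators, and below its extension \<open>tr_sa\<close> to self-adjoint ones.
\<close>

definition tr_pos :: "('a \<Rightarrow> 'a) \<Rightarrow> real" where "tr_pos P = \<omega> (lorentz_avg G P)"

lemma M_compact: "T \<in> M \<Longrightarrow> compact_op T" by (simp add: lorentz_M_def)

lemma avg_nonneg: "compact_op T \<Longrightarrow> lorentz_avg G (T :: 'a \<Rightarrow> 'a) n \<ge> 0"
  unfolding lorentz_avg_def using G_pos[of n] singular_value_basic(3)[of T]
  by (intro mult_nonneg_nonneg sum_nonneg) auto

lemma M_Bseq:
  assumes "T \<in> M" shows "Bseq (lorentz_avg G T)"
proof -
  obtain C where C: "\<And>n. lorentz_avg G T n \<le> C"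
    using assms by (auto simp: lorentz_M_def bdd_above_def)
  have "norm (lorentz_avg G T n) \<le> C" for n
    using C[of n] avg_nonneg[OF M_compact[OF assms]] by simp
  then show ?thesis by (rule BseqI')
qed

text \<open>Two majorants are allowed so that sums are covered; a single one is used twice.\<close>

lemma M_I:
  fixes P T S :: "'a \<Rightarrow> 'a"
  assumes P: "compact_op P" and T: "T \<in> M" and S: "S \<in> M" and C: "C \<ge> 0"
    and le: "\<And>n. (\<Sum>k\<le>n. singular_value P k) \<le> C * ((\<Sum>k\<le>n. singular_value T k) + (\<Sum>k\<le>n. singular_value S k))"
  shows "P \<in> M"
proof -
  obtain K where K: "\<And>n. lorentz_avg G T n \<le> K" using T by (auto simp: lorentz_M_def bdd_above_def)
  obtain L where L: "\<And>n. lorentz_avg G S n \<le> L" using S by (auto simp: lorentz_M_def bdd_above_def)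
  have "lorentz_avg G P n \<le> C * (K + L)" for n
  proof -
    have "lorentz_avg G P n \<le> 1 / G (real (n + 1)) * (C * ((\<Sum>k\<le>n. singular_value T k) + (\<Sum>k\<le>n. singular_value S k)))"
      unfolding lorentz_avg_def using le[of n] G_pos[of n] by (intro mult_left_mono) auto
    also have "\<dots> = C * (lorentz_avg G T n + lorentz_avg G S n)"
      unfolding lorentz_avg_def by (simp add: algebra_simps add_divide_distrib)
    also have "\<dots> \<le> C * (K + L)" using K[of n] L[of n] C by (intro mult_left_mono add_mono)
    finally show ?thesis .
  qed
  then show ?thesis using P by (auto simp: lorentz_M_def bdd_above_def)
qed

text \<open>
  Halved indices appear whenever an operator is split into two; they cost a factor \<open>2\<close> in the sums.
\<close>

lemma M_div2:
  fixes P T S :: "'a \<Rightarrow> 'a"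
  assumes P: "compact_op P" and T: "T \<in> M" and S: "S \<in> M"
    and le: "\<And>n. singular_value P n \<le> singular_value T (n div 2) + singular_value S (n div 2)"
  shows "P \<in> M"
proof (rule M_I[OF P T S, of 2])
  fix n
  have "(\<Sum>k\<le>n. singular_value P k) \<le> (\<Sum>k\<le>n. singular_value T (k div 2)) + (\<Sum>k\<le>n. singular_value S (k div 2))"
    unfolding sum.distrib[symmetric] by (rule sum_mono) (rule le)
  also have "\<dots> \<le> 2 * (\<Sum>k\<le>n. singular_value T k) + 2 * (\<Sum>k\<le>n. singular_value S k)"
    using M_compact[OF T] M_compact[OF S] by (intro add_mono sum_div2_le singular_value_basic(3))
  finally show "(\<Sum>k\<le>n. singular_value P k) \<le> 2 * ((\<Sum>k\<le>n. singular_value T k) + (\<Sum>k\<le>n. singular_value S k))"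
    by simp
qed simp

lemma M_add:
  assumes S: "S \<in> M" and T: "T \<in> M" shows "(\<lambda>x. S x + T x) \<in> M"
proof (rule M_div2[OF compact_op_add[OF M_compact[OF S] M_compact[OF T]] S T])
  fix n
  note c = compact_op_add[OF M_compact[OF S] M_compact[OF T]]
  have "singular_value (\<lambda>x. S x + T x) n \<le> singular_value (\<lambda>x. S x + T x) (n div 2 + n div 2)"
    by (rule decseqD[OF singular_value_basic(2)[OF c]]) simp
  also have "\<dots> \<le> singular_value S (n div 2) + singular_value T (n div 2)"
    by (rule singular_value_add[OF M_compact[OF S] M_compact[OF T]])
  finally show "singular_value (\<lambda>x. S x + T x) n \<le> singular_value S (n div 2) + singular_value T (n div 2)" .
qed

lemma M_scale:
  assumes T: "T \<in> M" shows "(\<lambda>x. c *\<^sub>C T x) \<in> M"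
proof (rule M_I[OF compact_op_scale[OF M_compact[OF T]] T T, of "cmod c"])
  fix n
  have nn: "(\<Sum>k\<le>n. singular_value T k) \<ge> 0"
    by (intro sum_nonneg singular_value_basic(3)[OF M_compact[OF T]])
  have "(\<Sum>k\<le>n. singular_value (\<lambda>x. c *\<^sub>C T x) k) \<le> cmod c * (\<Sum>k\<le>n. singular_value T k)"
    unfolding sum_distrib_left by (intro sum_mono singular_value_scale[OF M_compact[OF T]])
  also have "\<dots> \<le> cmod c * ((\<Sum>k\<le>n. singular_value T k) + (\<Sum>k\<le>n. singular_value T k))"
    using nn by (intro mult_left_mono) auto
  finally show "(\<Sum>k\<le>n. singular_value (\<lambda>x. c *\<^sub>C T x) k) \<le> cmod c * ((\<Sum>k\<le>n. singular_value T k) + (\<Sum>k\<le>n. singular_value T k))" .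
qed simp

lemma M_le:
  assumes P: "compact_op P" and T: "T \<in> M" and le: "\<And>n. singular_value P n \<le> singular_value T n"
  shows "P \<in> M"
proof (rule M_div2[OF P T T])
  fix n
  have "singular_value P n \<le> singular_value T (n div 2)"
    using le[of n] decseqD[OF singular_value_basic(2)[OF M_compact[OF T]], of "n div 2" n] by simp
  then show "singular_value P n \<le> singular_value T (n div 2) + singular_value T (n div 2)"
    using singular_value_basic(3)[OF M_compact[OF T], of "n div 2"] by linarith
qed

definition M_selfadjoint :: "('a \<Rightarrow> 'a) \<Rightarrow> bool" where "M_selfadjoint A \<longleftrightarrow> A \<in> M \<and> selfadjoint A"

definition M_positive :: "('a \<Rightarrow> 'a) \<Rightarrow> bool" where "M_positive P \<longleftrightarrow> P \<in> M \<and> positive_op P"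

lemma M_positive_parts:
  assumes "M_selfadjoint A" shows "M_positive (pos_part_op A)" "M_positive (neg_part_op A)"
proof -
  have A: "compact_op A" "selfadjoint A" "A \<in> M" using assms M_compact by (auto simp: M_selfadjoint_def)
  note p = parts_selfadjoint[OF A(1,2)]
  show "M_positive (pos_part_op A)" "M_positive (neg_part_op A)"
    unfolding M_positive_def using p M_le[OF p(1) A(3) p(6)] M_le[OF p(3) A(3) p(7)] by auto
qed

lemma M_selfadjoint_Re_Im:
  assumes T: "T \<in> M" shows "M_selfadjoint (Re_op T)" "M_selfadjoint (Im_op T)"
proof -
  note r = Re_Im_op[OF M_compact[OF T]]
  have "singular_value T n \<ge> 0" for n by (rule singular_value_basic(3)[OF M_compact[OF T]])
  then have "Re_op T \<in> M" "Im_op T \<in> M"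
    by (auto intro!: M_div2[OF r(1) T T] M_div2[OF r(3) T T] order_trans[OF r(5)] order_trans[OF r(6)] add_increasing2)
  then show "M_selfadjoint (Re_op T)" "M_selfadjoint (Im_op T)" using r by (auto simp: M_selfadjoint_def)
qed

text \<open>
  Additivity on the positive cone: the two Ky Fan inequalities squeeze the average of \<open>A + B\<close> between
  the sum of averages and its own value at twice the index, and \<open>\<omega>\<close> does not see the dilation.
\<close>

lemma tr_pos_add:
  assumes "M_positive A" "M_positive B" shows "tr_pos (\<lambda>x. A x + B x) = tr_pos A + tr_pos B"
proof -
  have A: "A \<in> M" "compact_op A" "positive_op A" and B: "B \<in> M" "compact_op B" "positive_op B"
    using assms M_compact by (auto simp: M_positive_def)
  let ?C = "\<lambda>x. A x + B x"
  define x where "x = lorentz_avg G ?C"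
  define a where "a = lorentz_avg G A"
  define b where "b = lorentz_avg G B"
  have CM: "?C \<in> M" by (rule M_add[OF A(1) B(1)])
  have Bx: "Bseq x" and Ba: "Bseq a" and Bb: "Bseq b"
    unfolding x_def a_def b_def using M_Bseq CM A B by auto
  have Bab: "Bseq (\<lambda>n. a n + b n)" using Bseq_diff_real[OF Ba Bseq_scale_real[OF Bb, of "- 1"]] by simp
  have ab: "a n + b n = 1 / G (real (n + 1)) * ((\<Sum>k<Suc n. singular_value A k) + (\<Sum>k<Suc n. singular_value B k))" for n
    unfolding a_def b_def lorentz_avg_def lessThan_Suc_atMost by (simp add: add_divide_distrib)
  have "x n \<le> a n + b n" for n
    unfolding ab unfolding x_def lorentz_avg_def lessThan_Suc_atMost[symmetric] using G_pos[of n]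
    by (intro mult_left_mono singular_value_sum_add_le A B) auto
  then have le: "\<omega> x \<le> \<omega> (\<lambda>n. a n + b n)" by (intro EL_nat_mono[OF \<omega> Bx Bab])
  define q where "q n = G (real (2 * n + 2)) / G (real (n + 1))" for n
  define y where "y n = q n * x (2 * n + 1)" for n
  obtain K where K: "K > 0" "\<And>n. \<bar>x n\<bar> \<le> K" using BseqE_abs[OF Bx] by metis
  have d1: "(\<lambda>n. y n - x (2 * n + 1)) \<longlonglongrightarrow> 0"
  proof (rule tendsto_rabs_zero_cancel, rule tendsto_sandwich)
    show "\<forall>\<^sub>F n in sequentially. 0 \<le> \<bar>y n - x (2 * n + 1)\<bar>" by simp
    show "\<forall>\<^sub>F n in sequentially. \<bar>y n - x (2 * n + 1)\<bar> \<le> \<bar>q n - 1\<bar> * K"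
    proof (intro always_eventually allI)
      fix n
      have "\<bar>y n - x (2 * n + 1)\<bar> = \<bar>q n - 1\<bar> * \<bar>x (2 * n + 1)\<bar>"
        unfolding y_def abs_mult[symmetric] by (simp add: algebra_simps)
      then show "\<bar>y n - x (2 * n + 1)\<bar> \<le> \<bar>q n - 1\<bar> * K" using K(2) by (simp add: mult_left_mono)
    qed
    have "(\<lambda>n. \<bar>q n - 1\<bar> * K) \<longlonglongrightarrow> \<bar>1 - 1\<bar> * K"
      unfolding q_def by (intro tendsto_intros G_slow)
    then show "(\<lambda>n. \<bar>q n - 1\<bar> * K) \<longlonglongrightarrow> 0" by simp
  qed simp
  have Bx2: "Bseq (\<lambda>n. x (2 * n + 1))" using K(2) by (intro BseqI'[of _ K]) simp
  have By: "Bseq y"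
  proof -
    have "Bseq (\<lambda>n. y n - x (2 * n + 1))" using d1 by (rule tendsto_imp_Bseq)
    from Bseq_diff_real[OF this Bseq_scale_real[OF Bx2, of "- 1"]] show ?thesis by simp
  qed
  have "a n + b n \<le> y n" for n
  proof -
    have "a n + b n \<le> 1 / G (real (n + 1)) * (\<Sum>k<2 * Suc n. singular_value ?C k)"
      unfolding ab using G_pos[of n] by (intro mult_left_mono singular_value_sum_add_ge A B) auto
    also have "{..<2 * Suc n} = {..2 * n + 1}" by auto
    also have "1 / G (real (n + 1)) * (\<Sum>k\<le>2 * n + 1. singular_value ?C k) = y n"
      using G_pos[of "2 * n + 1"] unfolding y_def q_def x_def lorentz_avg_def by (simp add: add.commute)
    finally show ?thesis .
  qed
  then have "\<omega> (\<lambda>n. a n + b n) \<le> \<omega> y" by (intro EL_nat_mono[OF \<omega> Bab By])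
  also have "\<omega> y = \<omega> (\<lambda>n. x (2 * n + 1))" by (rule EL_nat_cong_lim[OF \<omega> By d1])
  also have "\<dots> = \<omega> (\<lambda>n. x (2 * (n div 2) + 1))"
    by (rule dil[unfolded dilation_invariant_def, rule_format, OF Bx2, symmetric])
  also have "\<dots> = \<omega> x"
  proof (rule EL_nat_cong_lim[OF \<omega>])
    show "Bseq (\<lambda>n. x (2 * (n div 2) + 1))" using K(2) by (intro BseqI'[of _ K]) simp
    \<comment> \<open>The two sequences differ by at most one index, and consecutive averages are asymptotically equal.\<close>
    define s where "s = singular_value ?C"
    have cC: "compact_op ?C" by (rule M_compact[OF CM])
    define p where "p n = G (real (n + 1)) / G (real (Suc n + 1))" for n
    have "(\<lambda>n. 1 / q n) \<longlonglongrightarrow> 1 / 1" unfolding q_def by (intro tendsto_intros G_slow) simp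
    then have q1: "(\<lambda>n. 1 / q n) \<longlonglongrightarrow> 1" by simp
    have p1: "p \<longlonglongrightarrow> 1"
    proof (rule tendsto_sandwich[OF _ _ q1 tendsto_const])
      show "\<forall>\<^sub>F n in sequentially. 1 / q n \<le> p n"
      proof (intro always_eventually allI)
        fix n
        have "G (real (Suc n + 1)) \<le> G (real ((2 * n + 1) + 1))" by (rule G_mono) simp
        then have "G (real (n + 1)) / G (real ((2 * n + 1) + 1)) \<le> G (real (n + 1)) / G (real (Suc n + 1))"
          using G_pos[of n] G_pos[of "Suc n"] G_pos[of "2 * n + 1"] by (intro divide_left_mono) auto
        then show "1 / q n \<le> p n" by (simp add: p_def q_def add.commute)
      qed
      show "\<forall>\<^sub>F n in sequentially. p n \<le> 1"
      proof (intro always_eventually allI)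
        show "p n \<le> 1" for n
          unfolding p_def using G_pos[of "Suc n"] G_mono[of n "Suc n"] by (simp only: divide_le_eq_1_pos)
      qed
    qed
    have xstep: "\<bar>x (Suc n) - x n\<bar> \<le> s (Suc n) / G (real (0 + 1)) + K * (1 - p n)" for n
    proof -
      have G0: "G (real (n + 1)) > 0" "G (real (Suc n + 1)) > 0" by (rule G_pos)+
      have pn: "p n \<le> 1" using G0 G_mono[of n "Suc n"] by (simp add: p_def)
      have sn: "s (Suc n) \<ge> 0" unfolding s_def by (rule singular_value_basic(3)[OF cC])
      have "x (Suc n) = s (Suc n) / G (real (Suc n + 1)) + p n * x n"
        using G0 unfolding x_def lorentz_avg_def s_def p_def by (simp add: add_divide_distrib)
      then have "x (Suc n) - x n = s (Suc n) / G (real (Suc n + 1)) - (1 - p n) * x n"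
        by (simp add: algebra_simps)
      then have "\<bar>x (Suc n) - x n\<bar> \<le> \<bar>s (Suc n) / G (real (Suc n + 1))\<bar> + \<bar>(1 - p n) * x n\<bar>"
        by linarith
      moreover have "\<bar>(1 - p n) * x n\<bar> \<le> K * (1 - p n)"
        using pn mult_left_mono[OF K(2)[of n], of "1 - p n"] by (simp add: abs_mult mult.commute)
      moreover have "\<bar>s (Suc n) / G (real (Suc n + 1))\<bar> \<le> s (Suc n) / G (real (0 + 1))"
      proof -
        have "s (Suc n) / G (real (Suc n + 1)) \<le> s (Suc n) / G (real (0 + 1))"
          using sn G_pos[of 0] G0 G_mono[of 0 "Suc n"] by (intro divide_left_mono) auto
        then show ?thesis using sn G0 by simp
      qed
      ultimately show ?thesis by linarith
    qed
    show "(\<lambda>n. x (2 * (n div 2) + 1) - x n) \<longlonglongrightarrow> 0"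
    proof (rule tendsto_rabs_zero_cancel, rule tendsto_sandwich)
      show "\<forall>\<^sub>F n in sequentially. 0 \<le> \<bar>x (2 * (n div 2) + 1) - x n\<bar>" by simp
      show "\<forall>\<^sub>F n in sequentially. \<bar>x (2 * (n div 2) + 1) - x n\<bar> \<le> s (Suc n) / G (real (0 + 1)) + K * (1 - p n)"
      proof (intro always_eventually allI)
        fix n
        show "\<bar>x (2 * (n div 2) + 1) - x n\<bar> \<le> s (Suc n) / G (real (0 + 1)) + K * (1 - p n)"
        proof (cases "even n")
          case True
          then have "2 * (n div 2) + 1 = Suc n" by simp
          then show ?thesis using xstep[of n] by simp
        next
          case False
          then have "2 * (n div 2) + 1 = n" by presburger
          then show ?thesis using order_trans[OF abs_ge_zero xstep[of n]] by simp
        qed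
      qed
      have "(\<lambda>n. s (Suc n) / G (real (0 + 1)) + K * (1 - p n)) \<longlonglongrightarrow> 0 / G (real (0 + 1)) + K * (1 - 1)"
        using G_pos[of 0] unfolding s_def
        by (intro tendsto_intros p1 LIMSEQ_Suc[OF singular_value_basic(1)[OF cC]]) simp
      then show "(\<lambda>n. s (Suc n) / G (real (0 + 1)) + K * (1 - p n)) \<longlonglongrightarrow> 0" by simp
    qed simp
  qed
  finally have "\<omega> x = \<omega> (\<lambda>n. a n + b n)" using le by simp
  then show ?thesis unfolding tr_pos_def x_def[symmetric] a_def[symmetric] b_def[symmetric] EL_nat_add[OF \<omega> Ba Bb] .
qed

lemma tr_pos_scale:
  assumes "M_positive P" "r \<ge> 0" shows "tr_pos (\<lambda>x. of_real r *\<^sub>C P x) = r * tr_pos P"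
proof -
  have P: "P \<in> M" "compact_op P" "positive_op P" using assms M_compact by (auto simp: M_positive_def)
  have "lorentz_avg G (\<lambda>x. of_real r *\<^sub>C P x) = (\<lambda>n. r * lorentz_avg G P n)"
    unfolding lorentz_avg_def singular_value_scale_positive[OF P(2,3) assms(2)]
    by (simp add: fun_eq_iff sum_distrib_left)
  then show ?thesis unfolding tr_pos_def using EL_nat_scale[OF \<omega> M_Bseq[OF P(1)]] by simp
qed

lemma M_positive_add: "M_positive A \<Longrightarrow> M_positive B \<Longrightarrow> M_positive (\<lambda>x. A x + B x)"
  by (simp add: M_positive_def M_add positive_op_add)

lemma M_positive_scale: "M_positive A \<Longrightarrow> r \<ge> 0 \<Longrightarrow> M_positive (\<lambda>x. of_real r *\<^sub>C A x)"
  by (simp add: M_positive_def M_scale positive_op_scale)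

definition tr_sa :: "('a \<Rightarrow> 'a) \<Rightarrow> real" where "tr_sa A = tr_pos (pos_part_op A) - tr_pos (neg_part_op A)"

text \<open>
  If \<open>A = P - N\<close>, then \<open>A\<^sub>+ + N = P + A\<^sub>-\<close>, and additivity on the positive cone shows that the value
  does not depend on the decomposition.
\<close>

lemma tr_sa_eqI:
  assumes A: "M_selfadjoint A" and P: "M_positive P" and N: "M_positive N" and dec: "\<And>x. A x = P x - N x"
  shows "tr_sa A = tr_pos P - tr_pos N"
proof -
  have "A = (\<lambda>x. pos_part_op A x - neg_part_op A x)"
    using A M_compact by (intro parts_selfadjoint(5)) (auto simp: M_selfadjoint_def)
  then have "P x - N x = pos_part_op A x - neg_part_op A x" for x using dec by metis
  then have "(\<lambda>x. pos_part_op A x + N x) = (\<lambda>x. P x + neg_part_op A x)"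
    by (simp add: fun_eq_iff algebra_simps)
  then have "tr_pos (pos_part_op A) + tr_pos N = tr_pos P + tr_pos (neg_part_op A)"
    using tr_pos_add M_positive_parts[OF A] P N by metis
  then show ?thesis by (simp add: tr_sa_def)
qed

lemma M_selfadjoint_decomp:
  assumes "M_selfadjoint A" shows "A x = pos_part_op A x - neg_part_op A x"
proof -
  have "A = (\<lambda>x. pos_part_op A x - neg_part_op A x)"
    using assms M_compact by (intro parts_selfadjoint(5)) (auto simp: M_selfadjoint_def)
  then show ?thesis by metis
qed

lemma M_selfadjoint_add: "M_selfadjoint A \<Longrightarrow> M_selfadjoint B \<Longrightarrow> M_selfadjoint (\<lambda>x. A x + B x)"
  unfolding M_selfadjoint_def using M_add by (auto simp: selfadjoint_def cinner_add_left cinner_add_right)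

lemma M_selfadjoint_scale: "M_selfadjoint A \<Longrightarrow> M_selfadjoint (\<lambda>x. of_real r *\<^sub>C A x)"
  unfolding M_selfadjoint_def using M_scale by (auto simp: selfadjoint_def cinner_scaleC_left cinner_scaleC_right)

lemma tr_sa_add:
  assumes A: "M_selfadjoint A" and B: "M_selfadjoint B" shows "tr_sa (\<lambda>x. A x + B x) = tr_sa A + tr_sa B"
proof -
  note pA = M_positive_parts[OF A] and pB = M_positive_parts[OF B]
  have "tr_sa (\<lambda>x. A x + B x) = tr_pos (\<lambda>x. pos_part_op A x + pos_part_op B x) - tr_pos (\<lambda>x. neg_part_op A x + neg_part_op B x)"
    by (intro tr_sa_eqI M_selfadjoint_add A B M_positive_add pA pB) (simp add: M_selfadjoint_decomp[OF A] M_selfadjoint_decomp[OF B])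
  then show ?thesis by (simp add: tr_pos_add pA pB tr_sa_def)
qed

lemma tr_sa_scale:
  assumes A: "M_selfadjoint A" shows "tr_sa (\<lambda>x. of_real r *\<^sub>C A x) = r * tr_sa A"
proof (cases "r \<ge> 0")
  case True
  have "tr_sa (\<lambda>x. of_real r *\<^sub>C A x) = tr_pos (\<lambda>x. of_real r *\<^sub>C pos_part_op A x) - tr_pos (\<lambda>x. of_real r *\<^sub>C neg_part_op A x)"
    by (intro tr_sa_eqI M_selfadjoint_scale A M_positive_scale M_positive_parts[OF A] True)
      (simp only: cvec.scale_right_diff_distrib[symmetric] M_selfadjoint_decomp[OF A, symmetric])
  then show ?thesis by (simp add: tr_pos_scale M_positive_parts[OF A] True tr_sa_def algebra_simps)
next
  case False
  then have r: "- r \<ge> 0" by simp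
  have "tr_sa (\<lambda>x. of_real r *\<^sub>C A x) = tr_pos (\<lambda>x. of_real (- r) *\<^sub>C neg_part_op A x) - tr_pos (\<lambda>x. of_real (- r) *\<^sub>C pos_part_op A x)"
  proof (intro tr_sa_eqI M_selfadjoint_scale A M_positive_scale M_positive_parts[OF A] r)
    fix x
    have "of_real r *\<^sub>C A x = of_real r *\<^sub>C (pos_part_op A x - neg_part_op A x)"
      using M_selfadjoint_decomp[OF A] by simp
    then show "of_real r *\<^sub>C A x = of_real (- r) *\<^sub>C neg_part_op A x - of_real (- r) *\<^sub>C pos_part_op A x"
      by (simp add: cvec.scale_right_diff_distrib)
  qed
  then show ?thesis by (simp only: tr_pos_scale M_positive_parts[OF A] r tr_sa_def) (simp add: algebra_simps)
qed

lemma dixmier_ext_eq: "dixmier_ext G \<omega> T = of_real (tr_sa (Re_op T)) + \<i> * of_real (tr_sa (Im_op T))"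
  by (simp add: dixmier_ext_def tr_sa_def tr_pos_def algebra_simps)

theorem dixmier_trace_dixmier_ext: "dixmier_trace G (dixmier_ext G \<omega> :: ('a \<Rightarrow> 'a) \<Rightarrow> complex)"
  unfolding dixmier_trace_def
proof (intro bexI[OF _ \<omega>] conjI dil ballI impI)
  show "linear_functional_on M (dixmier_ext G \<omega>)"
    unfolding linear_functional_on_def
  proof (intro conjI ballI allI)
    fix S T assume S: "S \<in> M" and T: "T \<in> M"
    note bS = compact_op_bounded[OF M_compact[OF S]] and bT = compact_op_bounded[OF M_compact[OF T]]
    have "Re_op (\<lambda>x. S x + T x) = (\<lambda>x. Re_op S x + Re_op T x)"
      "Im_op (\<lambda>x. S x + T x) = (\<lambda>x. Im_op S x + Im_op T x)"
      unfolding Re_op_def Im_op_def adj_op_add[OF bS bT] scaleC_add_right[symmetric]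
      by (auto intro!: ext arg_cong[of _ _ "\<lambda>y. _ *\<^sub>C y"])
    then show "dixmier_ext G \<omega> (\<lambda>x. S x + T x) = dixmier_ext G \<omega> S + dixmier_ext G \<omega> T"
      unfolding dixmier_ext_eq by (simp add: tr_sa_add M_selfadjoint_Re_Im S T algebra_simps)
  next
    fix c T assume T: "T \<in> M"
    note bT = compact_op_bounded[OF M_compact[OF T]]
    have re: "Re_op (\<lambda>x. c *\<^sub>C T x) = (\<lambda>x. of_real (Re c) *\<^sub>C Re_op T x + of_real (- Im c) *\<^sub>C Im_op T x)"
      unfolding Re_op_def Im_op_def adj_op_scale[OF bT] by (intro ext Re_Im_scale(1))
    have im: "Im_op (\<lambda>x. c *\<^sub>C T x) = (\<lambda>x. of_real (Re c) *\<^sub>C Im_op T x + of_real (Im c) *\<^sub>C Re_op T x)"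
      unfolding Re_op_def Im_op_def adj_op_scale[OF bT] by (intro ext Re_Im_scale(2))
    have "tr_sa (Re_op (\<lambda>x. c *\<^sub>C T x)) = Re c * tr_sa (Re_op T) + (- Im c) * tr_sa (Im_op T)"
      unfolding re by (simp only: tr_sa_add tr_sa_scale M_selfadjoint_scale M_selfadjoint_Re_Im T)
    moreover have "tr_sa (Im_op (\<lambda>x. c *\<^sub>C T x)) = Re c * tr_sa (Im_op T) + Im c * tr_sa (Re_op T)"
      unfolding im by (simp only: tr_sa_add tr_sa_scale M_selfadjoint_scale M_selfadjoint_Re_Im T)
    ultimately show "dixmier_ext G \<omega> (\<lambda>x. c *\<^sub>C T x) = c * dixmier_ext G \<omega> T"
      unfolding dixmier_ext_eq by (simp add: complex_eq_iff algebra_simps)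
  qed
next
  fix T :: "'a \<Rightarrow> 'a" assume T: "T \<in> M" "positive_op T"
  have sa: "selfadjoint T" by (rule positive_op_selfadjoint[OF T(2)])
  have MT: "M_positive T" using T by (simp add: M_positive_def)
  have M0: "M_positive (\<lambda>x. of_real 0 *\<^sub>C T x)" by (rule M_positive_scale[OF MT]) simp
  have tr0: "tr_pos (\<lambda>x. of_real 0 *\<^sub>C T x) = 0" by (subst tr_pos_scale[OF MT]) auto
  have half: "(1/2 :: complex) *\<^sub>C (x + x) = x" for x :: 'a
    unfolding scaleC_add_right scaleC_add_left[symmetric] by simp
  have re: "Re_op T = T" and im: "Im_op T = (\<lambda>x. 0)"
    by (simp_all add: Re_op_def Im_op_def adj_op_selfadjoint[OF sa] half)
  have "tr_sa (Re_op T) = tr_pos T - tr_pos (\<lambda>x. of_real 0 *\<^sub>C T x)"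
    by (rule tr_sa_eqI[OF M_selfadjoint_Re_Im(1)[OF T(1)] MT M0]) (simp add: re)
  moreover have "tr_sa (Im_op T) = tr_pos (\<lambda>x. of_real 0 *\<^sub>C T x) - tr_pos (\<lambda>x. of_real 0 *\<^sub>C T x)"
    by (rule tr_sa_eqI[OF M_selfadjoint_Re_Im(2)[OF T(1)] M0 M0]) (simp add: im)
  ultimately show "dixmier_ext G \<omega> T = complex_of_real (\<omega> (lorentz_avg G T))"
    unfolding dixmier_ext_eq tr0 by (simp add: tr_pos_def)
qed

end


section \<open>The weight and its primitive\<close>

locale weight =
  fixes g G :: "real \<Rightarrow> real"
  assumes g: "g \<in> decay_class"
    and G: "\<And>t. t \<ge> 0 \<Longrightarrow> G t = integral {0..t} g"
begin

lemma g_pos: "t \<ge> 0 \<Longrightarrow> g t > 0"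
  and g_antimono: "0 \<le> s \<Longrightarrow> s \<le> t \<Longrightarrow> g t \<le> g s"
  and g_lim: "(g \<longlongrightarrow> 0) at_top"
  and g_not_integrable: "\<not> g absolutely_integrable_on {0<..}"
  and g_ratio: "((\<lambda>t. g (2 * t) / g t) \<longlongrightarrow> 1/2) at_top"
  using g by (auto simp: decay_class_def monotone_on_def)

lemma g_integrable: "0 \<le> a \<Longrightarrow> g integrable_on {a..b}"
proof -
  assume "0 \<le> a"
  then have "mono_on {a..b} (\<lambda>t. - g t)"
    using g_antimono by (auto simp: monotone_on_def)
  from integrable_on_mono_on[OF this] show ?thesis
    using integrable_neg[of "\<lambda>t. - g t" "{a..b}"] by simp
qed

lemma G_diff: "0 \<le> a \<Longrightarrow> a \<le> b \<Longrightarrow> G b - G a = integral {a..b} g"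
  using Henstock_Kurzweil_Integration.integral_combine[OF _ _ g_integrable, of 0 a b] by (simp add: G)

lemma G_diff_bounds:
  assumes "0 \<le> a" "a \<le> b"
  shows "(b - a) * g b \<le> G b - G a" "G b - G a \<le> (b - a) * g a"
proof -
  have c: "((\<lambda>_. c) has_integral (b - a) * c) {a..b}" for c :: real
    using has_integral_const_real[of c a b] assms by simp
  have i: "(g has_integral integral {a..b} g) {a..b}"
    using g_integrable[OF assms(1)] by (rule integrable_integral)
  show "(b - a) * g b \<le> G b - G a"
    unfolding G_diff[OF assms] by (rule has_integral_le[OF c i]) (use assms g_antimono in auto)
  show "G b - G a \<le> (b - a) * g a"
    unfolding G_diff[OF assms] by (rule has_integral_le[OF i c]) (use assms g_antimono in auto)
qed

lemma G_mono: "0 \<le> a \<Longrightarrow> a \<le> b \<Longrightarrow> G a \<le> G b"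
  using G_diff_bounds(1)[of a b] g_pos[of b] mult_nonneg_nonneg[of "b - a" "g b"] by linarith

lemma G_pos: "t > 0 \<Longrightarrow> G t > 0"
  using G_diff_bounds(1)[of 0 t] g_pos[of t] mult_pos_pos[of t "g t"] G[of 0] by (simp del: zero_less_mult_iff mult_pos_pos)

text \<open>
  Were \<open>G\<close> bounded, monotone convergence would make \<open>g\<close> integrable.
\<close>

lemma G_at_top: "filterlim G at_top at_top"
proof (rule ccontr)
  assume "\<not> filterlim G at_top at_top"
  then obtain Z where Z: "\<And>N. \<exists>t\<ge>N. \<not> Z \<le> G t"
    unfolding filterlim_at_top eventually_at_top_linorder by blast
  have bound: "G t \<le> Z" if "t \<ge> 0" for t
    using Z[of t] G_mono[of t] that by fastforce
  define f where "f k x = (if x \<in> {0..real k} then g x else 0)" for k :: nat and x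
  have fi: "(f k has_integral G (real k)) {0..}" for k
  proof -
    have "(g has_integral G (real k)) {0..real k}"
      using g_integrable[of 0 "real k"] by (simp add: G integrable_integral)
    then show ?thesis
      unfolding f_def by (subst has_integral_restrict) auto
  qed
  have "g integrable_on {0..} \<and> (\<lambda>k. integral {0..} (f k)) \<longlonglongrightarrow> integral {0..} g"
  proof (rule monotone_convergence_increasing)
    show "f k integrable_on {0..}" for k using fi by blast
    show "f k x \<le> f (Suc k) x" if "x \<in> {0..}" for k x
      using that g_pos[of x] by (auto simp: f_def)
    show "(\<lambda>k. f k x) \<longlonglongrightarrow> g x" if "x \<in> {0..}" for x
    proof (rule tendsto_eventually)
      obtain N :: nat where "x \<le> real N" using real_arch_simple by blast
      then show "\<forall>\<^sub>F k in sequentially. f k x = g x"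
        using that unfolding eventually_sequentially by (intro exI[of _ N]) (auto simp: f_def)
    qed
    show "bounded (range (\<lambda>k. integral {0..} (f k)))"
    proof (rule boundedI)
      fix y assume "y \<in> range (\<lambda>k. integral {0..} (f k))"
      then obtain k where "y = G (real k)" using integral_unique[OF fi] by blast
      then show "norm y \<le> Z" using bound[of "real k"] G_mono[of 0 "real k"] G[of 0] by simp
    qed
  qed
  then have "g integrable_on {0..}" by blast
  then have "g integrable_on {0<..}"
    by (rule integrable_spike_set) (auto intro: negligible_subset[of "{0}"])
  then have "g absolutely_integrable_on {0<..}"
    by (rule nonnegative_absolutely_integrable_1) (use g_pos in \<open>auto intro: less_imp_le\<close>)
  then show False using g_not_integrable by blast
qed

text \<open>\<open>G(2t) = 2\<integral>\<^sub>0\<^sup>t g(2s) ds\<close> and \<open>2g(2s)\<close> is asymptotic to \<open>g(s)\<close>; divergence of \<open>G\<close> does the rest.\<close>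

lemma G_slow: "((\<lambda>t. G (2 * t) / G t) \<longlongrightarrow> 1) at_top"
proof (rule tendstoI)
  fix \<epsilon> :: real assume \<epsilon>: "\<epsilon> > 0"
  have "((\<lambda>t. 2 * (g (2 * t) / g t)) \<longlongrightarrow> 2 * (1/2)) at_top" by (intro tendsto_intros g_ratio)
  then have "((\<lambda>t. 2 * (g (2 * t) / g t)) \<longlongrightarrow> 1) at_top" by simp
  from tendstoD[OF this, of "\<epsilon> / 2"] \<epsilon>
  obtain T0 where T0: "\<And>t. t \<ge> T0 \<Longrightarrow> \<bar>2 * (g (2 * t) / g t) - 1\<bar> < \<epsilon> / 2"
    by (auto simp: eventually_at_top_linorder dist_real_def)
  define T where "T = max T0 1"
  have T: "T > 0" by (simp add: T_def)
  have le: "\<bar>2 * g (2 * s) - g s\<bar> \<le> \<epsilon> / 2 * g s" if "s \<ge> T" for s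
  proof -
    have gs: "g s > 0" using that T by (intro g_pos) simp
    have "\<bar>2 * g (2 * s) - g s\<bar> = \<bar>2 * (g (2 * s) / g s) - 1\<bar> * g s"
      using gs by (simp add: abs_mult_pos field_simps flip: abs_mult_pos)
    also have "\<dots> \<le> \<epsilon> / 2 * g s" using T0[of s] that gs by (intro mult_right_mono) (auto simp: T_def)
    finally show ?thesis .
  qed
  have i2: "((\<lambda>s. 2 * g (2 * s)) has_integral (G (2 * b) - G (2 * a))) {a..b}" if "0 \<le> a" "a \<le> b" for a b
  proof -
    have "(g has_integral (G (2 * b) - G (2 * a))) {2 * a..2 * b}"
      using that by (simp add: G_diff g_integrable integrable_integral)
    from has_integral_stretch_real[OF this, of 2]
    have "((\<lambda>x. g (2 * x)) has_integral (1 / 2) *\<^sub>R (G (2 * b) - G (2 * a))) ((\<lambda>x. x / 2) ` {2 * a..2 * b})" by simp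
    moreover have "(\<lambda>x. x / 2) ` {2 * a..2 * b} = {a..b}"
      using image_divide_atLeastAtMost[of 2 "2 * a" "2 * b"] by simp
    ultimately have "((\<lambda>x. g (2 * x)) has_integral (1 / 2) *\<^sub>R (G (2 * b) - G (2 * a))) {a..b}" by simp
    from has_integral_mult_right[OF this, of 2] show ?thesis by (simp add: diff_divide_distrib)
  qed
  have i1: "(g has_integral (G b - G a)) {a..b}" if "0 \<le> a" "a \<le> b" for a b
    using that by (simp add: G_diff g_integrable integrable_integral)
  have tail: "\<bar>(G (2 * t) - G (2 * T)) - (G t - G T)\<bar> \<le> \<epsilon> / 2 * (G t - G T)" if "t \<ge> T" for t
  proof -
    have d: "((\<lambda>s. 2 * g (2 * s) - g s) has_integral ((G (2 * t) - G (2 * T)) - (G t - G T))) {T..t}"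
      using that T by (intro has_integral_diff i1 i2) auto
    have b: "((\<lambda>s. \<epsilon> / 2 * g s) has_integral (\<epsilon> / 2 * (G t - G T))) {T..t}"
      using that T by (intro has_integral_mult_right i1) auto
    have b': "((\<lambda>s. - (\<epsilon> / 2 * g s)) has_integral - (\<epsilon> / 2 * (G t - G T))) {T..t}"
      by (rule has_integral_neg[OF b])
    have "(G (2 * t) - G (2 * T)) - (G t - G T) \<le> \<epsilon> / 2 * (G t - G T)"
    proof (rule has_integral_le[OF d b])
      fix s assume "s \<in> {T..t}"
      then show "2 * g (2 * s) - g s \<le> \<epsilon> / 2 * g s" using order_trans[OF abs_ge_self le[of s]] by simp
    qed
    moreover have "- (\<epsilon> / 2 * (G t - G T)) \<le> (G (2 * t) - G (2 * T)) - (G t - G T)"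
    proof (rule has_integral_le[OF b' d])
      fix s assume "s \<in> {T..t}"
      then show "- (\<epsilon> / 2 * g s) \<le> 2 * g (2 * s) - g s"
        using order_trans[OF abs_ge_minus_self le[of s]] by simp
    qed
    ultimately show ?thesis by (intro abs_leI) linarith+
  qed
  define C where "C = G (2 * T)"
  have "\<forall>\<^sub>F t in at_top. 2 * C / \<epsilon> < G t"
    using G_at_top by (simp add: filterlim_at_top_dense)
  moreover have "\<forall>\<^sub>F t in at_top. t \<ge> T" by (rule eventually_ge_at_top)
  ultimately show "\<forall>\<^sub>F t in at_top. dist (G (2 * t) / G t) 1 < \<epsilon>"
  proof eventually_elim
    case (elim t)
    have Gt: "G t > 0" using elim T by (intro G_pos) simp
    have GT: "G T > 0" "G T \<le> C" using T by (auto simp: C_def intro: G_pos G_mono)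
    have "\<bar>G (2 * t) - G t\<bar> \<le> \<bar>(G (2 * t) - G (2 * T)) - (G t - G T)\<bar> + (C - G T)"
      using GT by (simp add: C_def)
    also have "\<dots> \<le> \<epsilon> / 2 * (G t - G T) + (C - G T)" using tail[of t] elim by simp
    also have "\<dots> < \<epsilon> / 2 * G t + C" using GT \<epsilon> by (simp add: algebra_simps add_pos_pos)
    also have "\<dots> < \<epsilon> * G t" using elim(1) \<epsilon> by (simp add: field_simps)
    finally have "\<bar>G (2 * t) - G t\<bar> / G t < \<epsilon>" using Gt by (simp add: pos_divide_less_eq)
    moreover have "\<bar>G (2 * t) - G t\<bar> / G t = \<bar>G (2 * t) / G t - 1\<bar>"
    proof -
      have "G (2 * t) / G t - 1 = (G (2 * t) - G t) / G t" using Gt by (simp add: diff_divide_distrib)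
      then show ?thesis using Gt by (simp add: abs_divide)
    qed
    ultimately show ?case by (simp add: dist_real_def)
  qed
qed

lemma G_seq:
  shows "G (real (n + 1)) > 0" "m \<le> n \<Longrightarrow> G (real (m + 1)) \<le> G (real (n + 1))"
    "(\<lambda>n. G (real (2 * n + 2)) / G (real (n + 1))) \<longlonglongrightarrow> 1"
proof -
  show "G (real (n + 1)) > 0" by (rule G_pos) simp
  show "m \<le> n \<Longrightarrow> G (real (m + 1)) \<le> G (real (n + 1))" by (rule G_mono) auto
  have "filterlim (\<lambda>n. real (n + 1)) at_top sequentially"
    by (rule filterlim_compose[OF filterlim_real_sequentially filterlim_add_const_nat_at_top])
  from filterlim_compose[OF G_slow this]
  have "(\<lambda>n. G (2 * real (n + 1)) / G (real (n + 1))) \<longlonglongrightarrow> 1" .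
  moreover have "2 * real (n + 1) = real (2 * n + 2)" for n by simp
  ultimately show "(\<lambda>n. G (real (2 * n + 2)) / G (real (n + 1))) \<longlonglongrightarrow> 1" by simp
qed

lemma G_at_top_seq: "filterlim (\<lambda>n. G (real (n + 1))) at_top sequentially"
  by (rule filterlim_compose[OF G_at_top
        filterlim_compose[OF filterlim_real_sequentially filterlim_add_const_nat_at_top]])

lemma sum_g_diff_le: "m \<le> n \<Longrightarrow> (\<Sum>k\<in>{m<..n}. g (real k)) \<le> G (real n) - G (real m)"
proof (induction n rule: dec_induct)
  case (step n)
  have "{m<..Suc n} = insert (Suc n) {m<..n}" using step by auto
  then have "(\<Sum>k\<in>{m<..Suc n}. g (real k)) = g (real (Suc n)) + (\<Sum>k\<in>{m<..n}. g (real k))" by simp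
  moreover have "g (real (Suc n)) \<le> G (real (Suc n)) - G (real n)"
    using G_diff_bounds(1)[of "real n" "real (Suc n)"] by simp
  ultimately show ?case using step by linarith
qed simp

lemma sum_g_le: "(\<Sum>k\<le>n. g (real k)) \<le> g 0 + G (real n)"
proof -
  have "{..n} = insert 0 {0<..n}" by auto
  then show ?thesis using sum_g_diff_le[of 0 n] G[of 0] by simp
qed

lemma G_le_sum_g: "G (real (n + 1)) \<le> (\<Sum>k\<le>n. g (real k))"
proof (induction n)
  case 0
  show ?case using G_diff_bounds(2)[of 0 1] G[of 0] by simp
next
  case (Suc n)
  then show ?case using G_diff_bounds(2)[of "real (Suc n)" "real (Suc n + 1)"] by simp
qed

text \<open>
  Regular variation makes \<open>g(m)\<close> comparable with \<open>g(4m)\<close>, which is below \<open>g(2m + 1)\<close> for \<open>m \<ge> 1\<close>.  This keeps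
  the halved index of \<open>Re T\<close> and \<open>Im T\<close> inside the ideal.
\<close>

lemma g_div2_le:
  obtains C where "C > 0" "\<And>k. g (real (k div 2)) \<le> C * g (real k)"
proof -
  have "\<forall>\<^sub>F t in at_top. g (2 * t) / g t > 1/3"
    using order_tendstoD(1)[OF g_ratio, of "1/3"] by simp
  then obtain T0 where T0: "\<And>t. t \<ge> T0 \<Longrightarrow> g (2 * t) / g t > 1/3"
    by (auto simp: eventually_at_top_linorder)
  define T where "T = max T0 1"
  have step: "g t \<le> 3 * g (2 * t)" if "t \<ge> T" for t
    using T0[of t] that g_pos[of t] by (simp add: T_def field_simps)
  define N where "N = nat \<lceil>T\<rceil> + 1"
  have NT: "real N \<ge> T" and N1: "N \<ge> 1" unfolding N_def by linarith+
  \<comment> \<open>\<open>9\<close> comes from two doubling steps; the quotient covers the finitely many small indices.\<close>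
  define C where "C = max 9 (g 0 / g (real (2 * N + 1)))"
  have "g (real (k div 2)) \<le> C * g (real k)" for k
  proof (cases "k div 2 \<ge> N")
    case True
    let ?m = "real (k div 2)"
    have m: "?m \<ge> T" "?m \<ge> 1" using True NT N1 by linarith+
    have "g ?m \<le> 3 * g (2 * ?m)" using m by (intro step)
    also have "g (2 * ?m) \<le> 3 * g (2 * (2 * ?m))" using m by (intro step) linarith
    also have "g (2 * (2 * ?m)) \<le> g (real k)"
    proof (rule g_antimono)
      have "k \<le> 2 * (k div 2) + 1" by presburger
      then have "real k \<le> 2 * ?m + 1" by linarith
      then show "real k \<le> 2 * (2 * ?m)" using m by linarith
    qed simp
    finally have "g ?m \<le> 9 * g (real k)" by simp
    also have "\<dots> \<le> C * g (real k)" using g_pos[of "real k"] by (intro mult_right_mono) (auto simp: C_def)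
    finally show ?thesis .
  next
    case False
    then have "k \<le> 2 * N + 1" by presburger
    then have "g (real (2 * N + 1)) \<le> g (real k)" by (intro g_antimono) auto
    have "g (real (k div 2)) \<le> g 0" by (rule g_antimono) auto
    also have "\<dots> = g 0 / g (real (2 * N + 1)) * g (real (2 * N + 1))" using g_pos[of "real (2 * N + 1)"] by simp
    also have "\<dots> \<le> C * g (real k)"
      using \<open>g (real (2 * N + 1)) \<le> g (real k)\<close> g_pos[of "real (2 * N + 1)"] by (intro mult_mono) (auto simp: C_def intro: less_imp_le)
    finally show ?thesis .
  qed
  moreover have "C > 0" by (simp add: C_def)
  ultimately show ?thesis using that by blast
qed

text \<open>
  As \<open>g\<close> is positive, a bound for large indices can be enlarged to one for all of them.
\<close>

lemma ideal_I_iff: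
  "T \<in> ideal_I g \<longleftrightarrow> compact_op T \<and> (\<exists>C. \<forall>n. \<bar>singular_value T n\<bar> \<le> C * g (real n))"
proof -
  have "singular_value T \<in> O(\<lambda>n. g (real n)) \<longleftrightarrow> (\<exists>C. \<forall>n. \<bar>singular_value T n\<bar> \<le> C * g (real n))"
  proof
    assume "singular_value T \<in> O(\<lambda>n. g (real n))"
    then obtain c where "\<forall>\<^sub>F n in sequentially. \<bar>singular_value T n\<bar> \<le> c * \<bar>g (real n)\<bar>"
      by (auto elim!: landau_o.bigE)
    then obtain N where c: "\<And>n. n \<ge> N \<Longrightarrow> \<bar>singular_value T n\<bar> \<le> c * \<bar>g (real n)\<bar>"
      unfolding eventually_sequentially by blast
    define C where "C = max c (Max ((\<lambda>n. \<bar>singular_value T n\<bar> / g (real n)) ` {..N}))"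
    have "\<bar>singular_value T n\<bar> \<le> C * g (real n)" for n
    proof (cases "n \<ge> N")
      case True
      have "c * g (real n) \<le> C * g (real n)" using g_pos[of "real n"] by (intro mult_right_mono) (auto simp: C_def)
      then show ?thesis using order_trans[OF c[OF True]] g_pos[of "real n"] by simp
    next
      case False
      then have "\<bar>singular_value T n\<bar> / g (real n) \<le> C" by (auto simp: C_def intro!: max.coboundedI2 Max_ge)
      then show ?thesis using g_pos[of "real n"] by (simp add: pos_divide_le_eq)
    qed
    then show "\<exists>C. \<forall>n. \<bar>singular_value T n\<bar> \<le> C * g (real n)" by blast
  next
    assume "\<exists>C. \<forall>n. \<bar>singular_value T n\<bar> \<le> C * g (real n)"
    then obtain C where C: "\<And>n. \<bar>singular_value T n\<bar> \<le> C * g (real n)" by blast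
    show "singular_value T \<in> O(\<lambda>n. g (real n))"
      by (rule bigoI[of _ C]) (use C g_pos in \<open>auto intro!: always_eventually simp: abs_of_pos\<close>)
  qed
  then show ?thesis by (simp add: ideal_I_def)
qed

lemma avg_bounded:
  assumes s: "\<And>k. 0 \<le> s k" "\<And>k. s k \<le> C * g (real k)" and C: "C \<ge> 0"
  shows "1 / G (real (n + 1)) * (\<Sum>k\<le>n. s k) \<le> C * (g 0 / G (real (0 + 1)) + 1)"
proof -
  have G1: "0 < G (real (0 + 1))" "G (real (0 + 1)) \<le> G (real (n + 1))" using G_seq(1)[of 0] G_seq(2)[of 0 n] by auto
  have "(\<Sum>k\<le>n. s k) \<le> C * (\<Sum>k\<le>n. g (real k))" unfolding sum_distrib_left by (intro sum_mono s)
  also have "\<dots> \<le> C * (g 0 + G (real (n + 1)))"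
    using sum_g_le[of n] G_mono[of "real n" "real (n + 1)"] C by (intro mult_left_mono) auto
  finally have "1 / G (real (n + 1)) * (\<Sum>k\<le>n. s k) \<le> 1 / G (real (n + 1)) * (C * (g 0 + G (real (n + 1))))"
    using G1 by (intro mult_left_mono) auto
  also have "\<dots> = C * (g 0 / G (real (n + 1)) + 1)" using G1 by (simp add: field_simps)
  also have "\<dots> \<le> C * (g 0 / G (real (0 + 1)) + 1)"
    using G1 g_pos[of 0] C by (intro mult_left_mono add_right_mono divide_left_mono) (auto intro: less_imp_le mult_pos_pos)
  finally show ?thesis .
qed

text \<open>
  Passing from \<open>n div 2\<close> to \<open>n\<close> changes both the sum and the denominator by \<open>o(G(n))\<close>, since the increment of
  the sum is dominated by that of \<open>G\<close>.
\<close>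

lemma avg_slow:
  assumes s: "\<And>k. 0 \<le> s k" "\<And>k. s k \<le> C * g (real k)" and C: "C \<ge> 0"
    and x: "\<And>n. x n = 1 / G (real (n + 1)) * (\<Sum>k\<le>n. s k)"
  shows "(\<lambda>n. x n - x (n div 2)) \<longlonglongrightarrow> 0"
proof -
  define K where "K = C * (g 0 / G (real (0 + 1)) + 1)"
  have xK: "x n \<le> K" for n unfolding x K_def by (rule avg_bounded[OF s C])
  have x0: "x n \<ge> 0" for n unfolding x using G_seq(1)[of n] by (intro mult_nonneg_nonneg sum_nonneg s) auto
  define q where "q n = G (real (2 * n + 2)) / G (real (n + 1))" for n
  define p where "p n = G (real (n div 2 + 1)) / G (real (n + 1))" for n
  have p1: "p n \<le> 1" for n using G_seq(1)[of n] G_seq(2)[of "n div 2" n] by (simp add: p_def)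
  have pq: "1 / q (n div 2) \<le> p n" for n
  proof -
    have "n \<le> 2 * (n div 2) + 1" by presburger
    from G_seq(2)[OF this]
    have "G (real (n div 2 + 1)) / G (real (2 * (n div 2) + 1 + 1)) \<le> G (real (n div 2 + 1)) / G (real (n + 1))"
      using G_seq(1)[of n] G_seq(1)[of "n div 2"] G_seq(1)[of "2 * (n div 2) + 1"] by (intro divide_left_mono) auto
    then show ?thesis by (simp add: p_def q_def add.commute)
  qed
  have div2: "filterlim (\<lambda>n::nat. n div 2) at_top sequentially"
    unfolding filterlim_at_top eventually_sequentially
  proof (intro allI)
    show "\<exists>N. \<forall>n\<ge>N. Z \<le> n div 2" for Z :: nat by (rule exI[of _ "2 * Z"]) auto
  qed
  have "(\<lambda>n. 1 / q n) \<longlonglongrightarrow> 1 / 1" unfolding q_def by (intro tendsto_intros G_seq(3)) simp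
  then have "(\<lambda>n. 1 / q (n div 2)) \<longlonglongrightarrow> 1" using filterlim_compose[OF _ div2] by simp
  then have plim: "p \<longlonglongrightarrow> 1"
    by (rule tendsto_sandwich[rotated 2, OF _ tendsto_const]) (use pq p1 in auto)
  have bound: "\<bar>x n - x (n div 2)\<bar> \<le> (C + K) * (1 - p n) + C * g 0 / G (real (n + 1))" for n
  proof -
    let ?m = "n div 2"
    have Gp: "G (real (n + 1)) > 0" "G (real (?m + 1)) > 0" by (rule G_seq(1))+
    have "{..n} = {..?m} \<union> {?m<..n}" by auto
    then have split: "(\<Sum>k\<le>n. s k) = (\<Sum>k\<le>?m. s k) + (\<Sum>k\<in>{?m<..n}. s k)"
      using sum.union_disjoint[of "{..?m}" "{?m<..n}" s] by fastforce
    have sm: "(\<Sum>k\<le>?m. s k) = G (real (?m + 1)) * x ?m" unfolding x using Gp by simp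
    have "x n = (\<Sum>k\<in>{?m<..n}. s k) / G (real (n + 1)) + p n * x ?m"
      unfolding p_def x[of n] split sm using Gp by (simp add: add_divide_distrib)
    then have "x n - x ?m = (\<Sum>k\<in>{?m<..n}. s k) / G (real (n + 1)) - (1 - p n) * x ?m"
      by (simp add: algebra_simps)
    moreover have "0 \<le> (\<Sum>k\<in>{?m<..n}. s k) / G (real (n + 1))"
      using Gp s by (intro divide_nonneg_pos sum_nonneg) auto
    moreover have "(\<Sum>k\<in>{?m<..n}. s k) / G (real (n + 1)) \<le> C * (1 - p n) + C * g 0 / G (real (n + 1))"
    proof -
      have "(\<Sum>k\<in>{?m<..n}. s k) \<le> C * (\<Sum>k\<in>{?m<..n}. g (real k))" unfolding sum_distrib_left by (intro sum_mono s)
      also have "\<dots> \<le> C * (G (real n) - G (real ?m))" using sum_g_diff_le[of ?m n] C by (intro mult_left_mono) auto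
      also have "\<dots> \<le> C * (G (real (n + 1)) - G (real (?m + 1)) + g 0)"
        using G_diff_bounds(2)[of "real ?m" "real (?m + 1)"] g_antimono[of 0 "real ?m"] G_mono[of "real n" "real (n + 1)"] C
        by (intro mult_left_mono) auto
      finally have "(\<Sum>k\<in>{?m<..n}. s k) / G (real (n + 1)) \<le> C * (G (real (n + 1)) - G (real (?m + 1)) + g 0) / G (real (n + 1))"
        using Gp by (intro divide_right_mono) auto
      also have "\<dots> = C * (1 - p n) + C * g 0 / G (real (n + 1))"
        using Gp by (simp add: p_def field_simps)
      finally show ?thesis .
    qed
    moreover have "0 \<le> (1 - p n) * x ?m" using p1[of n] x0 by simp
    moreover have "(1 - p n) * x ?m \<le> K * (1 - p n)" using mult_left_mono[OF xK[of ?m], of "1 - p n"] p1[of n] by (simp add: mult.commute)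
    moreover have "0 \<le> C * (1 - p n)" "0 \<le> C * g 0 / G (real (n + 1))" "0 \<le> K * (1 - p n)"
      using p1[of n] C Gp g_pos[of 0] order_trans[OF x0[of 0] xK] by auto
    ultimately show ?thesis unfolding distrib_right abs_le_iff by linarith
  qed
  show ?thesis
  proof (rule tendsto_rabs_zero_cancel, rule tendsto_sandwich)
    show "\<forall>\<^sub>F n in sequentially. 0 \<le> \<bar>x n - x (n div 2)\<bar>" by simp
    show "\<forall>\<^sub>F n in sequentially. \<bar>x n - x (n div 2)\<bar> \<le> (C + K) * (1 - p n) + C * g 0 / G (real (n + 1))"
      using bound by auto
    have "(\<lambda>n. C * g 0 / G (real (n + 1))) \<longlonglongrightarrow> 0"
      by (rule real_tendsto_divide_at_top[OF tendsto_const G_at_top_seq])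
    then have "(\<lambda>n. (C + K) * (1 - p n) + C * g 0 / G (real (n + 1))) \<longlonglongrightarrow> (C + K) * (1 - 1) + 0"
      by (intro tendsto_intros plim)
    then show "(\<lambda>n. (C + K) * (1 - p n) + C * g 0 / G (real (n + 1))) \<longlonglongrightarrow> 0" by simp
  qed simp
qed

end


section \<open>Generalised limits\<close>

lemma lebesgue_on_borel: "f \<in> borel_measurable borel \<Longrightarrow> f \<in> borel_measurable (lebesgue_on S)"
  by (intro measurable_restrict_space1 measurable_completion) simp

lemma LinfI: "f \<in> borel_measurable (lebesgue_on {0<..}) \<Longrightarrow> (\<And>t. \<bar>f t\<bar> \<le> C) \<Longrightarrow> f \<in> Linf"
  unfolding Linf_def by (auto intro!: exI[of _ C])

lemma Linf_add: "f \<in> Linf \<Longrightarrow> h \<in> Linf \<Longrightarrow> (\<lambda>t. f t + h t) \<in> Linf"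
proof -
  assume f: "f \<in> Linf" and h: "h \<in> Linf"
  from f obtain C where C: "AE t in lebesgue_on {0<..}. \<bar>f t\<bar> \<le> C" by (auto simp: Linf_def)
  from h obtain D where D: "AE t in lebesgue_on {0<..}. \<bar>h t\<bar> \<le> D" by (auto simp: Linf_def)
  have "AE t in lebesgue_on {0<..}. \<bar>f t + h t\<bar> \<le> C + D" using C D by eventually_elim linarith
  then show ?thesis using f h unfolding Linf_def by auto
qed

lemma Linf_scale: "f \<in> Linf \<Longrightarrow> (\<lambda>t. c * f t) \<in> Linf"
proof -
  assume f: "f \<in> Linf"
  then obtain C where C: "AE t in lebesgue_on {0<..}. \<bar>f t\<bar> \<le> C" by (auto simp: Linf_def)
  have "AE t in lebesgue_on {0<..}. \<bar>c * f t\<bar> \<le> \<bar>c\<bar> * C"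
    using C by eventually_elim (simp add: abs_mult mult_left_mono)
  then show ?thesis using f unfolding Linf_def by auto
qed

lemma ess_lim_at_topI:
  assumes "(f \<longlongrightarrow> l) at_top" shows "ess_lim_at_top f l"
  unfolding ess_lim_at_top_def
proof (intro allI impI)
  fix \<epsilon> :: real assume "\<epsilon> > 0"
  from tendstoD[OF assms this] obtain t0 where "\<And>t. t \<ge> t0 \<Longrightarrow> \<bar>f t - l\<bar> < \<epsilon>"
    by (auto simp: eventually_at_top_linorder dist_real_def)
  then show "\<exists>t0. AE t in lebesgue_on {0<..}. t0 < t \<longrightarrow> \<bar>f t - l\<bar> < \<epsilon>"
    by (intro exI[of _ t0] AE_I2) auto
qed

lemma Linf_cutoff:
  assumes a: "a > 0" and f: "f \<in> borel_measurable (lebesgue_on {a<..})" "bounded (f ` {a<..})"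
  shows "(\<lambda>t. f t * indicator {a<..} t) \<in> Linf"
proof -
  obtain C where C: "\<And>t. t > a \<Longrightarrow> \<bar>f t\<bar> \<le> C" using f(2) by (auto simp: bounded_iff)
  have "(\<lambda>t. indicator {a<..} t *\<^sub>R f t) \<in> borel_measurable lebesgue"
    using f(1) by (subst (asm) borel_measurable_restrict_space_iff) auto
  then have "(\<lambda>t. f t * indicator {a<..} t) \<in> borel_measurable lebesgue" by (simp add: mult.commute)
  then have "(\<lambda>t. f t * indicator {a<..} t) \<in> borel_measurable (lebesgue_on {0<..})"
    by (rule measurable_restrict_space1)
  moreover have "\<bar>f t * indicator {a<..} t\<bar> \<le> max C 0" for t
    using C[of t] by (cases "t > a") auto
  ultimately show ?thesis by (rule LinfI)
qed

lemma Linf_sample: "Bseq x \<Longrightarrow> (\<lambda>t. x (nat \<lfloor>t\<rfloor>)) \<in> Linf" for x :: "nat \<Rightarrow> real"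
proof -
  assume "Bseq x"
  then obtain K where K: "\<And>n. \<bar>x n\<bar> \<le> K" using BseqE_abs by metis
  have "(\<lambda>t::real. x (nat \<lfloor>t\<rfloor>)) \<in> borel_measurable borel" by measurable
  from LinfI[OF lebesgue_on_borel[OF this] K] show ?thesis .
qed

context
  fixes \<gamma> assumes \<gamma>: "\<gamma> \<in> EL_half_line"
begin

lemma EL_add: "f \<in> Linf \<Longrightarrow> h \<in> Linf \<Longrightarrow> \<gamma> (\<lambda>t. f t + h t) = \<gamma> f + \<gamma> h"
  and EL_scale: "f \<in> Linf \<Longrightarrow> \<gamma> (\<lambda>t. c * f t) = c * \<gamma> f"
  using \<gamma> by (auto simp: EL_half_line_def)

lemma EL_nonneg: "f \<in> Linf \<Longrightarrow> (\<And>t. f t \<ge> 0) \<Longrightarrow> \<gamma> f \<ge> 0"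
  using \<gamma> by (auto simp: EL_half_line_def)

lemma EL_lim: "f \<in> Linf \<Longrightarrow> (f \<longlongrightarrow> l) at_top \<Longrightarrow> \<gamma> f = l"
  using \<gamma> ess_lim_at_topI by (auto simp: EL_half_line_def)

lemma EL_diff: "f \<in> Linf \<Longrightarrow> h \<in> Linf \<Longrightarrow> \<gamma> (\<lambda>t. f t - h t) = \<gamma> f - \<gamma> h"
  using EL_add[of f "\<lambda>t. - 1 * h t"] EL_scale[of h "- 1"] Linf_scale[of h "- 1"] by simp

lemma EL_cong_lim:
  assumes "f \<in> Linf" "h \<in> Linf" "((\<lambda>t. f t - h t) \<longlongrightarrow> 0) at_top" shows "\<gamma> f = \<gamma> h"
proof -
  have "(\<lambda>t. f t - h t) \<in> Linf" using Linf_add[OF assms(1) Linf_scale[OF assms(2), of "- 1"]] by simp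
  from EL_lim[OF this assms(3)] show ?thesis using EL_diff[OF assms(1,2)] by simp
qed

text \<open>
  Two cut-offs of the same function agree near infinity, so a generalised limit does not tell them
  apart.
\<close>

lemma EL_eval_eq:
  assumes a: "a > 0" and f: "f \<in> borel_measurable (lebesgue_on {a<..})" "bounded (f ` {a<..})"
  shows "EL_eval \<gamma> f = \<gamma> (\<lambda>t. f t * indicator {a<..} t)"
proof -
  define t0 where "t0 = (SOME t0. t0 > 0 \<and> f \<in> borel_measurable (lebesgue_on {t0<..}) \<and> bounded (f ` {t0<..}))"
  have t0: "t0 > 0 \<and> f \<in> borel_measurable (lebesgue_on {t0<..}) \<and> bounded (f ` {t0<..})"
    unfolding t0_def by (rule someI[of _ a]) (use assms in simp)
  have "\<gamma> (\<lambda>t. f t * indicator {t0<..} t) = \<gamma> (\<lambda>t. f t * indicator {a<..} t)"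
  proof (rule EL_cong_lim)
    show "(\<lambda>t. f t * indicator {t0<..} t) \<in> Linf" using t0 by (intro Linf_cutoff) auto
    show "(\<lambda>t. f t * indicator {a<..} t) \<in> Linf" using assms by (intro Linf_cutoff) auto
    have "\<forall>\<^sub>F t in at_top. f t * indicator {t0<..} t - f t * indicator {a<..} t = 0"
      using eventually_gt_at_top[of t0] eventually_gt_at_top[of a] by eventually_elim simp
    then show "((\<lambda>t. f t * indicator {t0<..} t - f t * indicator {a<..} t) \<longlongrightarrow> 0) at_top"
      by (rule tendsto_eventually)
  qed
  then show ?thesis unfolding EL_eval_def Let_def t0_def .
qed

text \<open>
  Sampling at integer parts turns a generalised limit on the half-line into one on sequences.  In this
  way \<open>\<gamma>\<close> itself supplies the Banach limit that is needed to average over dilations.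
\<close>

lemma EL_nat_sample: "(\<lambda>x. \<gamma> (\<lambda>t. x (nat \<lfloor>t\<rfloor>))) \<in> EL_nat"
  unfolding EL_nat_def
proof (intro CollectI conjI allI impI)
  fix x :: "nat \<Rightarrow> real" and l assume x: "x \<longlonglongrightarrow> l"
  have "filterlim (\<lambda>t::real. nat \<lfloor>t\<rfloor>) sequentially at_top"
    by (rule filterlim_compose[OF filterlim_nat_sequentially filterlim_floor_sequentially])
  from filterlim_compose[OF x this] show "\<gamma> (\<lambda>t. x (nat \<lfloor>t\<rfloor>)) = l"
    using x by (intro EL_lim Linf_sample) (auto intro: convergent_imp_Bseq convergentI)
qed (auto intro!: EL_add EL_scale EL_nonneg Linf_sample)

end

lemma EL_nat_abs_le:
  assumes "\<omega> \<in> EL_nat" "\<And>n. \<bar>x n\<bar> \<le> K" shows "\<bar>\<omega> x\<bar> \<le> K"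
proof -
  have B: "Bseq x" using assms(2) by (intro BseqI'[of _ K]) simp
  have c: "\<omega> (\<lambda>_. c) = c" for c by (rule EL_nat_lim[OF assms(1) tendsto_const])
  have Bc: "Bseq (\<lambda>_. c)" for c :: real by (rule BseqI'[of _ "\<bar>c\<bar>"]) simp
  have "\<omega> x \<le> \<omega> (\<lambda>_. K)" by (rule EL_nat_mono[OF assms(1) B Bc]) (use assms(2) abs_le_D1 in blast)
  moreover have "\<omega> (\<lambda>_. - K) \<le> \<omega> x"
    by (rule EL_nat_mono[OF assms(1) Bc B]) (use assms(2) abs_le_D2 minus_le_iff in blast)
  ultimately show ?thesis by (simp add: c)
qed

text \<open>
  The generalised limit \<open>L\<close> of the Cesaro means of \<open>\<omega>\<close> along the iterated dilations of \<open>x\<close>; the index of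
  the \<open>j\<close>-th iterate is \<open>n div 2\<^sup>j\<close>.
\<close>

definition dilation_mean :: "((nat \<Rightarrow> real) \<Rightarrow> real) \<Rightarrow> ((nat \<Rightarrow> real) \<Rightarrow> real) \<Rightarrow> (nat \<Rightarrow> real) \<Rightarrow> real" where
  "dilation_mean L \<omega> x = L (\<lambda>N. (\<Sum>j\<le>N. \<omega> (\<lambda>n. x (n div 2 ^ j))) / (real N + 1))"

text \<open>
  A further dilation shifts the Cesaro means by one step, which changes them by \<open>O(1/N)\<close>; hence the
  invariance.  If \<open>x\<close> is asymptotically equal to its dilation, all the averaged values agree.
\<close>

lemma dilation_mean:
  assumes L: "L \<in> EL_nat" and \<omega>: "\<omega> \<in> EL_nat"
  shows "dilation_mean L \<omega> \<in> EL_nat" "dilation_invariant (dilation_mean L \<omega>)"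
    "Bseq x \<Longrightarrow> (\<lambda>n. x n - x (n div 2)) \<longlonglongrightarrow> 0 \<Longrightarrow> dilation_mean L \<omega> x = \<omega> x"
proof -
  define a where "a x N = (\<Sum>j\<le>N. \<omega> (\<lambda>n. x (n div 2 ^ j))) / (real N + 1)" for x :: "nat \<Rightarrow> real" and N
  have dm: "dilation_mean L \<omega> x = L (a x)" for x by (simp add: dilation_mean_def a_def[abs_def])
  have Bd: "Bseq (\<lambda>n. x (n div 2 ^ j))" if "Bseq x" for x :: "nat \<Rightarrow> real" and j
  proof -
    obtain K where "\<And>n. \<bar>x n\<bar> \<le> K" using BseqE_abs[OF \<open>Bseq x\<close>] by metis
    then show ?thesis by (intro BseqI'[of _ K]) simp
  qed
  have w: "\<bar>\<omega> (\<lambda>n. x (n div 2 ^ j))\<bar> \<le> K" if "\<And>n. \<bar>x n\<bar> \<le> K" for x K j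
    by (rule EL_nat_abs_le[OF \<omega>]) (rule that)
  have Ba: "Bseq (a x)" if x: "Bseq x" for x
  proof -
    obtain K where K: "\<And>n. \<bar>x n\<bar> \<le> K" using BseqE_abs[OF x] by metis
    have "norm (a x N) \<le> K" for N
    proof -
      have "\<bar>\<Sum>j\<le>N. \<omega> (\<lambda>n. x (n div 2 ^ j))\<bar> \<le> (\<Sum>j\<le>N. \<bar>\<omega> (\<lambda>n. x (n div 2 ^ j))\<bar>)" by (rule sum_abs)
      also have "\<dots> \<le> (\<Sum>j\<le>N. K)" by (intro sum_mono w K)
      finally show ?thesis by (simp add: a_def abs_divide pos_divide_le_eq mult.commute add.commute)
    qed
    then show ?thesis by (rule BseqI')
  qed
  have div2lim: "filterlim (\<lambda>n::nat. n div 2 ^ j) at_top sequentially" for j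
    unfolding filterlim_at_top eventually_sequentially
  proof (intro allI)
    show "\<exists>N. \<forall>n\<ge>N. Z \<le> n div 2 ^ j" for Z :: nat
      by (rule exI[of _ "2 ^ j * Z"]) (simp add: less_eq_div_iff_mult_less_eq mult.commute)
  qed
  have const: "a x N = c" if "\<And>j. \<omega> (\<lambda>n. x (n div 2 ^ j)) = c" for x c N
    unfolding a_def that by (simp add: field_simps)
  show "dilation_mean L \<omega> \<in> EL_nat"
    unfolding EL_nat_def dm
  proof (intro CollectI conjI allI impI)
    fix x y :: "nat \<Rightarrow> real" assume "Bseq x \<and> Bseq y"
    then have B: "Bseq x" "Bseq y" by auto
    have "a (\<lambda>n. x n + y n) = (\<lambda>N. a x N + a y N)"
      unfolding a_def by (simp add: EL_nat_add[OF \<omega>] Bd B sum.distrib add_divide_distrib)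
    then show "L (a (\<lambda>n. x n + y n)) = L (a x) + L (a y)" using EL_nat_add[OF L Ba Ba] B by simp
  next
    fix c and x :: "nat \<Rightarrow> real" assume B: "Bseq x"
    have "a (\<lambda>n. c * x n) = (\<lambda>N. c * a x N)"
      unfolding a_def by (simp add: EL_nat_scale[OF \<omega>] Bd B sum_distrib_left)
    then show "L (a (\<lambda>n. c * x n)) = c * L (a x)" using EL_nat_scale[OF L Ba[OF B]] by simp
  next
    fix x :: "nat \<Rightarrow> real" assume x: "Bseq x \<and> (\<forall>n. x n \<ge> 0)"
    then have "\<omega> (\<lambda>n. x (n div 2 ^ j)) \<ge> 0" for j by (intro EL_nat_nonneg[OF \<omega>] Bd) auto
    then have "a x N \<ge> 0" for N unfolding a_def by (intro divide_nonneg_pos sum_nonneg) auto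
    then show "L (a x) \<ge> 0" using x by (intro EL_nat_nonneg[OF L] Ba) auto
  next
    fix x :: "nat \<Rightarrow> real" and l assume x: "x \<longlonglongrightarrow> l"
    have "\<omega> (\<lambda>n. x (n div 2 ^ j)) = l" for j
      by (rule EL_nat_lim[OF \<omega> filterlim_compose[OF x div2lim]])
    then have "a x = (\<lambda>_. l)" using const by blast
    then show "L (a x) = l" using EL_nat_lim[OF L tendsto_const] by simp
  qed
  show "dilation_invariant (dilation_mean L \<omega>)"
    unfolding dilation_invariant_def dm
  proof (intro allI impI)
    fix x :: "nat \<Rightarrow> real" assume x: "Bseq x"
    then obtain K where K: "\<And>n. \<bar>x n\<bar> \<le> K" using BseqE_abs by metis
    have B': "Bseq (\<lambda>n. x (n div 2))" using Bd[OF x, of 1] by simp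
    show "L (a (\<lambda>n. x (n div 2))) = L (a x)"
    proof (rule EL_nat_cong_lim[OF L Ba[OF B']])
      have bound: "\<bar>a (\<lambda>n. x (n div 2)) N - a x N\<bar> \<le> 2 * K / (real N + 1)" for N
      proof -
        define v where "v j = \<omega> (\<lambda>n. x (n div 2 ^ j))" for j
        have "(\<Sum>j\<le>N. v (Suc j)) - (\<Sum>j\<le>N. v j) = v (Suc N) - v 0"
          by (induction N) auto
        moreover have "\<omega> (\<lambda>n. x (n div 2 ^ j div 2)) = v (Suc j)" for j
          by (simp add: v_def div_mult2_eq[symmetric] mult.commute)
        ultimately have "a (\<lambda>n. x (n div 2)) N - a x N = (v (Suc N) - v 0) / (real N + 1)"
          unfolding a_def by (simp add: v_def[symmetric] diff_divide_distrib[symmetric])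
        moreover have "\<bar>v (Suc N) - v 0\<bar> \<le> 2 * K"
          using w[of x K "Suc N", OF K] w[of x K 0, OF K] unfolding v_def by linarith
        ultimately show ?thesis by (simp add: abs_divide divide_right_mono)
      qed
      show "(\<lambda>N. a (\<lambda>n. x (n div 2)) N - a x N) \<longlonglongrightarrow> 0"
      proof (rule Lim_null_comparison)
        show "\<forall>\<^sub>F N in sequentially. norm (a (\<lambda>n. x (n div 2)) N - a x N) \<le> 2 * K / (real N + 1)"
          using bound by simp
        show "(\<lambda>N. 2 * K / (real N + 1)) \<longlonglongrightarrow> 0"
        proof (rule real_tendsto_divide_at_top[OF tendsto_const])
          have "filterlim (\<lambda>N. real (N + 1)) at_top sequentially"
            by (rule filterlim_compose[OF filterlim_real_sequentially filterlim_add_const_nat_at_top])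
          then show "filterlim (\<lambda>N. real N + 1) at_top sequentially" by (simp add: add.commute)
        qed
      qed
    qed
  qed
  show "dilation_mean L \<omega> x = \<omega> x" if x: "Bseq x" and slow: "(\<lambda>n. x n - x (n div 2)) \<longlonglongrightarrow> 0" for x
  proof -
    have "\<omega> (\<lambda>n. x (n div 2 ^ j)) = \<omega> x" for j
    proof (induction j)
      case (Suc j)
      have "(\<lambda>n. x (n div 2 ^ j) - x (n div 2 ^ j div 2)) \<longlonglongrightarrow> 0"
        by (rule filterlim_compose[OF slow div2lim])
      then have "\<omega> (\<lambda>n. x (n div 2 ^ j)) = \<omega> (\<lambda>n. x (n div 2 ^ j div 2))"
        by (rule EL_nat_cong_lim[OF \<omega> Bd[OF x]])
      also have "(\<lambda>n. x (n div 2 ^ j div 2)) = (\<lambda>n. x (n div 2 ^ Suc j))"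
        by (simp add: div_mult2_eq[symmetric] mult.commute)
      finally show ?case using Suc by simp
    qed simp
    then have "a x = (\<lambda>_. \<omega> x)" using const by blast
    then show ?thesis unfolding dm using EL_nat_lim[OF L tendsto_const] by simp
  qed
qed


section \<open>Residues as functionals of averages\<close>

text \<open>
  The boundary term \<open>u\<^sub>N \<Sum>\<^bsub>k<N\<^esub> s\<^sub>k\<close> tends to \<open>0\<close>: a fixed initial part of the sum is killed by \<open>u\<^sub>N\<close>, and
  on the rest \<open>u\<^sub>N \<le> u\<^sub>k\<close> leaves a tail of the convergent series.
\<close>

lemma abel_summation_sums:
  fixes s u :: "nat \<Rightarrow> real"
  assumes s: "\<And>n. s n \<ge> 0" and u: "decseq u" "\<And>n. u n \<ge> 0" "u \<longlonglongrightarrow> 0" and su: "summable (\<lambda>n. s n * u n)"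
  shows "(\<lambda>n. (u n - u (Suc n)) * (\<Sum>k\<le>n. s k)) sums (\<Sum>n. s n * u n)"
proof -
  have partial: "(\<Sum>n<N. (u n - u (Suc n)) * (\<Sum>k\<le>n. s k)) = (\<Sum>n<N. s n * u n) - u N * (\<Sum>k<N. s k)" for N
  proof (induction N)
    case (Suc N)
    have "(\<Sum>k\<le>N. s k) = (\<Sum>k<N. s k) + s N" by (simp add: lessThan_Suc_atMost[symmetric])
    with Suc show ?case by (simp add: algebra_simps)
  qed simp
  have "(\<lambda>N. u N * (\<Sum>k<N. s k)) \<longlonglongrightarrow> 0"
  proof (rule LIMSEQ_I)
    fix \<epsilon> :: real assume \<epsilon>: "\<epsilon> > 0"
    then have "\<epsilon> / 2 > 0" by simp
    then obtain M where M: "\<And>m n. m \<ge> M \<Longrightarrow> norm (\<Sum>k\<in>{m..<n}. s k * u k) < \<epsilon> / 2"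
      using su unfolding summable_Cauchy by blast
    have "(\<lambda>N. u N * (\<Sum>k<M. s k)) \<longlonglongrightarrow> 0 * (\<Sum>k<M. s k)" by (intro tendsto_intros u)
    then have "(\<lambda>N. u N * (\<Sum>k<M. s k)) \<longlonglongrightarrow> 0" by simp
    from LIMSEQ_D[OF this \<open>\<epsilon> / 2 > 0\<close>] obtain N0 where N0: "\<And>N. N \<ge> N0 \<Longrightarrow> \<bar>u N * (\<Sum>k<M. s k)\<bar> < \<epsilon> / 2" by auto
    have "norm (u N * (\<Sum>k<N. s k) - 0) < \<epsilon>" if N: "N \<ge> max M N0" for N
    proof -
      have "(\<Sum>k<N. s k) = (\<Sum>k<M. s k) + (\<Sum>k\<in>{M..<N}. s k)"
        using N by (simp add: lessThan_atLeast0 sum.atLeastLessThan_concat)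
      then have "u N * (\<Sum>k<N. s k) = u N * (\<Sum>k<M. s k) + (\<Sum>k\<in>{M..<N}. u N * s k)"
        by (simp add: distrib_left sum_distrib_left)
      moreover have "(\<Sum>k\<in>{M..<N}. u N * s k) \<le> (\<Sum>k\<in>{M..<N}. s k * u k)"
      proof (rule sum_mono)
        fix k assume "k \<in> {M..<N}"
        then have "u N \<le> u k" using decseqD[OF u(1)] by simp
        then show "u N * s k \<le> s k * u k" using mult_right_mono[OF _ s[of k], of "u N" "u k"] by (simp add: mult.commute)
      qed
      moreover have "(\<Sum>k\<in>{M..<N}. s k * u k) < \<epsilon> / 2" using M[of M N] by (simp add: abs_less_iff)
      moreover have "u N * (\<Sum>k<M. s k) < \<epsilon> / 2" using N0[of N] N by (simp add: abs_less_iff)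
      moreover have "0 \<le> u N * (\<Sum>k<N. s k)" using u s by (intro mult_nonneg_nonneg sum_nonneg)
      ultimately show ?thesis by simp
    qed
    then show "\<exists>N0. \<forall>N\<ge>N0. norm (u N * (\<Sum>k<N. s k) - 0) < \<epsilon>" by blast
  qed
  from tendsto_diff[OF summable_LIMSEQ[OF su] this] show ?thesis
    unfolding sums_def partial by simp
qed

text \<open>\<open>b\<^sup>1\<^sup>+\<^sup>h\<close> tends to \<open>b\<close> uniformly on bounded sets as \<open>h\<close> decreases to \<open>0\<close>; here \<open>b = s/a\<close>.\<close>

lemma powr_perturbation:
  fixes s a C h :: real
  assumes s: "0 \<le> s" "s \<le> C * a" and a: "a > 0" and C: "C \<ge> 1" and h: "h > 0"
  shows "\<bar>s powr (1 + h) - s * a powr h\<bar> \<le> (C * (C powr h - 1) + h) * a powr (1 + h)"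
proof -
  have Ch: "C powr h \<ge> 1" using C h by (simp add: ge_one_powr_ge_zero)
  show ?thesis
  proof (cases "s = 0")
    case True
    then show ?thesis using Ch C h by simp
  next
    case False
    define b where "b = s / a"
    have b: "b > 0" "b \<le> C" "s = b * a" using False s a by (auto simp: b_def pos_divide_le_eq)
    have "s powr (1 + h) - s * a powr h = (b * (b powr h - 1)) * a powr (1 + h)"
      using b a by (simp add: powr_mult powr_add algebra_simps)
    moreover have "\<bar>b * (b powr h - 1)\<bar> \<le> C * (C powr h - 1) + h"
    proof (cases "b \<ge> 1")
      case True
      then have "b powr h \<ge> 1" using h by (simp add: ge_one_powr_ge_zero)
      moreover have "b powr h \<le> C powr h" using b h by (intro powr_mono2) auto
      ultimately have "b * (b powr h - 1) \<le> C * (C powr h - 1)" using b by (intro mult_mono) auto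
      moreover have "0 \<le> b * (b powr h - 1)" using b \<open>b powr h \<ge> 1\<close> by simp
      ultimately show ?thesis using h by simp
    next
      case False
      have "b powr h \<ge> 1 + h * ln b"
        using b exp_ge_add_one_self[of "h * ln b"] by (simp add: powr_def)
      moreover have "b powr h \<le> 1" using False b h by (intro powr_le1) auto
      moreover have "ln (1 / b) \<le> 1 / b - 1" using b by (intro ln_le_minus_one) simp
      then have "b * (- ln b) \<le> b * (1 / b - 1)" using b by (intro mult_left_mono) (auto simp: ln_div)
      then have "b * (- ln b) \<le> 1" using b by (simp add: algebra_simps)
      then have "h * (b * (- ln b)) \<le> h * 1" using h by (intro mult_left_mono) auto
      moreover have "b * (1 - b powr h) \<le> b * (- (h * ln b))"
        using b \<open>b powr h \<ge> 1 + h * ln b\<close> by (intro mult_left_mono) auto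
      moreover have "0 \<le> b * (1 - b powr h)" using b \<open>b powr h \<le> 1\<close> by simp
      ultimately have "\<bar>b * (1 - b powr h)\<bar> \<le> h" by (simp add: algebra_simps)
      moreover have "\<bar>b * (b powr h - 1)\<bar> = \<bar>b * (1 - b powr h)\<bar>" by (simp add: abs_mult abs_minus_commute)
      ultimately show ?thesis using mult_nonneg_nonneg[of C "C powr h - 1"] C Ch by linarith
    qed
    ultimately show ?thesis by (simp add: abs_mult mult_right_mono)
  qed
qed

text \<open>
  Besides the generalised limit \<open>\<gamma>\<close>, this fixes \<open>t1\<close> and \<open>K\<close> that bound the zeta function of the
  sequence \<open>g(n)\<close> by \<open>G(e\<^sup>t)\<close>.
\<close>

locale zeta_setting = weight +
  fixes \<gamma> :: "(real \<Rightarrow> real) \<Rightarrow> real" and t1 K :: real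
  assumes \<gamma>: "\<gamma> \<in> EL_half_line" and t1: "t1 \<ge> 1"
    and zeta_summable: "\<And>t. t > t1 \<Longrightarrow> summable (\<lambda>n. g (real n) powr (1 + 1/t))"
    and zeta_bound: "\<And>t. t > t1 \<Longrightarrow> (\<Sum>n. g (real n) powr (1 + 1/t)) \<le> K * G (exp t)"
begin

text \<open>
  Summation by parts of \<open>\<Sum> s(n) g(n)\<^bsup>1/t\<^esup> / G(e\<^sup>t)\<close> yields \<open>mean_op x t\<close>, where \<open>x(n)\<close> is the average of \<open>s\<close>
  up to \<open>n\<close>.  Its coefficients are non-negative because \<open>g\<close> decreases, so it is positive in \<open>x\<close>, and
  \<open>\<Omega>\<close>, which evaluates it by \<open>\<gamma>\<close>, is a positive functional on all bounded sequences.
\<close>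

definition decr :: "real \<Rightarrow> nat \<Rightarrow> real" where
  "decr t n = g (real n) powr (1/t) - g (real (Suc n)) powr (1/t)"

definition mean_op :: "(nat \<Rightarrow> real) \<Rightarrow> real \<Rightarrow> real" where
  "mean_op x t = (\<Sum>n. decr t n * (G (real (n + 1)) * x n)) / G (exp t)"

definition mean_cut :: "(nat \<Rightarrow> real) \<Rightarrow> real \<Rightarrow> real" where
  "mean_cut x t = mean_op x t * indicator {t1<..} t"

definition \<Omega> :: "(nat \<Rightarrow> real) \<Rightarrow> real" where
  "\<Omega> x = \<gamma> (mean_cut x)"

lemma G_exp_pos: "G (exp t) > 0" by (rule G_pos) simp

lemma u_props:
  assumes t: "t > t1"
  shows "decseq (\<lambda>n. g (real n) powr (1/t))" "(\<lambda>n. g (real n) powr (1/t)) \<longlonglongrightarrow> 0"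
proof -
  have t0: "1 / t > 0" using t t1 by simp
  show "decseq (\<lambda>n. g (real n) powr (1/t))"
  proof (rule decseq_SucI)
    fix n
    show "g (real (Suc n)) powr (1/t) \<le> g (real n) powr (1/t)"
    proof (rule powr_mono2)
      show "0 \<le> g (real (Suc n))" using g_pos[of "real (Suc n)"] by simp
      show "g (real (Suc n)) \<le> g (real n)" by (rule g_antimono) auto
    qed (use t0 in simp)
  qed
  have "(\<lambda>n. g (real n)) \<longlonglongrightarrow> 0" by (rule filterlim_compose[OF g_lim filterlim_real_sequentially])
  moreover have "\<forall>\<^sub>F n in sequentially. 0 \<le> g (real n)"
    using less_imp_le[OF g_pos] by simp
  ultimately have "(\<lambda>n. g (real n) powr (1/t)) \<longlonglongrightarrow> 0 powr (1/t)"
    using tendsto_powr'[OF _ tendsto_const[of "1/t"]] t0 by blast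
  then show "(\<lambda>n. g (real n) powr (1/t)) \<longlonglongrightarrow> 0" using t0 by simp
qed

lemma decr_nonneg: "t > t1 \<Longrightarrow> decr t n \<ge> 0"
  using decseqD[OF u_props(1), of t n "Suc n"] by (simp add: decr_def)

lemma abel_g:
  assumes t: "t > t1" and s: "\<And>n. 0 \<le> s n" "\<And>n. s n \<le> C * g (real n)"
  shows "summable (\<lambda>n. s n * g (real n) powr (1/t))"
    "(\<lambda>n. decr t n * (\<Sum>k\<le>n. s k)) sums (\<Sum>n. s n * g (real n) powr (1/t))"
proof -
  have "summable (\<lambda>n. C * g (real n) powr (1 + 1/t))" by (intro summable_mult zeta_summable t)
  then show 1: "summable (\<lambda>n. s n * g (real n) powr (1/t))"
  proof (rule summable_comparison_test')
    fix n
    have "norm (s n * g (real n) powr (1/t)) \<le> C * g (real n) * g (real n) powr (1/t)"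
      using s[of n] by (simp add: mult_right_mono)
    also have "\<dots> = C * g (real n) powr (1 + 1/t)" using g_pos[of "real n"] by (simp add: powr_add)
    finally show "norm (s n * g (real n) powr (1/t)) \<le> C * g (real n) powr (1 + 1/t)" .
  qed
  show "(\<lambda>n. decr t n * (\<Sum>k\<le>n. s k)) sums (\<Sum>n. s n * g (real n) powr (1/t))"
    unfolding decr_def by (rule abel_summation_sums[OF s(1) u_props(1)[OF t] _ u_props(2)[OF t] 1]) simp
qed

text \<open>
  Comparing \<open>G(n + 1)\<close> with \<open>\<Sum>\<^bsub>k\<le>n\<^esub> g(k)\<close> and undoing the summation by parts bounds the coefficients by the
  zeta function of \<open>g\<close>.
\<close>

lemma decr_G_summable:
  assumes t: "t > t1"
  shows "summable (\<lambda>n. decr t n * G (real (n + 1)))" "(\<Sum>n. decr t n * G (real (n + 1))) \<le> K * G (exp t)"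
proof -
  have s: "(\<lambda>n. decr t n * (\<Sum>k\<le>n. g (real k))) sums (\<Sum>n. g (real n) * g (real n) powr (1/t))"
    by (rule abel_g(2)[OF t, of _ 1]) (use g_pos in \<open>auto intro: less_imp_le\<close>)
  have le: "decr t n * G (real (n + 1)) \<le> decr t n * (\<Sum>k\<le>n. g (real k))" for n
    by (intro mult_left_mono G_le_sum_g decr_nonneg t)
  have nn: "decr t n * G (real (n + 1)) \<ge> 0" for n
    using decr_nonneg[OF t] G_seq(1)[of n] by (intro mult_nonneg_nonneg) auto
  show 1: "summable (\<lambda>n. decr t n * G (real (n + 1)))"
    by (rule summable_comparison_test'[OF sums_summable[OF s], of 0]) (use le nn in simp)
  have "(\<Sum>n. decr t n * G (real (n + 1))) \<le> (\<Sum>n. g (real n) * g (real n) powr (1/t))"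
    by (rule sums_le[OF le summable_sums[OF 1] s])
  also have "\<dots> = (\<Sum>n. g (real n) powr (1 + 1/t))"
    by (simp add: powr_add abs_of_pos g_pos)
  also have "\<dots> \<le> K * G (exp t)" by (rule zeta_bound[OF t])
  finally show "(\<Sum>n. decr t n * G (real (n + 1))) \<le> K * G (exp t)" .
qed

lemma mean_op_summable:
  assumes t: "t > t1" and x: "\<And>n. \<bar>x n\<bar> \<le> X"
  shows "summable (\<lambda>n. decr t n * (G (real (n + 1)) * x n))"
    "\<bar>\<Sum>n. decr t n * (G (real (n + 1)) * x n)\<bar> \<le> X * (\<Sum>n. decr t n * G (real (n + 1)))"
proof -
  have le: "norm (decr t n * (G (real (n + 1)) * x n)) \<le> X * (decr t n * G (real (n + 1)))" for n
  proof -
    have "norm (decr t n * (G (real (n + 1)) * x n)) = (decr t n * G (real (n + 1))) * \<bar>x n\<bar>"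
      using decr_nonneg[OF t, of n] G_seq(1)[of n] by (simp add: abs_mult mult.assoc)
    also have "\<dots> \<le> (decr t n * G (real (n + 1))) * X"
      using decr_nonneg[OF t, of n] G_seq(1)[of n] x by (intro mult_left_mono) auto
    finally show ?thesis by (simp add: mult.commute)
  qed
  have s: "summable (\<lambda>n. X * (decr t n * G (real (n + 1))))" by (intro summable_mult decr_G_summable(1)[OF t])
  have n: "summable (\<lambda>n. norm (decr t n * (G (real (n + 1)) * x n)))"
    by (rule summable_comparison_test'[OF s, of 0]) (use le in simp)
  then show "summable (\<lambda>n. decr t n * (G (real (n + 1)) * x n))" by (rule summable_norm_cancel)
  have "\<bar>\<Sum>n. decr t n * (G (real (n + 1)) * x n)\<bar> \<le> (\<Sum>n. norm (decr t n * (G (real (n + 1)) * x n)))"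
    using summable_norm[OF n] by simp
  also have "\<dots> \<le> (\<Sum>n. X * (decr t n * G (real (n + 1))))" by (rule suminf_le[OF le n s])
  also have "\<dots> = X * (\<Sum>n. decr t n * G (real (n + 1)))" by (rule suminf_mult[OF decr_G_summable(1)[OF t]])
  finally show "\<bar>\<Sum>n. decr t n * (G (real (n + 1)) * x n)\<bar> \<le> X * (\<Sum>n. decr t n * G (real (n + 1)))" .
qed

lemma mean_op_bound:
  assumes t: "t > t1" and x: "\<And>n. \<bar>x n\<bar> \<le> X"
  shows "\<bar>mean_op x t\<bar> \<le> X * K"
proof -
  have X: "X \<ge> 0" using x[of 0] abs_ge_zero order_trans by blast
  have "\<bar>mean_op x t\<bar> \<le> X * (\<Sum>n. decr t n * G (real (n + 1))) / G (exp t)"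
    unfolding mean_op_def abs_divide using mean_op_summable(2)[OF t x] G_exp_pos[of t] by (simp add: divide_right_mono)
  also have "\<dots> \<le> X * (K * G (exp t)) / G (exp t)"
    using decr_G_summable(2)[OF t] X G_exp_pos[of t] by (intro divide_right_mono mult_left_mono) auto
  also have "\<dots> = X * K" using G_exp_pos[of t] by simp
  finally show ?thesis .
qed

lemma K_nonneg: "K \<ge> 0"
  using mean_op_bound[of "t1 + 1" "\<lambda>_. 1" 1] by simp

lemma G_exp_measurable: "(\<lambda>t. G (exp t)) \<in> borel_measurable borel"
  by (rule borel_measurable_mono) (auto simp: mono_def intro: G_mono)

lemma mean_cut_Linf:
  assumes "Bseq x" shows "mean_cut x \<in> Linf"
proof -
  obtain X where X: "X > 0" "\<And>n. \<bar>x n\<bar> \<le> X" using BseqE_abs[OF assms] by metis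
  note [measurable] = G_exp_measurable
  have "mean_cut x \<in> borel_measurable borel" unfolding mean_cut_def mean_op_def decr_def by measurable
  moreover have "\<bar>mean_cut x t\<bar> \<le> X * K" for t
    using mean_op_bound[of t x X] X K_nonneg by (cases "t > t1") (auto simp: mean_cut_def)
  ultimately show ?thesis by (intro LinfI lebesgue_on_borel)
qed

lemma \<Omega>_add:
  assumes x: "Bseq x" and y: "Bseq y" shows "\<Omega> (\<lambda>n. x n + y n) = \<Omega> x + \<Omega> y"
proof -
  obtain X where X: "\<And>n. \<bar>x n\<bar> \<le> X" using BseqE_abs[OF x] by metis
  obtain Y where Y: "\<And>n. \<bar>y n\<bar> \<le> Y" using BseqE_abs[OF y] by metis
  have "mean_cut (\<lambda>n. x n + y n) = (\<lambda>t. mean_cut x t + mean_cut y t)"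
  proof
    fix t
    show "mean_cut (\<lambda>n. x n + y n) t = mean_cut x t + mean_cut y t"
    proof (cases "t > t1")
      case True
      from suminf_add[OF mean_op_summable(1)[where x = x, OF True X] mean_op_summable(1)[where x = y, OF True Y], symmetric] True show ?thesis
        by (simp add: mean_cut_def mean_op_def distrib_left add_divide_distrib)
    qed (simp add: mean_cut_def)
  qed
  then show ?thesis unfolding \<Omega>_def by (simp add: EL_add[OF \<gamma> mean_cut_Linf[OF x] mean_cut_Linf[OF y]])
qed

lemma \<Omega>_scale:
  assumes x: "Bseq x" shows "\<Omega> (\<lambda>n. c * x n) = c * \<Omega> x"
proof -
  obtain X where X: "\<And>n. \<bar>x n\<bar> \<le> X" using BseqE_abs[OF x] by metis
  have "mean_cut (\<lambda>n. c * x n) = (\<lambda>t. c * mean_cut x t)"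
  proof
    fix t
    show "mean_cut (\<lambda>n. c * x n) t = c * mean_cut x t"
    proof (cases "t > t1")
      case True
      from suminf_mult[OF mean_op_summable(1)[where x = x, OF True X], of c] True show ?thesis
        by (simp add: mean_cut_def mean_op_def mult.left_commute)
    qed (simp add: mean_cut_def)
  qed
  then show ?thesis unfolding \<Omega>_def by (simp add: EL_scale[OF \<gamma> mean_cut_Linf[OF x]])
qed

lemma \<Omega>_nonneg:
  assumes x: "Bseq x" "\<And>n. x n \<ge> 0" shows "\<Omega> x \<ge> 0"
  unfolding \<Omega>_def
proof (rule EL_nonneg[OF \<gamma> mean_cut_Linf[OF x(1)]])
  obtain X where X: "\<And>n. \<bar>x n\<bar> \<le> X" using BseqE_abs[OF x(1)] by metis
  fix t
  show "mean_cut x t \<ge> 0"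
  proof (cases "t > t1")
    case True
    have "decr t n * (G (real (n + 1)) * x n) \<ge> 0" for n
      using decr_nonneg[OF True, of n] G_seq(1)[of n] x(2)[of n] by simp
    from suminf_nonneg[OF mean_op_summable(1)[where x = x, OF True X] this] show ?thesis
      using True G_exp_pos[of t] by (simp add: mean_cut_def mean_op_def)
  qed (simp add: mean_cut_def)
qed

text \<open>Each coefficient of the averaging operator is \<open>O(1/G(e\<^sup>t))\<close>, so null sequences are sent to \<open>0\<close>.\<close>

lemma \<Omega>_null:
  assumes x: "x \<longlonglongrightarrow> 0" shows "\<Omega> x = 0"
  unfolding \<Omega>_def
proof (rule EL_lim[OF \<gamma>])
  have B: "Bseq x" using x by (rule tendsto_imp_Bseq)
  then show "mean_cut x \<in> Linf" by (rule mean_cut_Linf)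
  obtain X where X: "\<And>n. \<bar>x n\<bar> \<le> X" using BseqE_abs[OF B] by metis
  show "(mean_cut x \<longlongrightarrow> 0) at_top"
  proof (rule tendstoI)
    fix \<epsilon> :: real assume \<epsilon>: "\<epsilon> > 0"
    define \<delta> where "\<delta> = \<epsilon> / (2 * (K + 1))"
    have \<delta>: "\<delta> > 0" "\<delta> * K < \<epsilon> / 2 + \<epsilon> / 4"
    proof -
      show "\<delta> > 0" using \<epsilon> K_nonneg by (simp add: \<delta>_def)
      then have "\<delta> * K \<le> \<delta> * (K + 1)" by simp
      also have "\<dots> = \<epsilon> / 2"
      proof -
        have "2 * (K + 1) > 0" using K_nonneg by simp
        then have "\<delta> * (2 * (K + 1)) = \<epsilon>" unfolding \<delta>_def by (metis less_irrefl nonzero_eq_divide_eq)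
        then show ?thesis by (simp add: algebra_simps)
      qed
      finally show "\<delta> * K < \<epsilon> / 2 + \<epsilon> / 4" using \<epsilon> by simp
    qed
    obtain N where N: "\<And>n. n \<ge> N \<Longrightarrow> \<bar>x n\<bar> < \<delta>" using LIMSEQ_D[OF x \<delta>(1)] by auto
    \<comment> \<open>\<open>m\<close> bounds every \<open>g(n)\<^bsup>1/t\<^esup>\<close> with \<open>t \<ge> 1\<close>, so \<open>Q\<close> bounds the first \<open>N\<close> terms uniformly in \<open>t\<close>.\<close>
    define m where "m = max 1 (g 0)"
    define Q where "Q = (\<Sum>n<N. m * (G (real (n + 1)) * \<bar>x n\<bar>))"
    have "\<forall>\<^sub>F t in at_top. 4 * Q / \<epsilon> < G (exp t)"
      using filterlim_compose[OF G_at_top exp_at_top] by (simp add: filterlim_at_top_dense)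
    moreover have "\<forall>\<^sub>F t in at_top. t > t1" by (rule eventually_gt_at_top)
    ultimately show "\<forall>\<^sub>F t in at_top. dist (mean_cut x t) 0 < \<epsilon>"
    proof eventually_elim
      case (elim t)
      note t = elim(2)
      define y where "y n = (if n < N then 0 else x n)" for n
      define z where "z n = (if n \<in> {..<N} then decr t n * (G (real (n + 1)) * x n) else 0)" for n
      have y: "\<bar>y n\<bar> \<le> \<delta>" for n using N[of n] \<delta>(1) by (auto simp: y_def)
      have zs: "z sums (\<Sum>n<N. decr t n * (G (real (n + 1)) * x n))"
        unfolding z_def by (rule sums_If_finite_set) simp
      have split: "decr t n * (G (real (n + 1)) * x n) = z n + decr t n * (G (real (n + 1)) * y n)" for n
        by (simp add: z_def y_def)
      have "(\<Sum>n. decr t n * (G (real (n + 1)) * x n)) = (\<Sum>n. z n + decr t n * (G (real (n + 1)) * y n))"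
        by (simp only: split)
      also have "\<dots> = (\<Sum>n. z n) + (\<Sum>n. decr t n * (G (real (n + 1)) * y n))"
        by (rule suminf_add[OF sums_summable[OF zs] mean_op_summable(1)[where x = y, OF t y], symmetric])
      finally have "mean_op x t = (\<Sum>n<N. decr t n * (G (real (n + 1)) * x n)) / G (exp t) + mean_op y t"
        unfolding mean_op_def sums_unique[OF zs, symmetric] by (simp only: add_divide_distrib)
      moreover have "\<bar>mean_op y t\<bar> \<le> \<delta> * K" by (rule mean_op_bound[where x = y, OF t y])
      moreover have "\<bar>(\<Sum>n<N. decr t n * (G (real (n + 1)) * x n)) / G (exp t)\<bar> \<le> Q / G (exp t)"
      proof -
        have "\<bar>\<Sum>n<N. decr t n * (G (real (n + 1)) * x n)\<bar> \<le> (\<Sum>n<N. \<bar>decr t n * (G (real (n + 1)) * x n)\<bar>)" by (rule sum_abs)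
        also have "\<dots> \<le> Q"
          unfolding Q_def
        proof (rule sum_mono)
          fix n
          have "decr t n \<le> g (real n) powr (1/t)" by (simp add: decr_def)
          also have "\<dots> \<le> m powr (1/t)"
            using g_pos[of "real n"] g_antimono[of 0 "real n"] t t1 by (intro powr_mono2) (auto simp: m_def)
          also have "\<dots> \<le> m powr 1" using t t1 by (intro powr_mono) (auto simp: m_def)
          finally have "decr t n \<le> m" by (simp add: m_def)
          then show "\<bar>decr t n * (G (real (n + 1)) * x n)\<bar> \<le> m * (G (real (n + 1)) * \<bar>x n\<bar>)"
            using decr_nonneg[OF t, of n] G_seq(1)[of n] by (simp add: abs_mult mult_right_mono)
        qed
        finally show ?thesis using G_exp_pos[of t] by (simp add: abs_divide divide_right_mono)
      qed
      moreover have "Q / G (exp t) < \<epsilon> / 4"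
        using elim(1) \<epsilon> G_exp_pos[of t] by (simp add: pos_divide_less_eq field_simps)
      ultimately have "\<bar>mean_op x t\<bar> < \<epsilon>" using \<delta>(2) by linarith
      then show ?case using t by (simp add: mean_cut_def)
    qed
  qed
qed

lemma \<Omega>_lim:
  assumes x: "x \<longlonglongrightarrow> l" shows "\<Omega> x = l * \<Omega> (\<lambda>_. 1)"
proof -
  have 1: "Bseq (\<lambda>_. 1 :: real)" by (rule BseqI'[of _ 1]) simp
  have "(\<lambda>n. x n - l) \<longlonglongrightarrow> 0" using tendsto_diff[OF x tendsto_const[of l]] by simp
  then have "Bseq (\<lambda>n. x n - l)" "\<Omega> (\<lambda>n. x n - l) = 0"
    using \<Omega>_null by (auto intro: tendsto_imp_Bseq)
  then show ?thesis
    using \<Omega>_add[of "\<lambda>n. x n - l" "\<lambda>n. l * 1"] Bseq_scale_real[OF 1, of l] \<Omega>_scale[OF 1, of l] by simp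
qed

lemma \<Omega>_normalised:
  assumes "\<Omega> (\<lambda>_. 1) \<noteq> 0"
  shows "(\<lambda>x. \<Omega> x / \<Omega> (\<lambda>_. 1)) \<in> EL_nat"
proof -
  have "Bseq (\<lambda>_. 1 :: real)" by (rule BseqI'[of _ 1]) simp
  then have "\<Omega> (\<lambda>_. 1) \<ge> 0" by (rule \<Omega>_nonneg) simp
  then show ?thesis
    unfolding EL_nat_def using assms
    by (auto simp: \<Omega>_add \<Omega>_scale add_divide_distrib \<Omega>_lim intro!: divide_nonneg_nonneg \<Omega>_nonneg)
qed

text \<open>
  Up to a uniformly small error \<open>s(n)\<^bsup>1+1/t\<^esup>\<close> may be replaced by \<open>s(n) g(n)\<^bsup>1/t\<^esup>\<close>, which is linear in \<open>s\<close>;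
  summation by parts then writes the residue in terms of averages of \<open>s\<close>.
\<close>

lemma zeta_eval:
  assumes s: "\<And>n. 0 \<le> s n" "\<And>n. s n \<le> C * g (real n)" and C: "C \<ge> 1"
    and f: "\<And>t. t > t1 \<Longrightarrow> f t = 1 / G (exp t) * enn2real (\<Sum>n. ennreal (s n powr (1 + 1/t)))"
  shows "EL_eval \<gamma> f = \<Omega> (\<lambda>n. 1 / G (real (n + 1)) * (\<Sum>k\<le>n. s k))"
proof -
  define x where "x n = 1 / G (real (n + 1)) * (\<Sum>k\<le>n. s k)" for n
  have x0: "x n \<ge> 0" for n unfolding x_def using G_seq(1)[of n] by (intro mult_nonneg_nonneg sum_nonneg s) auto
  have xb: "\<bar>x n\<bar> \<le> C * (g 0 / G (real (0 + 1)) + 1)" for n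
    using avg_bounded[OF s, of n] C x0[of n] by (simp add: x_def)
  have Bx: "Bseq x" by (rule BseqI') (use xb in simp)
  define e where "e t = C * (C powr (1/t) - 1) + 1/t" for t
  have main: "f t = (\<Sum>n. s n powr (1 + 1/t)) / G (exp t)" "\<bar>f t - mean_op x t\<bar> \<le> e t * K" if t: "t > t1" for t
  proof -
    have h: "1 / t > 0" using t t1 by simp
    have Ch: "C powr (1/t) \<ge> 1" using C h by (simp add: ge_one_powr_ge_zero)
    have e0: "e t \<ge> 0" unfolding e_def using Ch C h by (intro add_nonneg_nonneg mult_nonneg_nonneg) auto
    let ?a = "\<lambda>n. s n powr (1 + 1/t)" and ?b = "\<lambda>n. s n * g (real n) powr (1/t)" and ?c = "\<lambda>n. g (real n) powr (1 + 1/t)"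
    have pw: "norm (?a n - ?b n) \<le> e t * ?c n" for n
      using powr_perturbation[OF s(1,2) _ C h, of n] g_pos[of "real n"] by (simp add: e_def)
    have sc: "summable (\<lambda>n. e t * ?c n)" by (intro summable_mult zeta_summable t)
    have nd: "summable (\<lambda>n. norm (?a n - ?b n))"
      by (rule summable_comparison_test'[OF sc, of 0]) (use pw in simp)
    have sb: "summable ?b" by (rule abel_g(1)[OF t s])
    have "summable (\<lambda>n. (?a n - ?b n) + ?b n)" by (rule summable_add[OF summable_norm_cancel[OF nd] sb])
    then have sa: "summable ?a" by simp
    have "(\<Sum>n. ennreal (?a n)) = ennreal (\<Sum>n. ?a n)" by (rule suminf_ennreal2[OF _ sa]) simp
    then show ft: "f t = (\<Sum>n. ?a n) / G (exp t)"
      using f[OF t] suminf_nonneg[OF sa] by simp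
    have "(\<lambda>n. decr t n * (G (real (n + 1)) * x n)) = (\<lambda>n. decr t n * (\<Sum>k\<le>n. s k))"
      using G_seq(1) by (auto simp: x_def fun_eq_iff less_imp_neq[symmetric])
    then have "mean_op x t = (\<Sum>n. ?b n) / G (exp t)"
      unfolding mean_op_def using sums_unique[OF abel_g(2)[OF t s]] by simp
    then have "f t - mean_op x t = (\<Sum>n. ?a n - ?b n) / G (exp t)"
      unfolding ft by (simp add: suminf_diff[OF sa sb, symmetric] diff_divide_distrib)
    also have "\<bar>\<dots>\<bar> \<le> (e t * (\<Sum>n. ?c n)) / G (exp t)"
    proof -
      have "\<bar>\<Sum>n. ?a n - ?b n\<bar> \<le> (\<Sum>n. norm (?a n - ?b n))" using summable_norm[OF nd] by simp
      also have "\<dots> \<le> (\<Sum>n. e t * ?c n)" by (rule suminf_le[OF pw nd sc])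
      also have "\<dots> = e t * (\<Sum>n. ?c n)" by (rule suminf_mult[OF zeta_summable[OF t]])
      finally show ?thesis using G_exp_pos[of t] by (simp add: abs_divide divide_right_mono)
    qed
    also have "\<dots> \<le> (e t * (K * G (exp t))) / G (exp t)"
      using zeta_bound[OF t] e0 G_exp_pos[of t] by (intro divide_right_mono mult_left_mono) auto
    also have "\<dots> = e t * K" using G_exp_pos[of t] by simp
    finally show "\<bar>f t - mean_op x t\<bar> \<le> e t * K" .
  qed
  have e_lim: "(e \<longlongrightarrow> 0) at_top"
  proof -
    have i: "((\<lambda>t::real. 1/t) \<longlongrightarrow> 0) at_top" by (rule real_tendsto_divide_at_top[OF tendsto_const filterlim_ident])
    have "((\<lambda>t. C * (C powr (1/t) - 1) + 1/t) \<longlongrightarrow> C * (C powr 0 - 1) + 0) at_top"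
      using C by (intro tendsto_intros i) auto
    then show ?thesis using C by (simp add: e_def[abs_def])
  qed
  have t1p: "t1 > 0" using t1 by simp
  have fm: "f \<in> borel_measurable (lebesgue_on {t1<..})"
  proof -
    note [measurable] = G_exp_measurable
    have "(\<lambda>t. 1 / G (exp t) * enn2real (\<Sum>n. ennreal (s n powr (1 + 1/t)))) \<in> borel_measurable borel" by measurable
    from lebesgue_on_borel[OF this]
    have "(\<lambda>t. 1 / G (exp t) * enn2real (\<Sum>n. ennreal (s n powr (1 + 1/t)))) \<in> borel_measurable (lebesgue_on {t1<..})" .
    then show ?thesis by (subst measurable_cong[of _ f]) (use f in auto)
  qed
  have fb: "bounded (f ` {t1<..})"
  proof (rule boundedI)
    fix y assume "y \<in> f ` {t1<..}"
    then obtain t where t: "t > t1" "y = f t" by auto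
    have "C powr (1/t) \<le> C powr 1" using C t t1 by (intro powr_mono) auto
    then have "C * (C powr (1/t) - 1) \<le> C * (C - 1)" using C by (intro mult_left_mono) auto
    moreover have "1 / t \<le> 1" using t t1 by simp
    ultimately have "e t \<le> C * (C - 1) + 1" by (simp add: e_def)
    then have "e t * K \<le> (C * (C - 1) + 1) * K" using K_nonneg by (rule mult_right_mono)
    then show "norm y \<le> (C * (C - 1) + 1) * K + C * (g 0 / G (real (0 + 1)) + 1) * K"
      using main(2)[OF t(1)] mean_op_bound[where x = x, OF t(1) xb] t(2) by simp
  qed
  have "EL_eval \<gamma> f = \<gamma> (\<lambda>t. f t * indicator {t1<..} t)"
    by (rule EL_eval_eq[OF \<gamma> t1p fm fb])
  also have "\<dots> = \<gamma> (mean_cut x)"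
  proof (rule EL_cong_lim[OF \<gamma> Linf_cutoff[OF t1p fm fb] mean_cut_Linf[OF Bx]])
    show "((\<lambda>t. f t * indicator {t1<..} t - mean_cut x t) \<longlongrightarrow> 0) at_top"
    proof (rule Lim_null_comparison)
      show "\<forall>\<^sub>F t in at_top. norm (f t * indicator {t1<..} t - mean_cut x t) \<le> e t * K"
        using eventually_gt_at_top[of t1] by eventually_elim (use main(2) in \<open>simp add: mean_cut_def\<close>)
      show "((\<lambda>t. e t * K) \<longlongrightarrow> 0) at_top" using tendsto_mult[OF e_lim tendsto_const[of K]] by simp
    qed
  qed
  finally show ?thesis by (simp add: \<Omega>_def x_def[abs_def])
qed

text \<open>
  The normalised functional \<open>\<Omega>\<close> need not be dilation invariant, since the differences of \<open>g\<close> may be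
  irregular.  Its dilation mean is, and it has the same values on averages of sequences dominated by
  \<open>g\<close>, because these vary slowly.
\<close>

lemma ex_invariant_state:
  obtains \<omega> where "\<omega> \<in> EL_nat" "dilation_invariant \<omega>"
    "\<forall>s C. (\<forall>n. 0 \<le> s n \<and> s n \<le> C * g (real n)) \<and> 0 \<le> C \<longrightarrow>
       \<Omega> (\<lambda>n. 1 / G (real (n + 1)) * (\<Sum>k\<le>n. s k)) = \<Omega> (\<lambda>_. 1) * \<omega> (\<lambda>n. 1 / G (real (n + 1)) * (\<Sum>k\<le>n. s k))"
proof -
  define L where "L x = \<gamma> (\<lambda>t. x (nat \<lfloor>t\<rfloor>))" for x :: "nat \<Rightarrow> real"
  have L: "L \<in> EL_nat" unfolding L_def[abs_def] by (rule EL_nat_sample[OF \<gamma>])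
  define c where "c = \<Omega> (\<lambda>_. 1)"
  have B1: "Bseq (\<lambda>_. 1 :: real)" by (rule BseqI'[of _ 1]) simp
  \<comment> \<open>If \<open>\<Omega>\<close> kills the constants it kills every bounded sequence, and any state will do.\<close>
  define \<omega>0 where "\<omega>0 = (if c = 0 then L else (\<lambda>x. \<Omega> x / c))"
  have \<omega>0: "\<omega>0 \<in> EL_nat" using L \<Omega>_normalised by (simp add: \<omega>0_def c_def)
  have key: "\<Omega> x = c * dilation_mean L \<omega>0 x"
    if s: "\<And>n. 0 \<le> s n" "\<And>n. s n \<le> C * g (real n)" "C \<ge> 0" and x: "\<And>n. x n = 1 / G (real (n + 1)) * (\<Sum>k\<le>n. s k)" for s C x
  proof -
    define X where "X = C * (g 0 / G (real (0 + 1)) + 1)"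
    have x0: "x n \<ge> 0" for n unfolding x using G_seq(1)[of n] by (intro mult_nonneg_nonneg sum_nonneg s) auto
    have xb: "x n \<le> X" for n unfolding X_def x by (rule avg_bounded[OF s])
    have Bx: "Bseq x" by (rule BseqI'[of _ X]) (use xb x0 in simp)
    show ?thesis
    proof (cases "c = 0")
      case True
      have "\<Omega> (\<lambda>n. X * 1 + (- 1) * x n) = X * c + - 1 * \<Omega> x"
        using \<Omega>_add[OF Bseq_scale_real[OF B1, of X] Bseq_scale_real[OF Bx, of "- 1"]] \<Omega>_scale[OF B1, of X] \<Omega>_scale[OF Bx, of "- 1"]
        by (simp add: c_def)
      moreover have "\<Omega> (\<lambda>n. X * 1 + (- 1) * x n) \<ge> 0"
      proof (rule \<Omega>_nonneg)
        show "Bseq (\<lambda>n. X * 1 + (- 1) * x n)"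
          by (rule BseqI'[of _ X]) (use xb x0 in \<open>simp add: abs_le_iff\<close>)
      qed (use xb in simp)
      moreover have "\<Omega> x \<ge> 0" by (rule \<Omega>_nonneg[OF Bx x0])
      ultimately show ?thesis using True by simp
    next
      case False
      have "dilation_mean L \<omega>0 x = \<omega>0 x"
        by (rule dilation_mean(3)[OF L \<omega>0 Bx avg_slow[OF s x]])
      then show ?thesis using False by (simp add: \<omega>0_def)
    qed
  qed
  have "\<forall>s C. (\<forall>n. 0 \<le> s n \<and> s n \<le> C * g (real n)) \<and> 0 \<le> C \<longrightarrow>
       \<Omega> (\<lambda>n. 1 / G (real (n + 1)) * (\<Sum>k\<le>n. s k)) = \<Omega> (\<lambda>_. 1) * dilation_mean L \<omega>0 (\<lambda>n. 1 / G (real (n + 1)) * (\<Sum>k\<le>n. s k))"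
    unfolding c_def[symmetric]
  proof (intro allI impI)
    show "\<Omega> (\<lambda>n. 1 / G (real (n + 1)) * (\<Sum>k\<le>n. s k)) = c * dilation_mean L \<omega>0 (\<lambda>n. 1 / G (real (n + 1)) * (\<Sum>k\<le>n. s k))"
      if "(\<forall>n. 0 \<le> s n \<and> s n \<le> C * g (real n)) \<and> 0 \<le> C" for s C
      by (rule key[of s C]) (use that in auto)
  qed
  with dilation_mean(1,2)[OF L \<omega>0] show ?thesis by (rule that)
qed

end


section \<open>Residues on \<open>\<I>\<^sub>g\<close> are multiples of Dixmier traces\<close>

context separable_hilbert
begin

text \<open>
  The inclusion of ideals, applied to the diagonal operator with entries \<open>g(n)\<close>, is a growth bound for
  the zeta function of \<open>g\<close>.
\<close>

lemma zeta_growth: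
  fixes g G :: "real \<Rightarrow> real"
  assumes W: "weight g G" and incl: "(ideal_I g :: ('a \<Rightarrow> 'a) set) \<subseteq> ideal_Z G"
  obtains t1 K where "t1 \<ge> 1" "\<forall>t>t1. summable (\<lambda>n. g (real n) powr (1 + 1/t)) \<and> (\<Sum>n. g (real n) powr (1 + 1/t)) \<le> K * G (exp t)"
proof -
  interpret weight g G by (rule W)
  obtain b :: "nat \<Rightarrow> 'a" where b: "orthonormal_on UNIV b" "closure (cvec.span (range b)) = UNIV"
    "\<forall>x. (\<lambda>n. cinner (b n) x *\<^sub>C b n) sums x"
    by (rule obtain_basis)
  define s where "s n = g (real n)" for n
  have s0: "s \<longlonglongrightarrow> 0" unfolding s_def by (rule filterlim_compose[OF g_lim filterlim_real_sequentially])
  have sn: "s n \<ge> 0" for n using g_pos[of "real n"] by (simp add: s_def)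
  have dec: "decseq s" by (rule decseq_SucI) (simp add: s_def g_antimono)
  define T where "T = diag_op s b"
  have cT: "compact_op T" unfolding T_def by (rule compact_op_diag_op[OF b(1) s0])
  have "Bseq s" using s0 by (rule tendsto_imp_Bseq)
  then have "positive_op T" unfolding T_def by (rule positive_op_diag_op[OF b(1)]) (rule sn)
  from abs_op_positive[OF cT this] have abs: "abs_op T = diag_op s b" by (simp add: T_def)
  have sv: "singular_value T = s" by (rule singular_value_eqI[OF b(1) s0 dec sn abs])
  have "T \<in> ideal_I g"
    unfolding ideal_I_iff sv using cT sn by (intro conjI exI[of _ 1]) (auto simp: s_def)
  then have "T \<in> ideal_Z G" using incl by blast
  then have "Limsup at_top (\<lambda>t::real. trace_op (powr_op (abs_op T) (1 + 1/t)) / ennreal (G (exp t))) < \<infinity>"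
    by (simp add: ideal_Z_def)
  then obtain c where c: "Limsup at_top (\<lambda>t::real. trace_op (powr_op (abs_op T) (1 + 1/t)) / ennreal (G (exp t))) < c" "c < \<infinity>"
    using dense by blast
  obtain K where K: "c = ennreal K" "K \<ge> 0" using c(2) by (cases c) auto
  from Limsup_lessD[OF c(1)] obtain t0
    where t0: "\<And>t. t \<ge> t0 \<Longrightarrow> trace_op (powr_op (abs_op T) (1 + 1/t)) / ennreal (G (exp t)) < c"
    by (auto simp: eventually_at_top_linorder)
  have "summable (\<lambda>n. g (real n) powr (1 + 1/t)) \<and> (\<Sum>n. g (real n) powr (1 + 1/t)) \<le> K * G (exp t)"
    if t: "t > max t0 1" for t
  proof -
    have Gt: "G (exp t) > 0" by (rule G_pos) simp
    have p: "1 + 1/t > 0" using t by (simp add: add_pos_pos)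
    define S where "S = (\<Sum>n. ennreal (s n powr (1 + 1/t)))"
    have "t \<ge> t0" using t by simp
    from t0[OF this] have "S / ennreal (G (exp t)) < ennreal K"
      unfolding trace_powr_abs_op[OF cT p] sv K(1) S_def .
    then have "S / ennreal (G (exp t)) * ennreal (G (exp t)) \<le> ennreal K * ennreal (G (exp t))"
      by (rule mult_right_mono[OF less_imp_le]) simp
    moreover have "ennreal (G (exp t)) / ennreal (G (exp t)) = 1"
      using Gt by (intro ennreal_divide_self) auto
    ultimately have "S \<le> ennreal K * ennreal (G (exp t))"
      unfolding ennreal_divide_times by simp
    also have "\<dots> = ennreal (K * G (exp t))"
      using Gt by (intro ennreal_mult''[symmetric]) simp
    finally have le: "(\<Sum>n. ennreal (s n powr (1 + 1/t))) \<le> ennreal (K * G (exp t))"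
      unfolding S_def .
    then have ne: "(\<Sum>n. ennreal (s n powr (1 + 1/t))) \<noteq> top"
      by (rule less_imp_neq[OF le_less_trans[OF _ ennreal_less_top]])
    have sm: "summable (\<lambda>n. s n powr (1 + 1/t))" by (rule summable_suminf_not_top[OF _ ne]) simp
    have "ennreal (\<Sum>n. s n powr (1 + 1/t)) \<le> ennreal (K * G (exp t))"
      using le unfolding suminf_ennreal2[OF powr_ge_zero sm] .
    then have "(\<Sum>n. s n powr (1 + 1/t)) \<le> K * G (exp t)" using K(2) Gt by (subst (asm) ennreal_le_iff) auto
    with sm show ?thesis unfolding s_def by blast
  qed
  then show ?thesis using that[of "max t0 1" K] by simp
qed

text \<open>
  The real and imaginary parts of an operator in the ideal, and their positive and negative parts, stay
  in the ideal, and for each of these four positive operators the residue is \<open>\<Omega>(1)\<close> times \<open>\<omega>\<close> of its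
  averages.
\<close>

theorem zeta_residue_proportional:
  fixes g G :: "real \<Rightarrow> real" and \<zeta> :: "('a \<Rightarrow> 'a) \<Rightarrow> complex"
  assumes W: "weight g G" and incl: "(ideal_I g :: ('a \<Rightarrow> 'a) set) \<subseteq> ideal_Z G"
    and zeta: "zeta_residue_on_I g G \<zeta>"
  shows "\<exists>\<phi> c. dixmier_trace_on_I g G \<phi> \<and> (\<forall>T \<in> ideal_I g. \<zeta> T = c * \<phi> T)"
proof -
  obtain \<gamma> where \<gamma>: "\<gamma> \<in> EL_half_line" and \<zeta>: "\<And>T. T \<in> ideal_I g \<Longrightarrow> \<zeta> T = zeta_residue G \<gamma> T"
    using zeta by (auto simp: zeta_residue_on_I_def)
  obtain t1 K where t1: "t1 \<ge> 1"
    "\<forall>t>t1. summable (\<lambda>n. g (real n) powr (1 + 1/t)) \<and> (\<Sum>n. g (real n) powr (1 + 1/t)) \<le> K * G (exp t)"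
    by (rule zeta_growth[OF W incl])
  interpret zeta_setting g G \<gamma> t1 K
    by (intro zeta_setting.intro zeta_setting_axioms.intro W \<gamma>) (use t1 in auto)
  define c where "c = \<Omega> (\<lambda>_. 1)"
  obtain \<omega> where \<omega>: "\<omega> \<in> EL_nat" "dilation_invariant \<omega>" and
    rep: "\<forall>s C. (\<forall>n. 0 \<le> s n \<and> s n \<le> C * g (real n)) \<and> 0 \<le> C \<longrightarrow>
       \<Omega> (\<lambda>n. 1 / G (real (n + 1)) * (\<Sum>k\<le>n. s k)) = \<Omega> (\<lambda>_. 1) * \<omega> (\<lambda>n. 1 / G (real (n + 1)) * (\<Sum>k\<le>n. s k))"
    by (rule ex_invariant_state)
  interpret dixmier_setting G \<omega>
    by (intro dixmier_setting.intro separable_hilbert_axioms dixmier_setting_axioms.intro G_seq \<omega>)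
  have pos: "zeta_pos G \<gamma> P = c * \<omega> (lorentz_avg G P)"
    if P: "compact_op P" "positive_op P" and le: "\<And>n. singular_value P n \<le> C * g (real n)" and C: "C \<ge> 1" for P :: "'a \<Rightarrow> 'a" and C
  proof -
    have "zeta_pos G \<gamma> P = \<Omega> (\<lambda>n. 1 / G (real (n + 1)) * (\<Sum>k\<le>n. singular_value P k))"
      unfolding zeta_pos_def
    proof (rule zeta_eval[OF singular_value_basic(3)[OF P(1)] le C])
      fix t assume "t > t1"
      then have "1 + 1/t > 0" using t1 by (simp add: add_pos_pos)
      from trace_powr_abs_op[OF P(1) this]
      show "1 / G (exp t) * enn2real (trace_op (powr_op P (1 + 1/t)))
          = 1 / G (exp t) * enn2real (\<Sum>n. ennreal (singular_value P n powr (1 + 1/t)))"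
        unfolding abs_op_positive[OF P] by simp
    qed
    also have "\<dots> = c * \<omega> (\<lambda>n. 1 / G (real (n + 1)) * (\<Sum>k\<le>n. singular_value P k))"
      using rep[rule_format, of "singular_value P" C] le C singular_value_basic(3)[OF P(1)] by (simp add: c_def)
    finally show ?thesis unfolding lorentz_avg_def[abs_def] .
  qed
  have "\<zeta> T = of_real c * dixmier_ext G \<omega> T" if T: "T \<in> ideal_I g" for T
  proof -
    obtain C0 where cT: "compact_op T" and C0: "\<And>n. \<bar>singular_value T n\<bar> \<le> C0 * g (real n)"
      using T by (auto simp: ideal_I_iff)
    obtain Cd where Cd: "Cd > 0" "\<And>k. g (real (k div 2)) \<le> Cd * g (real k)" by (rule g_div2_le) blast
    define C where "C = max 1 (\<bar>C0\<bar> * Cd)"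
    have half: "singular_value T (n div 2) \<le> C * g (real n)" for n
    proof -
      have "C0 * g (real (n div 2)) \<le> \<bar>C0\<bar> * g (real (n div 2))"
        using g_pos[of "real (n div 2)"] by (intro mult_right_mono) auto
      then have "singular_value T (n div 2) \<le> \<bar>C0\<bar> * g (real (n div 2))"
        using C0[of "n div 2"] by linarith
      also have "\<dots> \<le> \<bar>C0\<bar> * (Cd * g (real n))" by (intro mult_left_mono Cd) simp
      also have "\<dots> \<le> C * g (real n)"
        using g_pos[of "real n"] unfolding mult.assoc[symmetric] by (intro mult_right_mono) (auto simp: C_def)
      finally show ?thesis .
    qed
    note ri = Re_Im_op[OF cT]
    note pr = parts_selfadjoint[OF ri(1,2)] and pi = parts_selfadjoint[OF ri(3,4)]
    have z: "zeta_pos G \<gamma> (pos_part_op (Re_op T)) = c * \<omega> (lorentz_avg G (pos_part_op (Re_op T)))"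
      "zeta_pos G \<gamma> (neg_part_op (Re_op T)) = c * \<omega> (lorentz_avg G (neg_part_op (Re_op T)))"
      "zeta_pos G \<gamma> (pos_part_op (Im_op T)) = c * \<omega> (lorentz_avg G (pos_part_op (Im_op T)))"
      "zeta_pos G \<gamma> (neg_part_op (Im_op T)) = c * \<omega> (lorentz_avg G (neg_part_op (Im_op T)))"
      using order_trans[OF pr(6) order_trans[OF ri(5) half]] order_trans[OF pr(7) order_trans[OF ri(5) half]]
        order_trans[OF pi(6) order_trans[OF ri(6) half]] order_trans[OF pi(7) order_trans[OF ri(6) half]]
      by (auto intro!: pos[where C = C] pr(1-4) pi(1-4) simp: C_def)
    show ?thesis
      unfolding \<zeta>[OF T] zeta_residue_def z dixmier_ext_def by (simp add: algebra_simps)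
  qed
  moreover have "dixmier_trace_on_I g G (dixmier_ext G \<omega> :: ('a \<Rightarrow> 'a) \<Rightarrow> complex)"
    unfolding dixmier_trace_on_I_def using dixmier_trace_dixmier_ext by blast
  ultimately show ?thesis by blast
qed

end

theorem proposition2p24:
  fixes g G :: "real \<Rightarrow> real"
    and \<zeta> :: "('h::complex_hilbert_space \<Rightarrow> 'h) \<Rightarrow> complex"
  assumes separable: "\<exists>D :: 'h set. countable D \<and> closure D = UNIV"
    and infinite_dim: "\<not> (\<exists>B :: 'h set. finite B \<and> cvec.span B = UNIV)"
    and g: "g \<in> decay_class"
    and G: "\<And>t. t \<ge> 0 \<Longrightarrow> G t = integral {0..t} g"
    and incl: "(ideal_I g :: ('h \<Rightarrow> 'h) set) \<subseteq> ideal_Z G"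
    and zeta: "zeta_residue_on_I g G \<zeta>"
  shows "\<exists>\<phi> c. dixmier_trace_on_I g G \<phi> \<and> (\<forall>T \<in> ideal_I g. \<zeta> T = c * \<phi> T)"
proof -
  have "separable_hilbert TYPE('h)"
    using separable infinite_dim by (rule separable_hilbert.intro)
  moreover have "weight g G"
    using g G by (rule weight.intro)
  ultimately show ?thesis
    using incl zeta by (rule separable_hilbert.zeta_residue_proportional)
qed


end
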